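(* Let $b,c$ be positive integers with $bc\le 4$. Then there exists a unique $\mathbb{Z}$-basis $\mathcal{B}$ of the cluster algebra $\mathcal{A}(b,c)$ such that the semiring of positive elements of $\mathcal{A}(b,c)$ consists precisely of the positive integer linear combinations of elements of $\mathcal{B}$ (i.e. the finite non-empty sums of elements of $\mathcal{B}$ with positive integer coefficients).
   Context: Let $\mathcal{F}=\mathbb{Q}(y_1,y_2)$ be the field of rational functions in two commuting independent variables. For positive integers $b,c$ define $y_m\in\mathcal{F}$ for all $m\in\mathbb{Z}$ recursively by the exchange relations $y_{m-1}y_{m+1}=y_m^b+1$ for $m$ odd and $y_{m-1}y_{m+1}=y_m^c+1$ for $m$ even. The cluster algebra $\mathcal{A}(b,c)$ is the subring of $\mathcal{F}$ generated by all $y_m$, $m\in\mathbb{Z}$ (the cluster variables). The sets $\{y_m,y_{m+1}\}$ are called clusters. It is known (Laurent phenomenon) that for each $m\in\mathbb{Z}$ every element of $\mathcal{A}(b,c)$ is uniquely a Laurent polynomial with integer coefficients in $y_m$ and $y_{m+1}$. A non-zero element $y\in\mathcal{A}(b,c)$ is called positive if for every $m\in\mathbb{Z}$ all the (non-zero) coefficients in the expansion of $y$ as a Laurent polynomial in $y_m$ and $y_{m+1}$ are positive. The set of positive elements is closed under addition and multiplication (it is called the semiring of positive elements). *)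

theory Defs
  imports
    Complex_Main
    "HOL-Library.Poly_Mapping"
    "HOL-Computational_Algebra.Polynomial"
    "HOL-Computational_Algebra.Fraction_Field"
begin

text \<open>
  The ambient field is the fraction field of \<open>\<rat>[y\<^sub>1][y\<^sub>2]\<close>, with \<open>y\<^sub>1\<close> the inner and
  \<open>y\<^sub>2\<close> the outer polynomial variable.
\<close>

type_synonym ratfun2 = "rat poly poly fract"

definition y1 :: ratfun2 where
  "y1 = Fract [:[:0, 1:]:] 1"

definition y2 :: ratfun2 where
  "y2 = Fract [:0, 1:] 1"

definition exch_exp :: "nat \<Rightarrow> nat \<Rightarrow> int \<Rightarrow> nat" where
  "exch_exp b c m = (if odd m then b else c)"

text \<open>
  The recursion solves the exchange relations outwards from the initial cluster \<open>{y\<^sub>1, y\<^sub>2}\<close>;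
  lemma \<open>exchange_relation\<close> below confirms that no division by zero occurs.
\<close>

function cluster_var :: "nat \<Rightarrow> nat \<Rightarrow> int \<Rightarrow> ratfun2" where
  "cluster_var b c m =
     (if m = 1 then y1
      else if m = 2 then y2
      else if m > 2 then
        (cluster_var b c (m - 1) ^ exch_exp b c (m - 1) + 1) / cluster_var b c (m - 2)
      else
        (cluster_var b c (m + 1) ^ exch_exp b c (m + 1) + 1) / cluster_var b c (m + 2))"
  by pat_completeness auto
termination
  by (relation "Wellfounded.measure (\<lambda>(b, c, m). nat \<bar>2 * m - 3\<bar>)") auto

declare cluster_var.simps [simp del]

lemma cluster_var_initial: "cluster_var b c 1 = y1" "cluster_var b c 2 = y2"
  by (simp_all add: cluster_var.simps)

text \<open>Positivity is taken in the library's ordering of the fraction field (by leading coefficients).\<close>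

lemma cluster_var_pos: "cluster_var b c m > 0"
proof (induction b c m rule: cluster_var.induct)
  case (1 b c m)
  have "[:[:0, 1:]:] > (0 :: rat poly poly)" "[:0, 1:] > (0 :: rat poly poly)"
    by (simp_all add: less_poly_def pos_poly_def)
  then have "y1 > 0" "y2 > 0"
    by (simp_all add: y1_def y2_def Fraction_Field.zero_less_Fract_iff)
  with 1 show ?case
    by (subst cluster_var.simps) (auto intro!: divide_pos_pos add_pos_pos zero_less_power)
qed

lemma exchange_relation:
  "cluster_var b c (m - 1) * cluster_var b c (m + 1) =
     cluster_var b c m ^ (if odd m then b else c) + 1"
proof (cases "m \<ge> 2")
  case True
  then have "cluster_var b c (m + 1) =
      (cluster_var b c m ^ exch_exp b c m + 1) / cluster_var b c (m - 1)"
    by (subst cluster_var.simps) auto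
  then show ?thesis
    using cluster_var_pos[of b c "m - 1"] by (simp add: exch_exp_def)
next
  case False
  then have "cluster_var b c (m - 1) =
      (cluster_var b c m ^ exch_exp b c m + 1) / cluster_var b c (m + 1)"
    by (subst cluster_var.simps) (auto simp: add.commute)
  then show ?thesis
    using cluster_var_pos[of b c "m + 1"] by (simp add: exch_exp_def)
qed

inductive_set subring_generated :: "'a::ring_1 set \<Rightarrow> 'a set" for S :: "'a set" where
  generator: "x \<in> S \<Longrightarrow> x \<in> subring_generated S"
| one: "1 \<in> subring_generated S"
| diff: "x \<in> subring_generated S \<Longrightarrow> y \<in> subring_generated S \<Longrightarrow> x - y \<in> subring_generated S"
| mult: "x \<in> subring_generated S \<Longrightarrow> y \<in> subring_generated S \<Longrightarrow> x * y \<in> subring_generated S"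

definition cluster_algebra :: "nat \<Rightarrow> nat \<Rightarrow> ratfun2 set" where
  "cluster_algebra b c = subring_generated (range (cluster_var b c))"

text \<open>
  An integer Laurent polynomial in two variables is given by its finitely supported
  coefficient function on exponent pairs.
\<close>

definition laurent_eval :: "((int \<times> int) \<Rightarrow>\<^sub>0 int) \<Rightarrow> 'a::field \<Rightarrow> 'a \<Rightarrow> 'a" where
  "laurent_eval f u v =
     (\<Sum>(i, j)\<in>Poly_Mapping.keys f. of_int (Poly_Mapping.lookup f (i, j)) * u powi i * v powi j)"

text \<open>
  Every element of the cluster algebra has exactly one expansion \<open>f\<close> in each cluster, so
  the existential quantifier over \<open>f\<close> refers to the expansion in \<open>y\<^sub>m\<close> and \<open>y\<^sub>m\<^sub>+\<^sub>1\<close>.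
  The set \<open>keys f\<close> indexes precisely its non-zero coefficients.
\<close>

definition positive_elements :: "nat \<Rightarrow> nat \<Rightarrow> ratfun2 set" where
  "positive_elements b c =
     {y \<in> cluster_algebra b c. y \<noteq> 0 \<and>
        (\<forall>m. \<exists>f. y = laurent_eval f (cluster_var b c m) (cluster_var b c (m + 1)) \<and>
                 (\<forall>k\<in>Poly_Mapping.keys f. Poly_Mapping.lookup f k > 0))}"

abbreviation int_scale :: "int \<Rightarrow> 'a::comm_ring_1 \<Rightarrow> 'a" where
  "int_scale \<equiv> \<lambda>n x. of_int n * x"

interpretation int_module: module "int_scale :: int \<Rightarrow> 'a::comm_ring_1 \<Rightarrow> 'a"
  by unfold_locales (simp_all add: algebra_simps)

definition is_int_basis :: "'a::comm_ring_1 set \<Rightarrow> 'a set \<Rightarrow> bool" where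
  "is_int_basis B M \<longleftrightarrow> int_module.independent B \<and> int_module.span B = M"

definition pos_int_combinations :: "'a::comm_ring_1 set \<Rightarrow> 'a set" where
  "pos_int_combinations B =
     {\<Sum>x\<in>S. of_int (n x) * x | S (n :: 'a \<Rightarrow> int).
        finite S \<and> S \<noteq> {} \<and> S \<subseteq> B \<and> (\<forall>x\<in>S. n x > 0)}"

end

theory Submission
  imports Defs "HOL-Library.Product_Plus"
begin

text \<open>
  The basis consists of all cluster monomials together with, if \<open>b c = 4\<close>, the Chebyshev polynomials
  (of the first kind) \<open>z\<^sub>n\<close> in a distinguished element \<open>z\<close>. Three facts carry the proof.

  Positivity: in finite type the expansions are computed outright. In affine type \<open>z = a + 1/a + s\<close> with
  a monomial \<open>a\<close> and a positive \<open>s\<close>, and a recurrence \<open>E\<^sub>k\<^sub>+\<^sub>1 = z E\<^sub>k - E\<^sub>k\<^sub>-\<^sub>1\<close> becomes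
  subtraction-free in terms of \<open>E\<^sub>k\<close> and \<open>E\<^sub>k\<^sub>+\<^sub>1 - a E\<^sub>k\<close>.

  Spanning: for every \<open>(p, q)\<close> some basis element has \<open>y\<^sub>1\<close> and \<open>y\<^sub>2\<close> exponents at least \<open>-p\<close> and
  \<open>-q\<close>, with coefficient 1 at \<open>(-p, -q)\<close>. Subtract such elements greedily from an element of
  the algebra. Since that element is also a Laurent polynomial in the two neighbouring clusters, its
  rows and columns are divisible by powers of \<open>1 + y\<^sub>1\<^sup>b\<close> and \<open>1 + y\<^sub>2\<^sup>c\<close>, which keeps the supports in
  a fixed box, so the procedure stops.

  Properness: in the expansion of a basis element in any cluster, a monomial with non-negative exponents
  occurs only if the element is that monomial: for every other cluster there are non-negative weights
  under which its non-trivial monomials have negative degree. The coefficient of the monomial \<open>y\<^sub>m\<^sup>p y\<^sub>m\<^sub>+\<^sub>1\<^sup>q\<close> therefore reads off the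
  coordinate of this basis element, and the coordinate of \<open>z\<^sub>n\<close> is the coefficient of \<open>a\<^sup>-\<^sup>n\<close> in a cluster far
  to the left. Thus the elements are independent and positive elements have non-negative coordinates.
\<close>

section \<open>Laurent expansions\<close>

text \<open>Basis elements are indexed by their denominators \<open>(p, q)\<close>, which run
  through all integer pairs. The cones spanned by the denominators of neighbouring cluster variables
  fill the plane in finite type. In affine type they miss one open ray, whose lattice points are the
  denominators of the elements \<open>cheb z n\<close>. The first kind of Chebyshev polynomials is
  chosen because it sends \<open>t + 1/t\<close> to \<open>t^n + 1/t^n\<close>: on the edge carrying
  \<open>a\<close> and \<open>1/a\<close> only two terms are left, and different \<open>n\<close>
  are separated. Powers of \<open>z\<close> would leave further terms there. A fixed cluster cannot
  supply the coordinate of \<open>cheb z n\<close>, as products of variables further left may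
  contain \<open>a^-n\<close> as well. The cluster is therefore chosen after the finitely many
  elements involved, which is enough for finite sums. Weights come from the tropical exchange
  relation, run backwards from negative values at the two indices of the other cluster; positivity
  is what makes degrees obey this relation. All arguments concern abstract exchange sequences, so
  that shift and reflection leave only the expansion in \<open>x 1\<close>, \<open>x 2\<close> with
  \<open>b \<le> c\<close>.\<close>

lemma laurent_eval_superset:
  assumes "finite K" "Poly_Mapping.keys f \<subseteq> K"
  shows "laurent_eval f u v =
    (\<Sum>k\<in>K. of_int (Poly_Mapping.lookup f k) * u powi fst k * v powi snd k)"
  unfolding laurent_eval_def case_prod_unfold prod.collapse
  by (rule sum.mono_neutral_left) (use assms in \<open>auto simp: in_keys_iff\<close>)

lemma laurent_eval_zero [simp]: "laurent_eval 0 u v = 0"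
  by (simp add: laurent_eval_def)

lemma laurent_eval_single:
  "laurent_eval (Poly_Mapping.single k c) u v = of_int c * u powi fst k * v powi snd k"
  by (subst laurent_eval_superset[of "{k}"]) auto

lemma laurent_eval_one [simp]: "laurent_eval 1 u v = 1"
  unfolding single_one[symmetric] laurent_eval_single by simp

lemma laurent_eval_add: "laurent_eval (f + g) u v = laurent_eval f u v + laurent_eval g u v"
  by (subst (1 2 3) laurent_eval_superset[of "Poly_Mapping.keys f \<union> Poly_Mapping.keys g"])
    (auto simp: lookup_add algebra_simps sum.distrib dest: set_mp[OF Poly_Mapping.keys_add])

lemma laurent_eval_uminus: "laurent_eval (- f) u v = - laurent_eval f u v"
  using laurent_eval_add[of f "- f" u v] by (simp add: add_eq_0_iff)

lemma laurent_eval_diff: "laurent_eval (f - g) u v = laurent_eval f u v - laurent_eval g u v"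
  using laurent_eval_add[of f "- g" u v] by (simp add: laurent_eval_uminus)

text \<open>Both sides are additive in \<open>f\<close> and in \<open>g\<close>, so induction over
  the free abelian group on exponent pairs reduces the claim to monomials.\<close>

lemma laurent_eval_mult:
  assumes "u \<noteq> 0" "v \<noteq> 0"
  shows "laurent_eval (f * g) u v = laurent_eval f u v * laurent_eval g u v"
proof (rule frag_induction[where c = f and S = UNIV])
  show "laurent_eval (frag_of k * g) u v = laurent_eval (frag_of k) u v * laurent_eval g u v" for k
  proof (rule frag_induction[where c = g and S = UNIV])
    show "laurent_eval (frag_of k * frag_of l) u v = laurent_eval (frag_of k) u v * laurent_eval (frag_of l) u v" for l
      using assms by (simp add: mult_single laurent_eval_single power_int_add)
  qed (auto simp: laurent_eval_diff algebra_simps)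
qed (auto simp: laurent_eval_diff algebra_simps)

lemma laurent_eval_power:
  assumes "u \<noteq> 0" "v \<noteq> 0"
  shows "laurent_eval (f ^ n) u v = laurent_eval f u v ^ n"
  by (induction n) (simp_all add: laurent_eval_mult assms)

lemma laurent_eval_sum: "laurent_eval (sum f A) u v = (\<Sum>x\<in>A. laurent_eval (f x) u v)"
  by (induction A rule: infinite_finite_induct) (simp_all add: laurent_eval_add)

lemma laurent_eval_frag_cmul:
  "laurent_eval (frag_cmul c f) u v = of_int c * laurent_eval f u v"
  by (subst (1 2) laurent_eval_superset[of "Poly_Mapping.keys f"])
     (auto simp: sum_distrib_left algebra_simps)

definition swap_exponents :: "((int \<times> int) \<Rightarrow>\<^sub>0 int) \<Rightarrow> ((int \<times> int) \<Rightarrow>\<^sub>0 int)" where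
  "swap_exponents f = Poly_Mapping.map_key prod.swap f"

lemma lookup_swap_exponents [simp]:
  "Poly_Mapping.lookup (swap_exponents f) k = Poly_Mapping.lookup f (prod.swap k)"
  unfolding swap_exponents_def by (subst map_key.rep_eq) auto

lemma keys_swap_exponents: "Poly_Mapping.keys (swap_exponents f) = prod.swap ` Poly_Mapping.keys f"
  by (force simp: in_keys_iff image_iff)

lemma laurent_eval_swap: "laurent_eval (swap_exponents f) u v = laurent_eval f v u"
proof -
  have "laurent_eval (swap_exponents f) u v =
    (\<Sum>k\<in>prod.swap ` Poly_Mapping.keys f. of_int (Poly_Mapping.lookup (swap_exponents f) k) * u powi fst k * v powi snd k)"
    by (rule laurent_eval_superset) (simp_all add: keys_swap_exponents)
  also have "\<dots> = (\<Sum>k\<in>Poly_Mapping.keys f. of_int (Poly_Mapping.lookup f k) * v powi fst k * u powi snd k)"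
    by (subst sum.reindex) (auto simp: inj_on_def ac_simps intro!: sum.cong)
  also have "\<dots> = laurent_eval f v u"
    by (rule laurent_eval_superset[symmetric]) auto
  finally show ?thesis .
qed

text \<open>Algebraic independence over the integers, phrased with Laurent polynomials so that it
  directly yields uniqueness of expansions.\<close>

definition laurent_indep :: "'a::field \<Rightarrow> 'a \<Rightarrow> bool" where
  "laurent_indep u v \<longleftrightarrow> u \<noteq> 0 \<and> v \<noteq> 0 \<and> (\<forall>f. laurent_eval f u v = 0 \<longrightarrow> f = 0)"

lemma laurent_indepD: "laurent_indep u v \<Longrightarrow> laurent_eval f u v = laurent_eval g u v \<Longrightarrow> f = g"
  unfolding laurent_indep_def using laurent_eval_diff[of f g u v] by force

lemma laurent_indep_sym: "laurent_indep u v \<Longrightarrow> laurent_indep v u"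
  unfolding laurent_indep_def
  by (metis laurent_eval_swap lookup_swap_exponents lookup_zero poly_mapping_eqI swap_swap)

section \<open>Laurent polynomials with non-negative coefficients\<close>

definition nonneg_coeffs :: "((int \<times> int) \<Rightarrow>\<^sub>0 int) \<Rightarrow> bool" where
  "nonneg_coeffs f \<longleftrightarrow> (\<forall>k. 0 \<le> Poly_Mapping.lookup f k)"

lemma nonneg_coeffs_add: "nonneg_coeffs f \<Longrightarrow> nonneg_coeffs g \<Longrightarrow> nonneg_coeffs (f + g)"
  by (simp add: nonneg_coeffs_def lookup_add)

lemma nonneg_coeffs_mult: "nonneg_coeffs f \<Longrightarrow> nonneg_coeffs g \<Longrightarrow> nonneg_coeffs (f * g)"
  unfolding nonneg_coeffs_def lookup_mult Sum_any.expand_set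
  by (intro allI sum_nonneg mult_nonneg_nonneg) (auto simp: when_def)

lemma nonneg_coeffs_one: "nonneg_coeffs 1"
  by (simp add: nonneg_coeffs_def lookup_one when_def)

lemma nonneg_coeffs_power: "nonneg_coeffs f \<Longrightarrow> nonneg_coeffs (f ^ n)"
  by (induction n) (simp_all add: nonneg_coeffs_one nonneg_coeffs_mult)

lemma keys_add_nonneg:
  assumes "nonneg_coeffs f" "nonneg_coeffs g"
  shows "Poly_Mapping.keys (f + g) = Poly_Mapping.keys f \<union> Poly_Mapping.keys g"
  using assms unfolding nonneg_coeffs_def
  by (auto simp: in_keys_iff lookup_add add_nonneg_eq_0_iff)

text \<open>Split \<open>f\<close> and \<open>g\<close> into the chosen term and the rest: all other
  products have non-negative coefficients, so nothing can cancel the chosen one.\<close>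

lemma lookup_mult_ge:
  assumes f: "nonneg_coeffs f" and g: "nonneg_coeffs g"
  shows "Poly_Mapping.lookup (f * g) (k + l) \<ge> Poly_Mapping.lookup f k * Poly_Mapping.lookup g l"
proof -
  define a b where "a = Poly_Mapping.lookup f k" "b = Poly_Mapping.lookup g l"
  define f' g' where "f' = f - Poly_Mapping.single k a" "g' = g - Poly_Mapping.single l b"
  have *: "nonneg_coeffs f'" "nonneg_coeffs g'" "nonneg_coeffs (Poly_Mapping.single k a)"
    "nonneg_coeffs (Poly_Mapping.single l b)"
    using f g by (auto simp: f'_g'_def a_b_def nonneg_coeffs_def lookup_minus lookup_single when_def)
  have "f = f' + Poly_Mapping.single k a" "g = g' + Poly_Mapping.single l b"
    by (simp_all add: f'_g'_def)
  then have "f * g = Poly_Mapping.single (k + l) (a * b) +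
      (f' * g' + Poly_Mapping.single k a * g' + f' * Poly_Mapping.single l b)"
    by (simp add: algebra_simps mult_single)
  then have "Poly_Mapping.lookup (f * g) (k + l) = a * b +
      Poly_Mapping.lookup (f' * g' + Poly_Mapping.single k a * g' + f' * Poly_Mapping.single l b) (k + l)"
    by (simp only: lookup_add lookup_single) simp
  moreover have "nonneg_coeffs (f' * g' + Poly_Mapping.single k a * g' + f' * Poly_Mapping.single l b)"
    by (intro nonneg_coeffs_add nonneg_coeffs_mult *)
  ultimately show ?thesis
    unfolding nonneg_coeffs_def a_b_def by (metis le_add_same_cancel1)
qed

lemma keys_mult_nonneg:
  assumes "nonneg_coeffs f" "nonneg_coeffs g" "k \<in> Poly_Mapping.keys f" "l \<in> Poly_Mapping.keys g"
  shows "k + l \<in> Poly_Mapping.keys (f * g)"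
proof -
  have "0 < Poly_Mapping.lookup f k * Poly_Mapping.lookup g l"
    using assms unfolding nonneg_coeffs_def by (metis in_keys_iff mult_pos_pos order.strict_iff_order)
  then show ?thesis
    using lookup_mult_ge[OF assms(1,2), of k l] by (auto simp: in_keys_iff)
qed

text \<open>
  The flag selects between arbitrary and non-negative coefficients, so that both kinds of
  expansions share their closure properties.
\<close>

definition laurents :: "bool \<Rightarrow> (int \<times> int) set \<Rightarrow> 'a::field \<Rightarrow> 'a \<Rightarrow> 'a set" where
  "laurents P S u v =
     {laurent_eval f u v | f. Poly_Mapping.keys f \<subseteq> S \<and> (P \<longrightarrow> nonneg_coeffs f)}"

lemma laurents_mono: "y \<in> laurents P S u v \<Longrightarrow> S \<subseteq> T \<Longrightarrow> (Q \<Longrightarrow> P) \<Longrightarrow> y \<in> laurents Q T u v"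
  unfolding laurents_def by blast

lemma laurents_zero: "0 \<in> laurents P S u v"
  unfolding laurents_def by (auto intro!: exI[of _ 0] simp: nonneg_coeffs_def)

lemma laurents_add: "y \<in> laurents P S u v \<Longrightarrow> y' \<in> laurents P S u v \<Longrightarrow> y + y' \<in> laurents P S u v"
proof -
  assume "y \<in> laurents P S u v" "y' \<in> laurents P S u v"
  then obtain f g where fg: "y = laurent_eval f u v" "y' = laurent_eval g u v"
    "Poly_Mapping.keys f \<subseteq> S" "Poly_Mapping.keys g \<subseteq> S" "P \<longrightarrow> nonneg_coeffs f" "P \<longrightarrow> nonneg_coeffs g"
    unfolding laurents_def by blast
  then have "Poly_Mapping.keys (f + g) \<subseteq> S"
    using Poly_Mapping.keys_add[of f g] by blast
  then show ?thesis
    unfolding laurents_def using fg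
    by (auto intro!: exI[of _ "f + g"] simp: laurent_eval_add nonneg_coeffs_add)
qed

lemma laurents_uminus: "y \<in> laurents False S u v \<Longrightarrow> - y \<in> laurents False S u v"
  unfolding laurents_def by (auto, metis laurent_eval_uminus keys_minus)

lemma laurents_diff:
  "y \<in> laurents False S u v \<Longrightarrow> y' \<in> laurents False S u v \<Longrightarrow> y - y' \<in> laurents False S u v"
  using laurents_add[OF _ laurents_uminus] by fastforce

lemma laurents_mult:
  assumes "u \<noteq> 0" "v \<noteq> 0" "y \<in> laurents P S u v" "y' \<in> laurents P T u v"
    and "\<And>i j i' j'. (i, j) \<in> S \<Longrightarrow> (i', j') \<in> T \<Longrightarrow> (i + i', j + j') \<in> U"
  shows "y * y' \<in> laurents P U u v"
proof -
  obtain f g where fg: "y = laurent_eval f u v" "y' = laurent_eval g u v"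
    "Poly_Mapping.keys f \<subseteq> S" "Poly_Mapping.keys g \<subseteq> T" "P \<longrightarrow> nonneg_coeffs f" "P \<longrightarrow> nonneg_coeffs g"
    using assms(3,4) unfolding laurents_def by blast
  have "Poly_Mapping.keys (f * g) \<subseteq> U"
    using Poly_Mapping.keys_mult[of f g] fg(3,4) assms(5) by fastforce
  then show ?thesis
    unfolding laurents_def using fg assms(1,2)
    by (auto intro!: exI[of _ "f * g"] simp: laurent_eval_mult nonneg_coeffs_mult)
qed

lemma laurents_monomial:
  assumes "(i, j) \<in> S" "P \<Longrightarrow> 0 \<le> c"
  shows "of_int c * u powi i * v powi j \<in> laurents P S u v"
  unfolding laurents_def using assms
  by (auto intro!: exI[of _ "Poly_Mapping.single (i, j) c"]
      simp: laurent_eval_single nonneg_coeffs_def lookup_single when_def split: if_splits)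

lemma laurents_monomial1:
  assumes "(i, j) \<in> S"
  shows "u powi i * v powi j \<in> laurents P S u v"
  using laurents_monomial[OF assms, of P 1 u v] by simp

lemma laurents_swap: "y \<in> laurents P S u v \<Longrightarrow> y \<in> laurents P (prod.swap ` S) v u"
proof -
  assume "y \<in> laurents P S u v"
  then obtain f where "y = laurent_eval f u v" "Poly_Mapping.keys f \<subseteq> S" "P \<longrightarrow> nonneg_coeffs f"
    unfolding laurents_def by blast
  then show ?thesis
    unfolding laurents_def
    by (auto intro!: exI[of _ "swap_exponents f"] image_mono
        simp: laurent_eval_swap keys_swap_exponents nonneg_coeffs_def)
qed

lemma laurents_power_UNIV:
  assumes "u \<noteq> 0" "v \<noteq> 0" "y \<in> laurents P UNIV u v"
  shows "y ^ n \<in> laurents P UNIV u v"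
proof (induction n)
  case 0
  show ?case using laurents_monomial1[of 0 0 UNIV u v P] by simp
next
  case (Suc n)
  then show ?case using laurents_mult[OF assms Suc] by simp
qed

lemma laurents_lookup:
  assumes "laurent_indep u v" "laurent_eval f u v \<in> laurents P S u v"
  shows "Poly_Mapping.keys f \<subseteq> S" "P \<Longrightarrow> nonneg_coeffs f"
  using assms laurent_indepD unfolding laurents_def by blast+

section \<open>Tropical weights and mutation of expansions\<close>

text \<open>The degree of \<open>f\<close> for the weights \<open>(l, m)\<close>, encoded as a
  relation because the zero polynomial has none.\<close>

definition wmax :: "int \<Rightarrow> int \<Rightarrow> ((int \<times> int) \<Rightarrow>\<^sub>0 int) \<Rightarrow> int \<Rightarrow> bool" where
  "wmax l m f t \<longleftrightarrow>
     (\<exists>(i, j)\<in>Poly_Mapping.keys f. l * i + m * j = t) \<and>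
     (\<forall>(i, j)\<in>Poly_Mapping.keys f. l * i + m * j \<le> t)"

lemma wmax_unique: "wmax l m f s \<Longrightarrow> wmax l m f t \<Longrightarrow> s = t"
  unfolding wmax_def by fastforce

lemma wmax_exists:
  assumes "f \<noteq> 0" shows "\<exists>t. wmax l m f t"
proof -
  let ?W = "(\<lambda>(i, j). l * i + m * j) ` Poly_Mapping.keys f"
  have "finite ?W" "?W \<noteq> {}" using assms by auto
  then have "Max ?W \<in> ?W" "\<forall>w\<in>?W. w \<le> Max ?W" by simp_all
  then show ?thesis unfolding wmax_def by (intro exI[of _ "Max ?W"]) force
qed

lemma wmax_mult:
  assumes "nonneg_coeffs f" "nonneg_coeffs g" "wmax l m f s" "wmax l m g t"
  shows "wmax l m (f * g) (s + t)"
proof -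
  obtain i j i' j' where ij: "(i, j) \<in> Poly_Mapping.keys f" "l * i + m * j = s"
      "(i', j') \<in> Poly_Mapping.keys g" "l * i' + m * j' = t"
    using assms(3,4) unfolding wmax_def by blast
  have 1: "(i + i', j + j') \<in> Poly_Mapping.keys (f * g)"
    using keys_mult_nonneg[OF assms(1,2) ij(1,3)] by simp
  have 2: "l * (i + i') + m * (j + j') = s + t"
    using ij(2,4) by (simp add: algebra_simps)
  have "l * x + m * y \<le> s + t" if xy: "(x, y) \<in> Poly_Mapping.keys (f * g)" for x y
  proof -
    have "\<exists>k\<in>Poly_Mapping.keys f. \<exists>k'\<in>Poly_Mapping.keys g. (x, y) = k + k'"
      using Poly_Mapping.keys_mult[of f g] xy by blast
    then obtain a b a' b' where k: "(a, b) \<in> Poly_Mapping.keys f" "(a', b') \<in> Poly_Mapping.keys g"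
      "x = a + a'" "y = b + b'"
      by force
    then have "l * a + m * b \<le> s" "l * a' + m * b' \<le> t"
      using assms(3,4) unfolding wmax_def by blast+
    then show ?thesis unfolding k(3,4) by (simp add: algebra_simps)
  qed
  with 1 2 show ?thesis unfolding wmax_def by blast
qed

lemma wmax_one: "wmax l m 1 0"
  by (simp add: wmax_def zero_prod_def)

lemma wmax_power:
  assumes "nonneg_coeffs f" "wmax l m f s"
  shows "wmax l m (f ^ n) (int n * s)"
proof (induction n)
  case (Suc n)
  then show ?case
    using wmax_mult[OF assms(1) nonneg_coeffs_power[OF assms(1)] assms(2) Suc]
    by (simp add: algebra_simps)
qed (simp add: wmax_one)

lemma wmax_add:
  assumes "nonneg_coeffs f" "nonneg_coeffs g" "wmax l m f s" "wmax l m g t"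
  shows "wmax l m (f + g) (max s t)"
  using assms(3,4) unfolding wmax_def keys_add_nonneg[OF assms(1,2)]
  by (fastforce simp: max_def)

text \<open>Without cancellation, degrees turn the exchange relation into its tropical form. Being
  nonzero, \<open>h\<close> has some degree, and additivity determines it.\<close>

lemma wmax_exchange:
  assumes "nonneg_coeffs f" "nonneg_coeffs g" "nonneg_coeffs h" "f * h = g ^ d + 1"
    and "wmax l m f s" "wmax l m g t"
  shows "wmax l m h (max (int d * t) 0 - s)"
proof -
  have "wmax l m (f * h) (max (int d * t) 0)"
    unfolding assms(4)
    by (intro wmax_add wmax_power nonneg_coeffs_power nonneg_coeffs_one wmax_one assms)
  moreover from this have "h \<noteq> 0" by (auto simp: wmax_def)
  then obtain r where "wmax l m h r" using wmax_exists by blast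
  moreover from this have "wmax l m (f * h) (s + r)"
    by (intro wmax_mult assms)
  ultimately show ?thesis using wmax_unique by fastforce
qed

section \<open>Rows of coefficients under mutation: the exponent of \<open>x1\<close> varies, that
  of the mutated variable is fixed\<close>

definition row_shift :: "nat \<Rightarrow> (int \<Rightarrow> int) \<Rightarrow> int \<Rightarrow> int" where
  "row_shift b \<phi> = (\<lambda>i. \<phi> i + \<phi> (i - int b))"

definition binomial_laurent :: "nat \<Rightarrow> ((int \<times> int) \<Rightarrow>\<^sub>0 int)" where
  "binomial_laurent b = Poly_Mapping.single (int b, 0) 1 + 1"

lemma laurent_eval_binomial_laurent: "laurent_eval (binomial_laurent b) u v = u ^ b + 1"
  by (simp add: binomial_laurent_def laurent_eval_add laurent_eval_single)

lemma lookup_mult_binomial: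
  "\<forall>i j. Poly_Mapping.lookup (f * binomial_laurent b) (i, j) =
     row_shift b (\<lambda>i. Poly_Mapping.lookup f (i, j)) i"
proof (rule frag_induction[where c = f and S = UNIV])
  show "\<forall>i j. Poly_Mapping.lookup (frag_of k * binomial_laurent b) (i, j) =
     row_shift b (\<lambda>i. Poly_Mapping.lookup (frag_of k) (i, j)) i" for k
  proof -
    have "frag_of k * binomial_laurent b = frag_of (k + (int b, 0)) + frag_of k"
      by (simp add: binomial_laurent_def distrib_left mult_single)
    then show ?thesis
      by (cases k) (auto simp: row_shift_def lookup_add lookup_single when_def)
  qed
qed (auto simp: row_shift_def lookup_minus left_diff_distrib)

lemma lookup_mult_binomial_power:
  "Poly_Mapping.lookup (f * binomial_laurent b ^ n) (i, j) =
     (row_shift b ^^ n) (\<lambda>i. Poly_Mapping.lookup f (i, j)) i"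
proof (induction n arbitrary: i)
  case (Suc n)
  have "Poly_Mapping.lookup (f * binomial_laurent b ^ Suc n) (i, j) =
      Poly_Mapping.lookup ((f * binomial_laurent b ^ n) * binomial_laurent b) (i, j)"
    by (simp add: ac_simps)
  also have "\<dots> = row_shift b (\<lambda>i. Poly_Mapping.lookup (f * binomial_laurent b ^ n) (i, j)) i"
    using lookup_mult_binomial by blast
  finally show ?case by (simp add: Suc)
qed simp

lemma row_shift_power_zero: "(row_shift b ^^ n) (\<lambda>_. 0) = (\<lambda>_. 0)"
  by (induction n) (simp_all add: row_shift_def)

lemma row_shift_power_sum:
  "(row_shift b ^^ n) (\<lambda>i. \<Sum>x\<in>A. c x * \<phi> x i) = (\<lambda>i. \<Sum>x\<in>A. c x * (row_shift b ^^ n) (\<phi> x) i)"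
  by (induction n) (simp_all add: row_shift_def sum.distrib algebra_simps)

text \<open>Multiplying by the power of the binomial makes room for the negative powers of \<open>x0\<close>.\<close>

lemma mutation_expansion:
  fixes x0 x1 x2 :: "'a::field"
  assumes ex: "x0 * x2 = x1 ^ b + 1" and nz: "x0 \<noteq> 0" "x1 \<noteq> 0" "x2 \<noteq> 0"
    and N: "\<And>i k. (i, k) \<in> Poly_Mapping.keys h \<Longrightarrow> 0 \<le> int N + k"
  shows "\<exists>G. laurent_eval G x1 x2 = laurent_eval h x1 x0 * (x1 ^ b + 1) ^ N \<and>
    (\<forall>i k. Poly_Mapping.lookup G (i, - k) =
       (row_shift b ^^ nat (int N + k)) (\<lambda>i. Poly_Mapping.lookup h (i, k)) i)"
proof -
  \<comment> \<open>By the exchange relation, \<open>x0 powi k\<close> equals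
    \<open>(x1 ^ b + 1) powi k * x2 powi (- k)\<close>. So row \<open>k\<close> of \<open>h\<close>
    lands in row \<open>- k\<close>, and the extra exponent \<open>N\<close> makes every power of
    the binomial a polynomial.\<close>
  define T where "T k = frag_of (fst k, - snd k) * binomial_laurent b ^ nat (int N + snd k)" for k
  define G where "G = (\<Sum>k\<in>Poly_Mapping.keys h. frag_cmul (Poly_Mapping.lookup h k) (T k))"
  have q: "x1 ^ b + 1 \<noteq> 0" using nz ex by (metis mult_eq_0_iff)
  have "laurent_eval G x1 x2 = (\<Sum>k\<in>Poly_Mapping.keys h. of_int (Poly_Mapping.lookup h k) *
      (x1 powi fst k * x2 powi (- snd k) * (x1 ^ b + 1) ^ nat (int N + snd k)))"
    unfolding G_def T_def laurent_eval_sum laurent_eval_frag_cmul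
    by (simp add: laurent_eval_mult laurent_eval_power nz laurent_eval_single laurent_eval_binomial_laurent)
  also have "\<dots> = (\<Sum>k\<in>Poly_Mapping.keys h. of_int (Poly_Mapping.lookup h k) *
      x1 powi fst k * x0 powi snd k * (x1 ^ b + 1) ^ N)"
  proof (rule sum.cong[OF refl])
    fix k assume "k \<in> Poly_Mapping.keys h"
    then have "0 \<le> int N + snd k" using N[of "fst k" "snd k"] by simp
    then have "(x1 ^ b + 1) ^ nat (int N + snd k) = (x1 ^ b + 1) powi (int N + snd k)"
      by (simp add: power_int_def)
    also have "\<dots> = (x1 ^ b + 1) ^ N * (x0 * x2) powi snd k"
      using q by (simp add: power_int_add ex)
    finally show "of_int (Poly_Mapping.lookup h k) *
        (x1 powi fst k * x2 powi (- snd k) * (x1 ^ b + 1) ^ nat (int N + snd k)) =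
       of_int (Poly_Mapping.lookup h k) * x1 powi fst k * x0 powi snd k * (x1 ^ b + 1) ^ N"
      using nz by (simp add: power_int_mult_distrib power_int_minus field_simps)
  qed
  also have "\<dots> = laurent_eval h x1 x0 * (x1 ^ b + 1) ^ N"
    by (simp add: laurent_eval_superset[of "Poly_Mapping.keys h"] sum_distrib_right)
  finally have 1: "laurent_eval G x1 x2 = laurent_eval h x1 x0 * (x1 ^ b + 1) ^ N" .
  have 2: "Poly_Mapping.lookup G (i, - k) =
       (row_shift b ^^ nat (int N + k)) (\<lambda>i. Poly_Mapping.lookup h (i, k)) i" for i k
  proof -
    let ?\<phi> = "\<lambda>p i. Poly_Mapping.lookup (frag_of (fst p, - snd p) :: (int \<times> int) \<Rightarrow>\<^sub>0 int) (i, - k)"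
    have "Poly_Mapping.lookup G (i, - k) = (\<Sum>p\<in>Poly_Mapping.keys h. Poly_Mapping.lookup h p *
        (row_shift b ^^ nat (int N + snd p)) (?\<phi> p) i)"
      by (simp add: G_def T_def lookup_sum lookup_mult_binomial_power)
    also have "\<dots> = (\<Sum>p\<in>Poly_Mapping.keys h. Poly_Mapping.lookup h p *
        (row_shift b ^^ nat (int N + k)) (?\<phi> p) i)"
    proof (rule sum.cong[OF refl])
      fix p assume "p \<in> Poly_Mapping.keys h"
      show "Poly_Mapping.lookup h p * (row_shift b ^^ nat (int N + snd p)) (?\<phi> p) i =
          Poly_Mapping.lookup h p * (row_shift b ^^ nat (int N + k)) (?\<phi> p) i"
      \<comment> \<open>A term from another row vanishes in row \<open>- k\<close> under any power
        of the shift, so all terms may share the exponent \<open>N + k\<close>.\<close>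
      proof (cases "snd p = k")
        case False
        then have "?\<phi> p = (\<lambda>_. 0)" by (auto simp: lookup_single)
        then show ?thesis by (simp only: row_shift_power_zero)
      qed simp
    qed
    also have "\<dots> = (row_shift b ^^ nat (int N + k))
        (\<lambda>i. \<Sum>p\<in>Poly_Mapping.keys h. Poly_Mapping.lookup h p * ?\<phi> p i) i"
      by (simp only: row_shift_power_sum)
    also have "(\<lambda>i. \<Sum>p\<in>Poly_Mapping.keys h. Poly_Mapping.lookup h p * ?\<phi> p i) =
        (\<lambda>i. Poly_Mapping.lookup h (i, k))"
    proof
      fix i
      have "(\<Sum>p\<in>Poly_Mapping.keys h. Poly_Mapping.lookup h p * ?\<phi> p i) =
          (\<Sum>p\<in>Poly_Mapping.keys h. if p = (i, k) then Poly_Mapping.lookup h p else 0)"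
        by (rule sum.cong) (auto simp: lookup_single when_def)
      then show "(\<Sum>p\<in>Poly_Mapping.keys h. Poly_Mapping.lookup h p * ?\<phi> p i) = Poly_Mapping.lookup h (i, k)"
        by (simp add: in_keys_iff)
    qed
    finally show ?thesis .
  qed
  show ?thesis using 1 2 by blast
qed

definition spans :: "(int \<Rightarrow> int) \<Rightarrow> int \<Rightarrow> int \<Rightarrow> bool" where
  "spans \<phi> lo hi \<longleftrightarrow> \<phi> lo \<noteq> 0 \<and> \<phi> hi \<noteq> 0 \<and> (\<forall>i. \<phi> i \<noteq> 0 \<longrightarrow> lo \<le> i \<and> i \<le> hi)"

lemma spans_exists:
  assumes "finite {i. \<phi> i \<noteq> 0}" "\<phi> i \<noteq> 0"
  shows "\<exists>lo hi. spans \<phi> lo hi"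
proof -
  let ?S = "{i. \<phi> i \<noteq> 0}"
  have "?S \<noteq> {}" using assms(2) by blast
  then have "Min ?S \<in> ?S" "Max ?S \<in> ?S" "\<forall>i\<in>?S. Min ?S \<le> i \<and> i \<le> Max ?S"
    using Min_in[OF assms(1)] Max_in[OF assms(1)] Min_le[OF assms(1)] Max_ge[OF assms(1)] by blast+
  then show ?thesis unfolding spans_def by blast
qed

lemma spans_le: "spans \<phi> lo hi \<Longrightarrow> lo \<le> hi"
  by (simp add: spans_def)

lemma spans_unique: "spans \<phi> lo hi \<Longrightarrow> spans \<phi> lo' hi' \<Longrightarrow> lo = lo' \<and> hi = hi'"
  unfolding spans_def by (meson order_antisym)

text \<open>As \<open>b > 0\<close>, the two extreme coefficients of the row meet no other term in
  the shifted sum and cannot cancel.\<close>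

lemma spans_row_shift:
  assumes "spans \<phi> lo hi" "b > 0"
  shows "spans (row_shift b \<phi>) lo (hi + int b)"
proof -
  have 1: "\<phi> (lo - int b) = 0" "\<phi> (hi + int b) = 0"
    using assms unfolding spans_def by (smt (verit) of_nat_0_less_iff)+
  have 2: "lo \<le> i \<and> i \<le> hi + int b" if "\<phi> i + \<phi> (i - int b) \<noteq> 0" for i
  proof -
    have "\<phi> i \<noteq> 0 \<or> \<phi> (i - int b) \<noteq> 0" using that by auto
    then have "(lo \<le> i \<and> i \<le> hi) \<or> (lo \<le> i - int b \<and> i - int b \<le> hi)"
      using assms(1) unfolding spans_def by blast
    then show ?thesis by auto
  qed
  show ?thesis
    unfolding spans_def row_shift_def
    using assms(1) 1 2 unfolding spans_def by simp
qed

lemma spans_row_shift_power: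
  assumes "spans \<phi> lo hi" "b > 0"
  shows "spans ((row_shift b ^^ n) \<phi>) lo (hi + int b * int n)"
proof (induction n)
  case (Suc n)
  from spans_row_shift[OF this assms(2)] show ?case by (simp add: algebra_simps)
qed (use assms in simp)

lemma finite_row: "finite {i. Poly_Mapping.lookup f (i, j) \<noteq> 0}"
proof -
  have "{i. Poly_Mapping.lookup f (i, j) \<noteq> 0} \<subseteq> fst ` Poly_Mapping.keys f"
    by (force simp: in_keys_iff)
  then show ?thesis by (rule finite_subset) simp
qed

lemma exponent_bound: "\<exists>N::nat. \<forall>i k. (i, k) \<in> Poly_Mapping.keys h \<longrightarrow> 0 \<le> int N + k"
proof -
  have fin: "finite (abs ` snd ` Poly_Mapping.keys h)" by simp
  define N where "N = nat (Max (insert 0 (abs ` snd ` Poly_Mapping.keys h)))"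
  have "0 \<le> int N + k" if "(i, k) \<in> Poly_Mapping.keys h" for i k
  proof -
    have "\<bar>k\<bar> \<in> insert 0 (abs ` snd ` Poly_Mapping.keys h)" using that by force
    then have "\<bar>k\<bar> \<le> Max (insert 0 (abs ` snd ` Poly_Mapping.keys h))" using fin by (intro Max_ge) auto
    then show ?thesis unfolding N_def by linarith
  qed
  then show ?thesis by blast
qed

text \<open>A relation between \<open>x1\<close> and \<open>x0\<close> becomes one between
  \<open>x1\<close> and \<open>x2\<close> after multiplication by a power of the binomial, and the
  leftmost coefficient of each nonzero row survives this.\<close>

lemma laurent_indep_mutation:
  assumes "laurent_indep x1 x2" "b > 0" "x0 * x2 = x1 ^ b + 1"
  shows "laurent_indep x1 x0"
proof -
  have nz: "x1 \<noteq> 0" "x2 \<noteq> 0" using assms(1) by (simp_all add: laurent_indep_def)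
  have "Poly_Mapping.lookup (binomial_laurent b) (0, 0) = 1"
    using assms(2) by (simp add: binomial_laurent_def lookup_add lookup_single lookup_one zero_prod_def)
  then have "binomial_laurent b \<noteq> 0" by auto
  then have q: "x1 ^ b + 1 \<noteq> 0"
    using assms(1) laurent_eval_binomial_laurent[of b x1 x2] unfolding laurent_indep_def by metis
  then have x0: "x0 \<noteq> 0" using assms(3) by auto
  have "h = 0" if h: "laurent_eval h x1 x0 = 0" for h
  proof (rule ccontr)
    assume "h \<noteq> 0"
    then obtain i k where ik: "Poly_Mapping.lookup h (i, k) \<noteq> 0"
      by (metis lookup_zero poly_mapping_eqI surj_pair)
    obtain N where N: "\<And>i k. (i, k) \<in> Poly_Mapping.keys h \<Longrightarrow> 0 \<le> int N + k"
      using exponent_bound by blast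
    obtain G where G0: "laurent_eval G x1 x2 = laurent_eval h x1 x0 * (x1 ^ b + 1) ^ N \<and>
    (\<forall>i k. Poly_Mapping.lookup G (i, - k) =
     (row_shift b ^^ nat (int N + k)) (\<lambda>i. Poly_Mapping.lookup h (i, k)) i)"
    using mutation_expansion[OF assms(3) x0 nz N] by (rule exE)
  note G = conjunct1[OF G0] conjunct2[OF G0]
    have "G = 0" using G(1) h assms(1) unfolding laurent_indep_def by simp
    moreover obtain lo hi where "spans (\<lambda>i. Poly_Mapping.lookup h (i, k)) lo hi"
      using spans_exists[of "\<lambda>i. Poly_Mapping.lookup h (i, k)" i, OF finite_row ik] by blast
    from spans_row_shift_power[OF this assms(2)] have "Poly_Mapping.lookup G (lo, - k) \<noteq> 0"
      unfolding G(2)[rule_format] spans_def by blast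
    ultimately show False by simp
  qed
  then show ?thesis using x0 nz unfolding laurent_indep_def by blast
qed

text \<open>Being Laurent also in \<open>x1, x0\<close> makes row \<open>- k\<close> divisible by
  the \<open>k\<close>-th power of the binomial, so for \<open>k > 0\<close> it is at least
  \<open>b * k\<close> wide. The width is found by computing the same row of \<open>G\<close> from
  \<open>f\<close> with \<open>N\<close> factors and from \<open>h\<close> with \<open>N + k\<close>
  factors. The second alternative covers an \<open>i\<close> that is not the left end.\<close>

lemma row_width:
  assumes "laurent_indep x1 x2" "b > 0" "x0 * x2 = x1 ^ b + 1"
    and eq: "laurent_eval f x1 x2 = laurent_eval h x1 x0"
    and k: "Poly_Mapping.lookup f (i, - k) \<noteq> 0"
  obtains i' where "i + int b * k \<le> i'" "Poly_Mapping.lookup f (i', - k) \<noteq> 0"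
    | i' where "i' < i" "Poly_Mapping.lookup f (i', - k) \<noteq> 0"
proof -
  have nz: "x1 \<noteq> 0" "x2 \<noteq> 0" "x0 \<noteq> 0"
    using assms(1) laurent_indep_mutation[OF assms(1-3)] by (simp_all add: laurent_indep_def)
  obtain N where N: "\<And>i k. (i, k) \<in> Poly_Mapping.keys h \<Longrightarrow> 0 \<le> int N + k"
    using exponent_bound by blast
  obtain G where G0: "laurent_eval G x1 x2 = laurent_eval h x1 x0 * (x1 ^ b + 1) ^ N \<and>
    (\<forall>i k. Poly_Mapping.lookup G (i, - k) =
     (row_shift b ^^ nat (int N + k)) (\<lambda>i. Poly_Mapping.lookup h (i, k)) i)"
    using mutation_expansion[OF assms(3) nz(3,1,2) N] by (rule exE)
  note G = conjunct1[OF G0] conjunct2[OF G0]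
  have "laurent_eval G x1 x2 = laurent_eval (f * binomial_laurent b ^ N) x1 x2"
    unfolding G(1) by (simp add: laurent_eval_mult laurent_eval_power nz laurent_eval_binomial_laurent eq)
  then have G': "G = f * binomial_laurent b ^ N"
    using laurent_indepD[OF assms(1)] by blast
  obtain lo hi where f: "spans (\<lambda>i. Poly_Mapping.lookup f (i, - k)) lo hi"
    using spans_exists[of "\<lambda>i. Poly_Mapping.lookup f (i, - k)" i, OF finite_row k] by blast
  note f1 = spans_row_shift_power[OF f assms(2), of N]
  have "(\<lambda>i. Poly_Mapping.lookup G (i, - k)) = (row_shift b ^^ N) (\<lambda>i. Poly_Mapping.lookup f (i, - k))"
    unfolding G' by (simp add: lookup_mult_binomial_power)
  with f1 have f2: "spans (\<lambda>i. Poly_Mapping.lookup G (i, - k)) lo (hi + int b * int N)" by simp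
  have "\<exists>i. Poly_Mapping.lookup h (i, k) \<noteq> 0"
  proof (rule ccontr)
    assume "\<not> ?thesis"
    then have "(\<lambda>i. Poly_Mapping.lookup h (i, k)) = (\<lambda>_. 0)" by auto
    then have "\<forall>i. Poly_Mapping.lookup G (i, - k) = 0" unfolding G(2)[rule_format] by (simp only: row_shift_power_zero simp_thms)
    then show False using f2 by (simp add: spans_def)
  qed
  then obtain i0 where i0: "Poly_Mapping.lookup h (i0, k) \<noteq> 0" by blast
  then obtain lo' hi' where h: "spans (\<lambda>i. Poly_Mapping.lookup h (i, k)) lo' hi'"
    using spans_exists[of "\<lambda>i. Poly_Mapping.lookup h (i, k)" i0, OF finite_row i0] by blast
  have Nk: "0 \<le> int N + k" using N[of i0 k] i0 by (simp add: in_keys_iff)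
  have "(\<lambda>i. Poly_Mapping.lookup G (i, - k)) = (row_shift b ^^ nat (int N + k)) (\<lambda>i. Poly_Mapping.lookup h (i, k))"
    unfolding G(2)[rule_format] by simp
  with spans_row_shift_power[OF h assms(2), of "nat (int N + k)"]
  have "spans (\<lambda>i. Poly_Mapping.lookup G (i, - k)) lo' (hi' + int b * (int N + k))"
    using Nk by simp
  with f2 have "lo' = lo" "hi + int b * int N = hi' + int b * (int N + k)"
    using spans_unique by blast+
  then have "lo + int b * k \<le> hi" using spans_le[OF h] by (simp add: algebra_simps)
  moreover have "Poly_Mapping.lookup f (lo, - k) \<noteq> 0" "Poly_Mapping.lookup f (hi, - k) \<noteq> 0" "lo \<le> i"
    using f k by (auto simp: spans_def)
  ultimately show thesis
    using that(1)[of hi] that(2)[of lo] by (cases "lo = i") auto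
qed

text \<open>
  The width and height are those forced by the divisibility of the bottom row and of the left
  column, see \<open>row_width\<close>.
\<close>

definition pbox :: "nat \<Rightarrow> nat \<Rightarrow> int \<times> int \<Rightarrow> (int \<times> int) set" where
  "pbox b c = (\<lambda>(p, q). {(i, j). - p \<le> i \<and> i \<le> - p + int b * max q 0 \<and>
                                - q \<le> j \<and> j \<le> - q + int c * max p 0})"

definition pointed :: "nat \<Rightarrow> nat \<Rightarrow> int \<times> int \<Rightarrow> 'a::field \<Rightarrow> 'a \<Rightarrow> 'a \<Rightarrow> bool" where
  "pointed b c = (\<lambda>(p, q) u v y.
     y - u powi (- p) * v powi (- q) \<in> laurents False (pbox b c (p, q) - {(- p, - q)}) u v)"

text \<open>\<open>U\<close> will be the algebra and \<open>M\<close> the span of the basis.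
  Coefficients are removed from the bottom row upwards, and within a row from left to right.\<close>

lemma greedy_expansion:
  fixes x0 x1 x2 x3 :: "'a::field"
  assumes ind: "laurent_indep x1 x2" and bc: "b > 0" "c > 0"
    and ex: "x0 * x2 = x1 ^ b + 1" "x1 * x3 = x2 ^ c + 1"
    and U: "\<And>y. y \<in> U \<Longrightarrow> y \<in> laurents False UNIV x1 x2"
      "\<And>y. y \<in> U \<Longrightarrow> y \<in> laurents False UNIV x0 x1"
      "\<And>y. y \<in> U \<Longrightarrow> y \<in> laurents False UNIV x2 x3"
    and U_diff: "\<And>y y' n. y \<in> U \<Longrightarrow> y' \<in> M \<Longrightarrow> y - of_int n * y' \<in> U"
    and M0: "0 \<in> M" and M_add: "\<And>y y' n. y \<in> M \<Longrightarrow> y' \<in> M \<Longrightarrow> y + of_int n * y' \<in> M"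
    and pts: "\<And>p q. \<exists>y\<in>M. pointed b c (p, q) x1 x2 y"
    and y: "y \<in> U"
  shows "y \<in> M"
proof -
  obtain f where f: "y = laurent_eval f x1 x2"
    using U(1)[OF y] unfolding laurents_def by blast
  obtain K where K: "\<And>i j. (i, j) \<in> Poly_Mapping.keys f \<Longrightarrow> - int K \<le> i \<and> i \<le> int K \<and> - int K \<le> j \<and> j \<le> int K"
  proof -
    obtain K1 where K1: "\<forall>i k. (i, k) \<in> Poly_Mapping.keys f \<longrightarrow> 0 \<le> int K1 + k"
      using exponent_bound by blast
    obtain K2 where K2: "\<forall>i k. (i, k) \<in> Poly_Mapping.keys (swap_exponents f) \<longrightarrow> 0 \<le> int K2 + k"
      using exponent_bound by blast
    define f' where "f' = Poly_Mapping.map_key uminus f"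
    have f': "Poly_Mapping.lookup f' k = Poly_Mapping.lookup f (- k)" for k
      unfolding f'_def by (subst map_key.rep_eq) (auto simp: inj_on_def)
    obtain K3 where K3: "\<forall>i k. (i, k) \<in> Poly_Mapping.keys f' \<longrightarrow> 0 \<le> int K3 + k"
      using exponent_bound by blast
    obtain K4 where K4: "\<forall>i k. (i, k) \<in> Poly_Mapping.keys (swap_exponents f') \<longrightarrow> 0 \<le> int K4 + k"
      using exponent_bound by blast
    show thesis
    proof (rule that[of "K1 + K2 + K3 + K4"])
      fix i j assume "(i, j) \<in> Poly_Mapping.keys f"
      then have "0 \<le> int K1 + j" "0 \<le> int K2 + i" "0 \<le> int K3 + (- j)" "0 \<le> int K4 + (- i)"
        using K1[rule_format, of i j] K2[rule_format, of j i] K3[rule_format, of "-i" "-j"] K4[rule_format, of "-j" "-i"]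
        by (auto simp: in_keys_iff f')
      then show "- int (K1 + K2 + K3 + K4) \<le> i \<and> i \<le> int (K1 + K2 + K3 + K4) \<and>
          - int (K1 + K2 + K3 + K4) \<le> j \<and> j \<le> int (K1 + K2 + K3 + K4)" by simp
    qed
  qed
  \<comment> \<open>\<open>W\<close> is the side of the box, and \<open>rank\<close> numbers its
    points row by row from \<open>0\<close> to \<open>W * W - 1\<close>. In \<open>main\<close>,
    \<open>n\<close> bounds the number of points still to be treated, so \<open>n = 0\<close> forces
    \<open>f = 0\<close>.\<close>
  define W where "W = 2 * int K + 1"
  define rank where "rank i j = (j + int K) * W + (i + int K)" for i j
  have main: "y \<in> M" if "y \<in> U" "y = laurent_eval f x1 x2"
    "\<And>i j. (i, j) \<in> Poly_Mapping.keys f \<Longrightarrow> - int K \<le> i \<and> i \<le> int K \<and> - int K \<le> j \<and> j \<le> int K"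
    "\<And>i j. (i, j) \<in> Poly_Mapping.keys f \<Longrightarrow> W * W - int n \<le> rank i j" for n y f
    using that
  proof (induction n arbitrary: y f)
    case 0
    have "f = 0"
    proof (rule ccontr)
      assume "f \<noteq> 0"
      then obtain i j where ij: "(i, j) \<in> Poly_Mapping.keys f" by (metis all_not_in_conv keys_eq_empty surj_pair)
      have "(j + int K) * W \<le> (2 * int K) * W"
        using 0(3)[OF ij] by (intro mult_right_mono) (auto simp: W_def)
      then show False using 0(3)[OF ij] 0(4)[OF ij] by (simp add: rank_def W_def algebra_simps)
    qed
    then show ?case using 0 M0 by simp
  next
    case (Suc n)
    show ?case
    proof (cases "\<exists>i j. (i, j) \<in> Poly_Mapping.keys f \<and> rank i j = W * W - int (Suc n)")
      case False
      then show ?thesis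
        using Suc.prems by (intro Suc.IH[of y f]) force+
    next
      case True
      then obtain p q where pq: "(- p, - q) \<in> Poly_Mapping.keys f" "rank (- p) (- q) = W * W - int (Suc n)"
        by (metis minus_minus)
      have lex: "- q < j \<or> (j = - q \<and> - p \<le> i)" if ij: "(i, j) \<in> Poly_Mapping.keys f" for i j
      proof (rule ccontr)
        assume "\<not> ?thesis"
        then consider "j + 1 \<le> - q" | "j = - q" "i < - p" by linarith
        then show False
        proof cases
          case 1
          have "(j + int K + 1) * W \<le> (- q + int K) * W"
            using 1 by (intro mult_right_mono) (auto simp: W_def)
          then show False
            using Suc.prems(4)[OF ij] Suc.prems(3)[OF ij] Suc.prems(3)[OF pq(1)] pq(2)
            by (simp add: rank_def W_def algebra_simps)
        next
          case 2
          then show False using Suc.prems(4)[OF ij] pq(2) by (simp add: rank_def)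
        qed
      qed
      \<comment> \<open>\<open>(- p, - q)\<close> is the left end of the bottom row, so divisibility
        makes that row reach column \<open>- p + b * q\<close>, which must lie in the box. Hence the
        new support fits horizontally.\<close>
      have q_le: "- p + int b * q \<le> int K" if "q > 0"
      proof -
        obtain h where h: "y = laurent_eval h x1 x0"
          using laurents_swap[OF U(2)[OF Suc.prems(1)]] unfolding laurents_def by blast
        have "Poly_Mapping.lookup f (- p, - q) \<noteq> 0" using pq(1) by (simp add: in_keys_iff)
        from row_width[OF ind bc(1) ex(1) _ this, of h] h Suc.prems(2)
        consider i' where "- p + int b * q \<le> i'" "Poly_Mapping.lookup f (i', - q) \<noteq> 0"
          | i' where "i' < - p" "Poly_Mapping.lookup f (i', - q) \<noteq> 0" by metis
        then show ?thesis
        proof cases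
          case 1
          then show ?thesis using Suc.prems(3)[of i' "- q"] by (auto simp: in_keys_iff)
        next
          case 2
          then show ?thesis using lex[of i' "- q"] by (auto simp: in_keys_iff)
        qed
      qed
      \<comment> \<open>\<open>- p'\<close> is the leftmost column of \<open>f\<close>. It is
        divisible by the \<open>p'\<close>-th power of the binomial in \<open>x2\<close>, and its
        lowest entry \<open>lo\<close> is not below the bottom row \<open>- q\<close>; together with
        \<open>p \<le> p'\<close> this bounds the height.\<close>
      have p_le: "- q + int c * p \<le> int K" if p: "p > 0"
      proof -
        obtain h where h: "y = laurent_eval h x2 x3"
          using U(3)[OF Suc.prems(1)] unfolding laurents_def by blast
        have "finite (fst ` Poly_Mapping.keys f)" by simp
        define p' where "p' = - Min (fst ` Poly_Mapping.keys f)"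
        have "- p \<in> fst ` Poly_Mapping.keys f" using pq(1) by force
        then have p': "- p' \<in> fst ` Poly_Mapping.keys f" "p \<le> p'"
          using Min_in[of "fst ` Poly_Mapping.keys f"] Min_le[of "fst ` Poly_Mapping.keys f" "- p"]
            finite_imageI[OF finite_keys, of fst f]
          unfolding p'_def minus_minus by (metis empty_iff, linarith)
        then obtain j where "Poly_Mapping.lookup f (- p', j) \<noteq> 0" by (auto simp: in_keys_iff)
        then have "Poly_Mapping.lookup (swap_exponents f) (j, - p') \<noteq> 0" by simp
        from spans_exists[OF finite_row this] obtain lo hi
          where sp: "spans (\<lambda>i. Poly_Mapping.lookup (swap_exponents f) (i, - p')) lo hi" by blast
        then have lo: "Poly_Mapping.lookup (swap_exponents f) (lo, - p') \<noteq> 0" by (simp add: spans_def)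
        have "- q \<le> lo" using lex[of "- p'" lo] lo by (auto simp: in_keys_iff)
        have ind': "laurent_indep x2 x1" and ex': "x3 * x1 = x2 ^ c + 1"
          using laurent_indep_sym[OF ind] ex by (simp_all add: mult.commute)
        have "laurent_eval (swap_exponents f) x2 x1 = laurent_eval h x2 x3"
          using Suc.prems(2) h by (simp add: laurent_eval_swap)
        from row_width[OF ind' bc(2) ex' this lo]
        consider i' where "lo + int c * p' \<le> i'" "Poly_Mapping.lookup (swap_exponents f) (i', - p') \<noteq> 0"
          | i' where "i' < lo" "Poly_Mapping.lookup (swap_exponents f) (i', - p') \<noteq> 0" by metis
        then show ?thesis
        proof cases
          case 1
          then have "i' \<le> int K" using Suc.prems(3)[of "- p'" i'] by (auto simp: in_keys_iff)
          moreover have "int c * p \<le> int c * p'" using p' by (intro mult_left_mono) auto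
          ultimately show ?thesis using 1 \<open>- q \<le> lo\<close> by linarith
        next
          case 2
          then show ?thesis using sp by (force simp: spans_def)
        qed
      qed
      obtain x where x: "x \<in> M" "pointed b c (p, q) x1 x2 x" using pts by blast
      then obtain g where g: "x - x1 powi (- p) * x2 powi (- q) = laurent_eval g x1 x2"
        "Poly_Mapping.keys g \<subseteq> pbox b c (p, q) - {(- p, - q)}"
        unfolding pointed_def laurents_def by auto
      define g' where "g' = g + frag_of (- p, - q)"
      have xg: "x = laurent_eval g' x1 x2"
        using g(1) by (simp add: g'_def laurent_eval_add laurent_eval_single algebra_simps)
      have g'1: "Poly_Mapping.lookup g' (- p, - q) = 1"
      proof -
        have "Poly_Mapping.lookup g (- p, - q) = 0" using g(2) by (meson Diff_iff in_keys_iff insertI1 subsetD)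
        then show ?thesis by (simp add: g'_def lookup_add)
      qed
      have g'box: "- p \<le> i \<and> i \<le> - p + int b * max q 0 \<and> - q \<le> j \<and> j \<le> - q + int c * max p 0"
        if "(i, j) \<in> Poly_Mapping.keys g'" for i j
      proof -
        have "(i, j) \<in> pbox b c (p, q)"
          using that g(2) Poly_Mapping.keys_add[of g "frag_of (- p, - q)"]
          unfolding g'_def by (auto simp: pbox_def)
        then show ?thesis by (simp add: pbox_def)
      qed
      define n0 where "n0 = Poly_Mapping.lookup f (- p, - q)"
      define f' where "f' = f - frag_cmul n0 g'"
      have yf': "y - of_int n0 * x = laurent_eval f' x1 x2"
        by (simp add: f'_def laurent_eval_diff laurent_eval_frag_cmul Suc.prems(2) xg)
      have f'sub: "(i, j) \<in> Poly_Mapping.keys f \<or> (i, j) \<in> Poly_Mapping.keys g'"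
        if "(i, j) \<in> Poly_Mapping.keys f'" for i j
        using that unfolding f'_def by (auto simp: in_keys_iff lookup_minus)
      have f'0: "Poly_Mapping.lookup f' (- p, - q) = 0"
        unfolding f'_def by (simp add: lookup_minus g'1 n0_def)
      have "y - of_int n0 * x \<in> M"
      proof (rule Suc.IH[OF _ yf'])
        show "y - of_int n0 * x \<in> U" using U_diff Suc.prems(1) x(1) by blast
        fix i j assume ij: "(i, j) \<in> Poly_Mapping.keys f'"
        show "- int K \<le> i \<and> i \<le> int K \<and> - int K \<le> j \<and> j \<le> int K"
          using f'sub[OF ij]
        proof
          assume "(i, j) \<in> Poly_Mapping.keys g'"
          then show ?thesis
            using g'box[of i j] q_le p_le Suc.prems(3)[OF pq(1)]
            by (cases "q > 0"; cases "p > 0") (auto simp: max_def split: if_splits)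
        qed (use Suc.prems(3) in blast)
        have ge: "W * W - int (Suc n) \<le> rank i j"
          using f'sub[OF ij]
        proof
          assume "(i, j) \<in> Poly_Mapping.keys g'"
          then have "- p \<le> i" "- q \<le> j" using g'box by auto
          then have "(- q + int K) * W \<le> (j + int K) * W"
            by (intro mult_right_mono) (auto simp: W_def)
          then show ?thesis using \<open>- p \<le> i\<close> pq(2) unfolding rank_def by linarith
        qed (use Suc.prems(4) in blast)
        \<comment> \<open>\<open>rank\<close> is injective on the box: columns differ by less than
          \<open>W\<close>, so equal ranks force equal rows and then equal columns.\<close>
        have "rank i j \<noteq> W * W - int (Suc n)"
        proof
          assume eq: "rank i j = W * W - int (Suc n)"
          have "(i, j) \<noteq> (- p, - q)" using ij f'0 by (auto simp: in_keys_iff)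
          moreover have "\<bar>i + p\<bar> < W"
            using f'sub[OF ij] Suc.prems(3)[of i j] Suc.prems(3)[OF pq(1)] g'box[of i j] q_le
            by (cases "q > 0") (auto simp: max_def W_def)
          moreover have r: "(j + q) * W + (i + p) = 0"
            using eq pq(2) unfolding rank_def by (simp add: algebra_simps)
          ultimately have "j + q \<noteq> 0" by auto
          then have "1 * W \<le> \<bar>j + q\<bar> * W" by (intro mult_right_mono) (auto simp: W_def)
          also have "\<bar>j + q\<bar> * W = \<bar>(j + q) * W\<bar>" by (simp add: abs_mult W_def)
          also have "\<dots> = \<bar>i + p\<bar>" using r by linarith
          finally show False using \<open>\<bar>i + p\<bar> < W\<close> by linarith
        qed
        then show "W * W - int n \<le> rank i j" using ge by simp
      qed
      from M_add[OF this x(1), of n0] show ?thesis by simp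
    qed
  qed
  show ?thesis
  proof (rule main[OF y f K])
    show "W * W - int (nat (W * W)) \<le> rank i j" if "(i, j) \<in> Poly_Mapping.keys f" for i j
      using K[OF that] by (simp add: rank_def W_def)
  qed
qed

section \<open>Cluster sequences and the basis\<close>

abbreviation halfplane :: "int \<Rightarrow> int \<Rightarrow> int \<Rightarrow> (int \<times> int) set" where
  "halfplane l m t \<equiv> {(i, j). l * i + m * j \<le> t}"

lemma halfplane_mult:
  assumes "u \<noteq> 0" "v \<noteq> 0" "y \<in> laurents P (halfplane l m s) u v" "y' \<in> laurents P (halfplane l m t) u v"
  shows "y * y' \<in> laurents P (halfplane l m (s + t)) u v"
  by (rule laurents_mult[OF assms]) (auto simp: algebra_simps)

lemma halfplane_power:
  assumes "u \<noteq> 0" "v \<noteq> 0" "y \<in> laurents P (halfplane l m s) u v"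
  shows "y ^ n \<in> laurents P (halfplane l m (int n * s)) u v"
proof (induction n)
  case 0
  show ?case using laurents_monomial1[of 0 0 "halfplane l m 0" u v P] by simp
next
  case (Suc n)
  then show ?case using halfplane_mult[OF assms Suc] by (simp add: algebra_simps)
qed

lemma laurents_UNIV_mult:
  assumes "u \<noteq> 0" "v \<noteq> 0" "y \<in> laurents P UNIV u v" "y' \<in> laurents P UNIV u v"
  shows "y * y' \<in> laurents P UNIV u v"
  by (rule laurents_mult[OF assms]) simp

lemma pbox_nonneg:
  assumes "0 \<le> p" "0 \<le> q"
  shows "pbox b c (p, q) = {(i, j). - p \<le> i \<and> i \<le> - p + int b * q \<and> - q \<le> j \<and> j \<le> - q + int c * p}"
  using assms by (simp add: pbox_def)

text \<open>For non-negative denominators the side lengths of the boxes are linear in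
  \<open>(p, q)\<close>, so the boxes add up; the corner of the sum arises only from the two
  corners.\<close>

lemma pointed_mult:
  assumes nz: "u \<noteq> 0" "v \<noteq> 0" and nn: "0 \<le> p" "0 \<le> q" "0 \<le> p'" "0 \<le> q'"
    and y: "pointed b c (p, q) u v y" and y': "pointed b c (p', q') u v y'"
  shows "pointed b c (p + p', q + q') u v (y * y')"
proof -
  define M M' where "M = u powi (- p) * v powi (- q)" "M' = u powi (- p') * v powi (- q')"
  define r r' where "r = y - M" "r' = y' - M'"
  let ?S = "pbox b c (p, q) - {(- p, - q)}" and ?S' = "pbox b c (p', q') - {(- p', - q')}"
  let ?T = "pbox b c (p + p', q + q') - {(- (p + p'), - (q + q'))}"
  have r: "r \<in> laurents False ?S u v" "r' \<in> laurents False ?S' u v"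
    using y y' by (simp_all add: pointed_def r_r'_def M_M'_def)
  have M: "M \<in> laurents False {(- p, - q)} u v" "M' \<in> laurents False {(- p', - q')} u v"
    unfolding M_M'_def by (auto intro: laurents_monomial1)
  define B B' C C' where "B = int b * q" "B' = int b * q'" "C = int c * p" "C' = int c * p'"
  have nn': "0 \<le> B" "0 \<le> B'" "0 \<le> C" "0 \<le> C'" using nn by (simp_all add: B_B'_C_C'_def)
  have S: "pbox b c (p, q) = {(i, j). - p \<le> i \<and> i \<le> - p + B \<and> - q \<le> j \<and> j \<le> - q + C}"
    "pbox b c (p', q') = {(i, j). - p' \<le> i \<and> i \<le> - p' + B' \<and> - q' \<le> j \<and> j \<le> - q' + C'}"
    "pbox b c (p + p', q + q') = {(i, j). - (p + p') \<le> i \<and> i \<le> - (p + p') + (B + B') \<and>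
        - (q + q') \<le> j \<and> j \<le> - (q + q') + (C + C')}"
    using nn by (simp_all add: pbox_nonneg B_B'_C_C'_def algebra_simps)
  have "M * r' + r * M' + r * r' \<in> laurents False ?T u v"
    using nn'
    by (intro laurents_add laurents_mult[OF nz M(1) r(2)] laurents_mult[OF nz r(1) M(2)] laurents_mult[OF nz r])
      (auto simp: S)
  moreover have "u powi (- (p + p')) * v powi (- (q + q')) = M * M'"
    using nz power_int_add[of u "- p" "- p'"] power_int_add[of v "- q" "- q'"] unfolding M_M'_def by simp
  moreover have "y * y' - M * M' = M * r' + r * M' + r * r'"
    unfolding r_r'_def by (simp add: algebra_simps)
  ultimately show ?thesis unfolding pointed_def by simp
qed

lemma pointed_one: "pointed b c (0, 0) u v 1"
  by (simp add: pointed_def laurents_zero)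

lemma pointed_power:
  assumes nz: "u \<noteq> 0" "v \<noteq> 0" and nn: "0 \<le> p" "0 \<le> q" and y: "pointed b c (p, q) u v y"
  shows "pointed b c (int n * p, int n * q) u v (y ^ n)"
proof (induction n)
  case (Suc n)
  show ?case
    using pointed_mult[OF nz nn _ _ y Suc] nn by (simp add: algebra_simps)
qed (simp add: pointed_one)

lemma pointed_swap:
  assumes "pointed b c (p, q) u v y" shows "pointed c b (q, p) v u y"
proof -
  have "prod.swap ` (pbox b c (p, q) - {(- p, - q)}) \<subseteq> pbox c b (q, p) - {(- q, - p)}"
    by (auto simp: pbox_def)
  with laurents_mono[OF laurents_swap, OF assms[unfolded pointed_def, simplified] this]
  show ?thesis by (simp add: pointed_def mult.commute)
qed

lemma pointed_sub:
  assumes "pointed b c (p, q) u v y" "y' \<in> laurents False (pbox b c (p, q) - {(- p, - q)}) u v"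
  shows "pointed b c (p, q) u v (y - y')"
  using laurents_diff[OF assms(1)[unfolded pointed_def, simplified] assms(2)]
  by (simp add: pointed_def algebra_simps)

lemma pointed_laurents:
  assumes "pointed b c (p, q) u v y" "pbox b c (p, q) \<subseteq> S" "(- p, - q) \<in> S"
  shows "y \<in> laurents False S u v"
proof -
  have "y - u powi (- p) * v powi (- q) \<in> laurents False S u v"
    using assms(1) unfolding pointed_def case_prod_conv
    by (rule laurents_mono) (use assms in auto)
  from laurents_add[OF this laurents_monomial1[OF assms(3)]] show ?thesis by simp
qed

text \<open>Explicit lists turn support, positivity and box conditions into finite checks, and
  unfold into rational expressions for computations in the field.\<close>

definition lsum :: "(int \<times> int \<times> int) list \<Rightarrow> 'a::field \<Rightarrow> 'a \<Rightarrow> 'a" where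
  "lsum L u v = (\<Sum>(c, i, j)\<leftarrow>L. of_int c * u powi i * v powi j)"

lemma lsum_simps [simp]:
  "lsum [] u v = 0" "lsum ((c, i, j) # L) u v = of_int c * u powi i * v powi j + lsum L u v"
  by (simp_all add: lsum_def)

lemma lsum_laurents:
  "(\<And>c i j. (c, i, j) \<in> set L \<Longrightarrow> (i, j) \<in> S \<and> (P \<longrightarrow> 0 \<le> c)) \<Longrightarrow> lsum L u v \<in> laurents P S u v"
proof (induction L)
  case (Cons a L)
  obtain c i j where a: "a = (c, i, j)" by (cases a)
  show ?case
    unfolding a lsum_simps
  proof (intro laurents_add laurents_monomial Cons.IH)
    show "(i, j) \<in> S" "P \<Longrightarrow> 0 \<le> c" using Cons.prems[of c i j] a by auto
    show "(i', j') \<in> S \<and> (P \<longrightarrow> 0 \<le> c')" if "(c', i', j') \<in> set L" for c' i' j'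
      using Cons.prems[of c' i' j'] that by auto
  qed
qed (simp add: laurents_zero)

lemma lsum_pointed:
  assumes "\<And>c' i j. (c', i, j) \<in> set L \<Longrightarrow> (i, j) \<in> pbox b c (p, q) - {(- p, - q)}"
  shows "pointed b c (p, q) u v (lsum ((1, - p, - q) # L) u v)"
  using lsum_laurents[of L "pbox b c (p, q) - {(- p, - q)}" False u v] assms
  by (simp add: pointed_def)

section \<open>Proper expansions and the weights that certify them\<close>

definition proper_at :: "'a::field \<Rightarrow> 'a \<Rightarrow> 'a \<Rightarrow> bool" where
  "proper_at u v y \<longleftrightarrow> (\<forall>f i j. laurent_eval f u v = y \<longrightarrow> (i, j) \<in> Poly_Mapping.keys f \<longrightarrow>
     0 \<le> i \<longrightarrow> 0 \<le> j \<longrightarrow> y = u ^ nat i * v ^ nat j)"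

lemma proper_at_swap: "proper_at u v y \<Longrightarrow> proper_at v u y"
  unfolding proper_at_def
proof (intro allI impI)
  fix f i j
  assume *: "\<forall>f i j. laurent_eval f u v = y \<longrightarrow> (i, j) \<in> Poly_Mapping.keys f \<longrightarrow>
     0 \<le> i \<longrightarrow> 0 \<le> j \<longrightarrow> y = u ^ nat i * v ^ nat j"
    and f: "laurent_eval f v u = y" "(i, j) \<in> Poly_Mapping.keys f" "0 \<le> i" "0 \<le> j"
  then show "y = v ^ nat i * u ^ nat j"
    using *[rule_format, of "swap_exponents f" j i]
    by (force simp: laurent_eval_swap keys_swap_exponents mult.commute)
qed

lemma proper_at_monomial:
  assumes "laurent_indep u v" shows "proper_at u v (u ^ p * v ^ q)"
  unfolding proper_at_def
proof (intro allI impI)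
  fix f i j
  assume f: "laurent_eval f u v = u ^ p * v ^ q" "(i, j) \<in> Poly_Mapping.keys f"
  have "laurent_eval f u v = laurent_eval (frag_of (int p, int q)) u v"
    by (simp add: f laurent_eval_single)
  then have "f = frag_of (int p, int q)" by (rule laurent_indepD[OF assms])
  with f show "u ^ p * v ^ q = u ^ nat i * v ^ nat j" by simp
qed

text \<open>For non-negative weights a monomial of negative degree has a negative exponent, so the
  condition holds vacuously.\<close>

lemma proper_at_halfplane:
  assumes "laurent_indep u v" "0 \<le> l" "0 \<le> m" "y \<in> laurents False (halfplane l m (- 1)) u v"
  shows "proper_at u v y"
  unfolding proper_at_def
proof (intro allI impI)
  fix f i j
  assume f: "laurent_eval f u v = y" "(i, j) \<in> Poly_Mapping.keys f" "0 \<le> i" "0 \<le> j"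
  have "Poly_Mapping.keys f \<subseteq> halfplane l m (- 1)"
    using assms(1,4) f(1) laurents_lookup(1) by blast
  with f have "l * i + m * j \<le> - 1" by blast
  moreover have "0 \<le> l * i" "0 \<le> m * j" using f assms by simp_all
  ultimately show "y = u ^ nat i * v ^ nat j" by simp
qed

lemma proper_at_cluster_monomial:
  assumes "laurent_indep u v" "0 \<le> l" "0 \<le> m"
    and "y \<in> laurents False (halfplane l m (- 1)) u v" "y' \<in> laurents False (halfplane l m (- 1)) u v"
  shows "proper_at u v (y ^ r * y' ^ s)"
proof (cases "r = 0 \<and> s = 0")
  \<comment> \<open>The exponents \<open>r = s = 0\<close> give the element 1, which has degree 0
    and is treated as a monomial of the initial cluster.\<close>
  case True
  then show ?thesis using proper_at_monomial[OF assms(1), of 0 0] by simp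
next
  case False
  have nz: "u \<noteq> 0" "v \<noteq> 0" using assms(1) by (simp_all add: laurent_indep_def)
  have "y ^ r * y' ^ s \<in> laurents False (halfplane l m (int r * - 1 + int s * - 1)) u v"
    by (intro halfplane_mult halfplane_power nz assms)
  then have "y ^ r * y' ^ s \<in> laurents False (halfplane l m (- 1)) u v"
    by (rule laurents_mono) (use False in auto)
  then show ?thesis using proper_at_halfplane assms(1-3) by blast
qed

text \<open>Abstracts from \<open>cluster_var\<close> so that shifted and reflected sequences are
  again instances; statements about all clusters then reduce to the expansion in \<open>x 1\<close>
  and \<open>x 2\<close>.\<close>

definition rank2_seq :: "nat \<Rightarrow> nat \<Rightarrow> (int \<Rightarrow> 'a::field) \<Rightarrow> bool" where
  "rank2_seq b c x \<longleftrightarrow> b > 0 \<and> c > 0 \<and>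
     (\<forall>m. x (m - 1) * x (m + 1) = x m ^ exch_exp b c m + 1) \<and>
     (\<forall>m. laurent_indep (x m) (x (m + 1)))"

lemma rank2_seq_exchange: "rank2_seq b c x \<Longrightarrow> x (m - 1) * x (m + 1) = x m ^ exch_exp b c m + 1"
  and rank2_seq_indep: "rank2_seq b c x \<Longrightarrow> laurent_indep (x m) (x (m + 1))"
  and rank2_seq_nonzero: "rank2_seq b c x \<Longrightarrow> x m \<noteq> 0"
  and rank2_seq_pos: "rank2_seq b c x \<Longrightarrow> b > 0" "rank2_seq b c x \<Longrightarrow> c > 0"
  unfolding rank2_seq_def laurent_indep_def by blast+

lemma rank2_seq_indep12: "rank2_seq b c x \<Longrightarrow> laurent_indep (x 1) (x 2)"
  using rank2_seq_indep[of b c x 1] by simp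

lemma rank2_seq_next:
  assumes "rank2_seq b c x"
  shows "x (m + 1) = (x m ^ exch_exp b c m + 1) / x (m - 1)"
    "x (m - 1) = (x m ^ exch_exp b c m + 1) / x (m + 1)"
  using rank2_seq_exchange[OF assms, of m] rank2_seq_nonzero[OF assms] by (auto simp: field_simps)

text \<open>The exponents at the positions 1 and 2 of the shifted sequence are the old ones at
  \<open>s + 1\<close> and \<open>s + 2\<close>, and \<open>s\<close> has the parity of the
  latter.\<close>

lemma rank2_seq_shift:
  assumes "rank2_seq b c x"
  shows "rank2_seq (exch_exp b c (s + 1)) (exch_exp b c s) (\<lambda>m. x (m + s))"
proof -
  have "x (m - 1 + s) * x (m + 1 + s) =
      x (m + s) ^ exch_exp (exch_exp b c (s + 1)) (exch_exp b c s) m + 1" for m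
    using rank2_seq_exchange[OF assms, of "m + s"] by (auto simp: exch_exp_def algebra_simps)
  then show ?thesis
    using assms rank2_seq_indep[OF assms, of "m + s" for m]
    by (simp add: rank2_seq_def exch_exp_def algebra_simps)
qed

text \<open>The reflection interchanges \<open>x 1\<close> with \<open>x 2\<close> and odd with even
  indices, hence \<open>b\<close> with \<open>c\<close>.\<close>

lemma rank2_seq_reflect:
  assumes "rank2_seq b c x"
  shows "rank2_seq c b (\<lambda>m. x (3 - m))"
proof -
  have 1: "x (3 - (m - 1)) * x (3 - (m + 1)) = x (3 - m) ^ exch_exp c b m + 1" for m
    using rank2_seq_exchange[OF assms, of "3 - m"] by (auto simp: exch_exp_def algebra_simps)
  have 2: "laurent_indep (x (3 - m)) (x (3 - (m + 1)))" for m
    using laurent_indep_sym[OF rank2_seq_indep[OF assms, of "2 - m"]] by (simp add: algebra_simps)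
  show ?thesis using assms 1 2 by (simp add: rank2_seq_def)
qed

text \<open>Chebyshev polynomials of the first kind, normalised so that \<open>t + 1 / t\<close> is
  sent to \<open>t ^ n + 1 / t ^ n\<close>; hence the initial value 2.\<close>

fun cheb :: "'a::comm_ring_1 \<Rightarrow> nat \<Rightarrow> 'a" where
  "cheb z 0 = 2"
| "cheb z (Suc 0) = z"
| "cheb z (Suc (Suc n)) = z * cheb z (Suc n) - cheb z n"

text \<open>
  The element \<open>z\<close> of the affine types, characterised by its expansion in every cluster, so that
  it does not depend on the choice of an initial cluster.
\<close>

definition affine_elt :: "nat \<Rightarrow> nat \<Rightarrow> (int \<Rightarrow> 'a::field) \<Rightarrow> 'a \<Rightarrow> bool" where
  "affine_elt b c x z \<longleftrightarrow> (\<forall>m.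
     if exch_exp b c m = 1 then z * x m * x (m + 1) ^ 2 = (x m + 1) ^ 2 + x (m + 1) ^ 4
     else if exch_exp b c m = 2 then z * x m * x (m + 1) = x m ^ 2 + x (m + 1) ^ 2 + 1
     else z * x (m + 1) * x m ^ 2 = (x (m + 1) + 1) ^ 2 + x m ^ 4)"

definition cluster_monomials :: "(int \<Rightarrow> 'a::field) \<Rightarrow> 'a set" where
  "cluster_monomials x = {x k ^ p * x (k + 1) ^ q | k p q. True}"

text \<open>Binding \<open>z\<close> inside the set keeps the definition uniform in \<open>b\<close>
  and \<open>c\<close> and invariant under shift and reflection. The index 0 is excluded because
  \<open>cheb z 0 = 2\<close>, while 1 already is a cluster monomial.\<close>

definition canonical_basis :: "nat \<Rightarrow> nat \<Rightarrow> (int \<Rightarrow> 'a::field) \<Rightarrow> 'a set" where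
  "canonical_basis b c x = cluster_monomials x \<union>
     {cheb z n | z n. b * c = 4 \<and> 1 \<le> n \<and> affine_elt b c x z}"

lemma cluster_monomialsI: "x k ^ p * x (k + 1) ^ q \<in> cluster_monomials x"
  unfolding cluster_monomials_def by blast

lemma cluster_monomials_shift: "cluster_monomials (\<lambda>m. x (m + s)) = cluster_monomials x"
proof -
  have "x k ^ p * x (k + 1) ^ q = x (k - s + s) ^ p * x (k - s + 1 + s) ^ q" for k p q by simp
  moreover have "x (k + s) ^ p * x (k + 1 + s) ^ q = x (k + s) ^ p * x (k + s + 1) ^ q" for k p q
    by (simp add: algebra_simps)
  ultimately show ?thesis unfolding cluster_monomials_def by blast
qed

lemma cluster_monomials_reflect: "cluster_monomials (\<lambda>m. x (3 - m)) = cluster_monomials x"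
proof -
  have "x k ^ p * x (k + 1) ^ q = x (3 - (2 - k)) ^ q * x (3 - (2 - k + 1)) ^ p" for k p q
    by (simp add: algebra_simps)
  moreover have "x (3 - k) ^ p * x (3 - (k + 1)) ^ q = x (2 - k) ^ q * x (2 - k + 1) ^ p" for k p q
    by (simp add: algebra_simps)
  ultimately show ?thesis unfolding cluster_monomials_def by blast
qed

lemma exch_exp_shift:
  "exch_exp (exch_exp b c (s + 1)) (exch_exp b c s) m = exch_exp b c (m + s)"
  by (auto simp: exch_exp_def)

lemma affine_elt_shift:
  "affine_elt (exch_exp b c (s + 1)) (exch_exp b c s) (\<lambda>m. x (m + s)) z \<longleftrightarrow> affine_elt b c x z"
  (is "?L \<longleftrightarrow> ?R")
proof
  show "?R \<Longrightarrow> ?L"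
    unfolding affine_elt_def exch_exp_shift
  proof
    fix m
    assume *: "\<forall>m. if exch_exp b c m = 1 then z * x m * x (m + 1) ^ 2 = (x m + 1) ^ 2 + x (m + 1) ^ 4
     else if exch_exp b c m = 2 then z * x m * x (m + 1) = x m ^ 2 + x (m + 1) ^ 2 + 1
     else z * x (m + 1) * x m ^ 2 = (x (m + 1) + 1) ^ 2 + x m ^ 4"
    have eq: "m + 1 + s = m + s + 1" by simp
    show "if exch_exp b c (m + s) = 1 then z * x (m + s) * x (m + 1 + s) ^ 2 = (x (m + s) + 1) ^ 2 + x (m + 1 + s) ^ 4
     else if exch_exp b c (m + s) = 2 then z * x (m + s) * x (m + 1 + s) = x (m + s) ^ 2 + x (m + 1 + s) ^ 2 + 1
     else z * x (m + 1 + s) * x (m + s) ^ 2 = (x (m + 1 + s) + 1) ^ 2 + x (m + s) ^ 4"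
      unfolding eq by (rule spec[OF *])
  qed
  show "?L \<Longrightarrow> ?R"
    unfolding affine_elt_def exch_exp_shift
  proof
    fix m
    assume *: "\<forall>m. if exch_exp b c (m + s) = 1 then z * x (m + s) * x (m + 1 + s) ^ 2 = (x (m + s) + 1) ^ 2 + x (m + 1 + s) ^ 4
     else if exch_exp b c (m + s) = 2 then z * x (m + s) * x (m + 1 + s) = x (m + s) ^ 2 + x (m + 1 + s) ^ 2 + 1
     else z * x (m + 1 + s) * x (m + s) ^ 2 = (x (m + 1 + s) + 1) ^ 2 + x (m + s) ^ 4"
    have eq: "m - s + s = m" "m - s + 1 + s = m + 1" by simp_all
    show "if exch_exp b c m = 1 then z * x m * x (m + 1) ^ 2 = (x m + 1) ^ 2 + x (m + 1) ^ 4
     else if exch_exp b c m = 2 then z * x m * x (m + 1) = x m ^ 2 + x (m + 1) ^ 2 + 1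
     else z * x (m + 1) * x m ^ 2 = (x (m + 1) + 1) ^ 2 + x m ^ 4"
      using spec[OF *, of "m - s"] unfolding eq .
  qed
qed

lemma product_four:
  fixes b c :: nat
  assumes "b * c = 4"
  shows "(b = 1 \<and> c = 4) \<or> (b = 2 \<and> c = 2) \<or> (b = 4 \<and> c = 1)"
proof -
  have "b dvd 4" using assms by (metis dvd_triv_left)
  then have "b \<le> 4" by (rule dvd_imp_le) simp
  then have "b = 0 \<or> b = 1 \<or> b = 2 \<or> b = 3 \<or> b = 4" by linarith
  moreover have "b \<noteq> 3"
  proof
    assume "b = 3"
    with assms have "3 * c = 4" by simp
    then show False by presburger
  qed
  ultimately show ?thesis using assms by auto
qed

lemma affine_elt_reflect_imp:
  assumes bc: "b * c = 4" and a: "affine_elt b c x z"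
  shows "affine_elt c b (\<lambda>m. x (3 - m)) z"
  unfolding affine_elt_def
proof
  fix m :: int
  have m: "3 - (m + 1) = 2 - m" "3 - m = 2 - m + 1" by simp_all
  note * = a[unfolded affine_elt_def, rule_format, of "2 - m"]
  show "if exch_exp c b m = 1 then z * x (3 - m) * x (3 - (m + 1)) ^ 2 = (x (3 - m) + 1) ^ 2 + x (3 - (m + 1)) ^ 4
     else if exch_exp c b m = 2 then z * x (3 - m) * x (3 - (m + 1)) = x (3 - m) ^ 2 + x (3 - (m + 1)) ^ 2 + 1
     else z * x (3 - (m + 1)) * x (3 - m) ^ 2 = (x (3 - (m + 1)) + 1) ^ 2 + x (3 - m) ^ 4"
    using * product_four[OF bc] unfolding m(1) unfolding m(2)
    by (cases "odd m") (auto simp: exch_exp_def algebra_simps)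
qed

lemma affine_elt_reflect:
  assumes "b * c = 4"
  shows "affine_elt c b (\<lambda>m. x (3 - m)) z \<longleftrightarrow> affine_elt b c x z"
  using affine_elt_reflect_imp[OF assms, of x z] affine_elt_reflect_imp[of c b "\<lambda>m. x (3 - m)" z] assms
  by (auto simp: mult.commute)

lemma canonical_basis_shift:
  "canonical_basis (exch_exp b c (s + 1)) (exch_exp b c s) (\<lambda>m. x (m + s)) = canonical_basis b c x"
proof -
  have "exch_exp b c (s + 1) * exch_exp b c s = b * c" by (auto simp: exch_exp_def)
  then show ?thesis
    unfolding canonical_basis_def cluster_monomials_shift affine_elt_shift by simp
qed

lemma canonical_basis_reflect:
  "canonical_basis c b (\<lambda>m. x (3 - m)) = canonical_basis b c x"
  unfolding canonical_basis_def cluster_monomials_reflect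
  using affine_elt_reflect[of b c x] by (auto simp: mult.commute)

text \<open>Collects what is needed of a single cluster; the other clusters follow by
  \<open>canonical_basis_shift\<close> and \<open>canonical_basis_reflect\<close>.\<close>

definition cluster_good :: "nat \<Rightarrow> nat \<Rightarrow> (int \<Rightarrow> 'a::field) \<Rightarrow> bool" where
  "cluster_good b c x \<longleftrightarrow>
     (\<forall>y\<in>canonical_basis b c x. y \<in> laurents True UNIV (x 1) (x 2) \<and> proper_at (x 1) (x 2) y) \<and>
     (\<forall>p q. \<exists>y\<in>canonical_basis b c x. pointed b c (p, q) (x 1) (x 2) y)"

lemma cluster_good_reflect:
  assumes "cluster_good c b (\<lambda>m. x (3 - m))"
  shows "cluster_good b c x"
proof -
  note a = assms[unfolded cluster_good_def canonical_basis_reflect, simplified]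
  have 1: "y \<in> laurents True UNIV (x 1) (x 2)" "proper_at (x 1) (x 2) y" if "y \<in> canonical_basis b c x" for y
    using a that laurents_mono[OF laurents_swap, of y True UNIV "x 2" "x 1" UNIV True] proper_at_swap by auto
  have 2: "\<exists>y\<in>canonical_basis b c x. pointed b c (p, q) (x 1) (x 2) y" for p q
    using a pointed_swap by metis
  show ?thesis unfolding cluster_good_def using 1 2 by blast
qed

text \<open>The weights \<open>(1, 0)\<close> give \<open>x 3\<close> degree -1 but
  \<open>x 2\<close> only degree 0, so \<open>s = 0\<close> is treated as a monomial of the initial
  cluster.\<close>

lemma proper_at_adjacent:
  assumes "rank2_seq b c x"
  shows "proper_at (x 1) (x 2) (x 2 ^ r * x 3 ^ s)"
proof (cases "s = 0")
  case True
  then show ?thesis using proper_at_monomial[OF rank2_seq_indep12[OF assms], of 0 r] by simp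
next
  case False
  note nz = rank2_seq_nonzero[OF assms]
  have "x 3 = lsum [(1, - 1, int c), (1, - 1, 0)] (x 1) (x 2)"
    using rank2_seq_next(1)[OF assms, of 2] nz by (simp add: exch_exp_def field_simps)
  moreover have "lsum [(1, - 1, int c), (1, - 1, 0)] (x 1) (x 2) \<in> laurents False (halfplane 1 0 (- 1)) (x 1) (x 2)"
    by (rule lsum_laurents) auto
  ultimately have 3: "x 3 \<in> laurents False (halfplane 1 0 (- 1)) (x 1) (x 2)" by simp
  have 2: "x 2 \<in> laurents False (halfplane 1 0 0) (x 1) (x 2)"
    using laurents_monomial1[of 0 1 "halfplane 1 0 0" "x 1" "x 2" False] by simp
  have "x 2 ^ r * x 3 ^ s \<in> laurents False (halfplane 1 0 (int r * 0 + int s * - 1)) (x 1) (x 2)"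
    by (intro halfplane_mult halfplane_power nz 2 3)
  then have "x 2 ^ r * x 3 ^ s \<in> laurents False (halfplane 1 0 (- 1)) (x 1) (x 2)"
    by (rule laurents_mono) (use False in auto)
  then show ?thesis by (intro proper_at_halfplane[where l = 1 and m = 0] rank2_seq_indep12[OF assms]) auto
qed

text \<open>The element is a monomial in \<open>x 1, x 2\<close> if \<open>p \<le> 0\<close> and in
  \<open>x 2, x 3\<close> otherwise, since \<open>x 3\<close> has denominator
  \<open>(1, 0)\<close>.\<close>

lemma cluster_good_pointed_nonpos:
  assumes "rank2_seq b c x" "q \<le> 0"
  shows "\<exists>y\<in>cluster_monomials x. pointed b c (p, q) (x 1) (x 2) y"
proof (cases "p \<le> 0")
  case True
  then have "pointed b c (p, q) (x 1) (x 2) (x 1 ^ nat (- p) * x (1 + 1) ^ nat (- q))"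
    using assms by (simp add: pointed_def power_int_def laurents_zero)
  then show ?thesis using cluster_monomialsI by blast
next
  case False
  note nz = rank2_seq_nonzero[OF assms(1)]
  have x3: "x 3 = lsum [(1, - 1, 0), (1, - 1, int c)] (x 1) (x 2)"
    using rank2_seq_next(1)[OF assms(1), of 2] nz by (simp add: exch_exp_def field_simps)
  have "c > 0" using assms(1) by (rule rank2_seq_pos)
  then have "pointed b c (1, 0) (x 1) (x 2) (x 3)"
    unfolding x3 using lsum_pointed[of "[(1, - 1, int c)]" b c 1 0 "x 1" "x 2"] by (simp add: pbox_def)
  from pointed_power[OF nz nz _ _ this, of "nat p"]
  have pt: "pointed b c (p, 0) (x 1) (x 2) (x 3 ^ nat p)" using False by simp
  \<comment> \<open>\<open>pointed_mult\<close> covers only non-negative denominators. Here the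
    other factor is a power of \<open>x 2\<close>, which merely translates the box, and
    \<open>max q 0 = 0\<close> gives the box the size belonging to \<open>(p, 0)\<close>.\<close>
  have "x 2 powi (- q) * (x 3 ^ nat p - x 1 powi (- p)) \<in>
      laurents False (pbox b c (p, q) - {(- p, - q)}) (x 1) (x 2)"
  proof (rule laurents_mult[OF nz nz])
    show "x 2 powi (- q) \<in> laurents False {(0, - q)} (x 1) (x 2)"
      using laurents_monomial1[of 0 "- q" "{(0, - q)}" "x 1" "x 2" False] by simp
    show "x 3 ^ nat p - x 1 powi (- p) \<in> laurents False (pbox b c (p, 0) - {(- p, 0)}) (x 1) (x 2)"
      using pt by (simp add: pointed_def)
  qed (use assms(2) in \<open>auto simp: pbox_def\<close>)
  then have "pointed b c (p, q) (x 1) (x 2) (x 2 ^ nat (- q) * x (2 + 1) ^ nat p)"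
    using assms(2) by (simp add: pointed_def power_int_def algebra_simps split: if_splits)
  then show ?thesis using cluster_monomialsI by blast
qed

lemma cluster_good_pointed_boundary:
  assumes "rank2_seq b c x" "p \<le> 0 \<or> q \<le> 0"
  shows "\<exists>y\<in>cluster_monomials x. pointed b c (p, q) (x 1) (x 2) y"
proof (cases "q \<le> 0")
  case False
  then show ?thesis
    using cluster_good_pointed_nonpos[OF rank2_seq_reflect[OF assms(1)], of p q] assms(2) pointed_swap
    by (fastforce simp: cluster_monomials_reflect)
qed (use cluster_good_pointed_nonpos[OF assms(1)] in blast)

section \<open>Finite types\<close>

lemma canonical_basis_cluster_monomials:
  "b * c \<noteq> 4 \<Longrightarrow> canonical_basis b c x = cluster_monomials x"
  by (simp add: canonical_basis_def)

text \<open>Reduces a finite type to a table over one period \<open>P\<close>: the expansions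
  \<open>L\<close>, weights for every cluster not adjacent to the initial one, and denominators
  \<open>(A k, B k)\<close> whose consecutive pairs generate all positive integer vectors.\<close>

lemma cluster_good_finite:
  fixes P :: int and L :: "int \<Rightarrow> (int \<times> int \<times> int) list"
  assumes rs: "rank2_seq b c x" and bc: "b * c \<noteq> 4"
    and per: "\<And>k. \<exists>k'. 1 \<le> k' \<and> k' \<le> P \<and> x k = x k' \<and> x (k + 1) = x (k' + 1)"
    and xP: "x P = x 0" "x (P + 1) = x 1"
    and L: "\<And>k. 3 \<le> k \<Longrightarrow> k \<le> P \<Longrightarrow> x k = lsum (L k) (x 1) (x 2) \<and> (\<forall>(c, i, j)\<in>set (L k). 0 \<le> c)"
    and wt: "\<And>k. 3 \<le> k \<Longrightarrow> k < P \<Longrightarrow> \<exists>l m. 0 \<le> l \<and> 0 \<le> m \<and>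
        (\<forall>(c, i, j)\<in>set (L k) \<union> set (L (k + 1)). l * i + m * j \<le> - 1)"
    and pt: "\<And>k. 3 \<le> k \<Longrightarrow> k \<le> P \<Longrightarrow> pointed b c (A k, B k) (x 1) (x 2) (x k) \<and> 0 \<le> A k \<and> 0 \<le> B k"
    and cone: "\<And>p q. 0 < p \<Longrightarrow> 0 < q \<Longrightarrow> \<exists>k r s. 3 \<le> k \<and> k < P \<and> 0 \<le> r \<and> 0 \<le> s \<and>
        p = r * A k + s * A (k + 1) \<and> q = r * B k + s * B (k + 1)"
  shows "cluster_good b c x"
proof -
  note nz = rank2_seq_nonzero[OF rs]
  note ind = rank2_seq_indep12[OF rs]
  have pos: "x k \<in> laurents True UNIV (x 1) (x 2)" if "1 \<le> k" "k \<le> P + 1" for k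
  proof -
    have one: "x 1 \<in> laurents True UNIV (x 1) (x 2)"
      using laurents_monomial1[of 1 0 UNIV "x 1" "x 2" True] by simp
    have two: "x 2 \<in> laurents True UNIV (x 1) (x 2)"
      using laurents_monomial1[of 0 1 UNIV "x 1" "x 2" True] by simp
    have "x k \<in> laurents True UNIV (x 1) (x 2)" if k: "3 \<le> k" "k \<le> P"
    proof -
      have "lsum (L k) (x 1) (x 2) \<in> laurents True UNIV (x 1) (x 2)"
        using L[OF k] by (intro lsum_laurents) auto
      then show ?thesis using L[OF k] by simp
    qed
    moreover have "k = 1 \<or> k = 2 \<or> (3 \<le> k \<and> k \<le> P) \<or> k = P + 1" using that by linarith
    ultimately show ?thesis using one two xP(2) by auto
  qed
  have proper: "proper_at (x 1) (x 2) (x k ^ r * x (k + 1) ^ s)" if k: "1 \<le> k" "k \<le> P" for k r s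
  proof -
    consider "k = 1" | "k = 2" | "3 \<le> k" "k < P" | "k = P" using k by linarith
    then show ?thesis
    proof cases
      case 1 then show ?thesis using proper_at_monomial[OF ind] by simp
    next
      case 2 then show ?thesis using proper_at_adjacent[OF rs] by simp
    next
      case 3
      from wt[OF this] obtain l m where lm: "0 \<le> l" "0 \<le> m"
        "\<forall>(c, i, j)\<in>set (L k) \<union> set (L (k + 1)). l * i + m * j \<le> - 1" by blast
      have "lsum (L k) (x 1) (x 2) \<in> laurents False (halfplane l m (- 1)) (x 1) (x 2)"
        "lsum (L (k + 1)) (x 1) (x 2) \<in> laurents False (halfplane l m (- 1)) (x 1) (x 2)"
        using lm(3) by (intro lsum_laurents; force)+
      then show ?thesis
        using L[of k] L[of "k + 1"] 3 by (intro proper_at_cluster_monomial[OF ind lm(1,2)]) simp_all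
    next
      \<comment> \<open>As \<open>x P = x 0\<close>, this is the left neighbour of the initial
        cluster, reached by reflecting \<open>proper_at_adjacent\<close>.\<close>
      case 4
      show ?thesis
        using proper_at_swap[OF proper_at_adjacent[OF rank2_seq_reflect[OF rs], of s r]]
        by (simp add: 4 xP mult.commute)
    qed
  qed
  have "y \<in> laurents True UNIV (x 1) (x 2) \<and> proper_at (x 1) (x 2) y" if "y \<in> cluster_monomials x" for y
  proof -
    obtain k r s where y: "y = x k ^ r * x (k + 1) ^ s"
      using \<open>y \<in> cluster_monomials x\<close> unfolding cluster_monomials_def by blast
    obtain k' where k': "1 \<le> k'" "k' \<le> P" "x k = x k'" "x (k + 1) = x (k' + 1)"
      using per by blast
    show ?thesis
      unfolding y k'(3,4) using k'
      by (intro conjI proper laurents_UNIV_mult laurents_power_UNIV pos nz) auto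
  qed
  moreover have "\<exists>y\<in>cluster_monomials x. pointed b c (p, q) (x 1) (x 2) y" for p q
  proof (cases "p \<le> 0 \<or> q \<le> 0")
    case True
    then show ?thesis by (rule cluster_good_pointed_boundary[OF rs])
  next
    case False
    then obtain k r s where k: "3 \<le> k" "k < P" "0 \<le> r" "0 \<le> s"
        "p = r * A k + s * A (k + 1)" "q = r * B k + s * B (k + 1)"
      using cone[of p q] by auto
    note p1 = pt[of k] and p2 = pt[of "k + 1"]
    have "pointed b c (int (nat r) * A k + int (nat s) * A (k + 1), int (nat r) * B k + int (nat s) * B (k + 1))
        (x 1) (x 2) (x k ^ nat r * x (k + 1) ^ nat s)"
      using k p1 p2 by (intro pointed_mult pointed_power nz mult_nonneg_nonneg) simp_all
    then have "pointed b c (p, q) (x 1) (x 2) (x k ^ nat r * x (k + 1) ^ nat s)" using k by simp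
    then show ?thesis using cluster_monomialsI by blast
  qed
  ultimately show ?thesis
    unfolding cluster_good_def canonical_basis_cluster_monomials[OF bc] by blast
qed

lemma int_induct_both:
  fixes Q :: "int \<Rightarrow> bool"
  assumes "Q a" "\<And>m. Q m \<Longrightarrow> Q (m + 1)" "\<And>m. Q m \<Longrightarrow> Q (m - 1)"
  shows "Q m"
  by (rule int_induct[of Q a]) (use assms in auto)

text \<open>One repeated pair of neighbours suffices: the exchange relation carries the repetition
  in both directions, as translation by \<open>P\<close> preserves the exponents.\<close>

lemma rank2_seq_periodic:
  assumes rs: "rank2_seq b c x" and P: "P > 0" "\<And>m. exch_exp b c (m + P) = exch_exp b c m"
    and x: "x (P + 1) = x 1" "x (P + 2) = x 2"
  shows "x P = x 0" "\<exists>k'. 1 \<le> k' \<and> k' \<le> P \<and> x k = x k' \<and> x (k + 1) = x (k' + 1)"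
proof -
  have "x (m + P) = x m \<and> x (m + 1 + P) = x (m + 1)" for m
  proof (rule int_induct_both[where a = 1 and m = m and Q = "\<lambda>m. x (m + P) = x m \<and> x (m + 1 + P) = x (m + 1)"])
    show "x (1 + P) = x 1 \<and> x (1 + 1 + P) = x (1 + 1)" using x by (simp add: add.commute)
  next
    fix m assume m: "x (m + P) = x m \<and> x (m + 1 + P) = x (m + 1)"
    have "x (m + 1 + P + 1) = x (m + 1 + 1)"
      using rank2_seq_next(1)[OF rs, of "m + 1 + P"] rank2_seq_next(1)[OF rs, of "m + 1"] m P(2)[of "m + 1"]
      by simp
    then show "x (m + 1 + P) = x (m + 1) \<and> x (m + 1 + 1 + P) = x (m + 1 + 1)"
      using m by (simp add: algebra_simps)
  next
    fix m assume m: "x (m + P) = x m \<and> x (m + 1 + P) = x (m + 1)"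
    have "x (m + P - 1) = x (m - 1)"
      using rank2_seq_next(2)[OF rs, of "m + P"] rank2_seq_next(2)[OF rs, of "m"] m P(2)[of m]
      by (simp add: algebra_simps)
    then show "x (m - 1 + P) = x (m - 1) \<and> x (m - 1 + 1 + P) = x (m - 1 + 1)"
      using m by (simp add: algebra_simps)
  qed
  then have per: "x (m + P) = x m" for m by blast
  then show "x P = x 0" by (metis add_0)
  have n: "x (m + n * P) = x m" for m n
  proof (rule int_induct_both[where a = 0 and m = n and Q = "\<lambda>n. x (m + n * P) = x m"])
    fix n assume n: "x (m + n * P) = x m"
    have "m + (n + 1) * P = m + n * P + P" by (simp add: algebra_simps)
    then show "x (m + (n + 1) * P) = x m" using n per by metis
  next
    fix n assume n: "x (m + n * P) = x m"
    have "m + n * P = m + (n - 1) * P + P" by (simp add: algebra_simps)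
    then show "x (m + (n - 1) * P) = x m" using n per by metis
  qed simp
  have "k = (k - 1) mod P + 1 + (k - 1) div P * P" by simp
  then have "x k = x ((k - 1) mod P + 1)" "x (k + 1) = x ((k - 1) mod P + 1 + 1)"
    using n[of "(k - 1) mod P + 1" "(k - 1) div P"] n[of "(k - 1) mod P + 1 + 1" "(k - 1) div P"]
    by (simp_all add: algebra_simps)
  moreover have "1 \<le> (k - 1) mod P + 1" "(k - 1) mod P + 1 \<le> P"
    using pos_mod_sign[OF P(1), of "k - 1"] pos_mod_bound[OF P(1), of "k - 1"] by linarith+
  ultimately show "\<exists>k'. 1 \<le> k' \<and> k' \<le> P \<and> x k = x k' \<and> x (k + 1) = x (k' + 1)" by blast
qed

text \<open>Lets a closed form of the next variable be verified by a single product.\<close>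

lemma rank2_seq_nextI:
  assumes "rank2_seq b c x" "x (m - 1) * w = x m ^ exch_exp b c m + 1"
  shows "x (m + 1) = w"
  using rank2_seq_exchange[OF assms(1), of m] assms(2) rank2_seq_nonzero[OF assms(1), of "m - 1"]
  by (metis mult_cancel_left)

text \<open>Type A2, of period 5; the denominators of \<open>x 3\<close>, \<open>x 4\<close>,
  \<open>x 5\<close> are the positive roots \<open>(1, 0)\<close>, \<open>(1, 1)\<close>,
  \<open>(0, 1)\<close>.\<close>

lemma cluster_good_A2:
  assumes rs: "rank2_seq 1 1 x"
  shows "cluster_good 1 1 x"
proof -
  define u v where "u = x 1" "v = x 2"
  note nz = rank2_seq_nonzero[OF rs]
  have uv: "u \<noteq> 0" "v \<noteq> 0" using nz by (simp_all add: u_v_def)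
  have x3: "x 3 = (v + 1) / u"
    using rank2_seq_nextI[OF rs, of 2 "(v + 1) / u"] uv by (simp add: exch_exp_def u_v_def)
  have x4: "x 4 = (v + 1 + u) / (u * v)"
    using rank2_seq_nextI[OF rs, of 3 "(v + 1 + u) / (u * v)"] uv by (simp add: exch_exp_def u_v_def[symmetric] x3 field_simps)
  have x5: "x 5 = (u + 1) / v"
    using rank2_seq_nextI[OF rs, of 4 "(u + 1) / v"] uv by (simp add: exch_exp_def u_v_def[symmetric] x3 x4 field_simps)
  have x6: "x 6 = u"
    using rank2_seq_nextI[OF rs, of 5 u] uv by (simp add: exch_exp_def u_v_def[symmetric] x5 x4 field_simps)
  have x7: "x 7 = v"
    using rank2_seq_nextI[OF rs, of 6 v] uv by (simp add: exch_exp_def u_v_def[symmetric] x5 x6 field_simps)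
  have per0: "(0::int) < 5" "\<And>m. exch_exp 1 1 (m + 5) = exch_exp 1 1 m" "x (5 + 1) = x 1" "x (5 + 2) = x 2"
    using x6 x7 by (simp_all add: exch_exp_def u_v_def)
  note per = rank2_seq_periodic[OF rs per0]
  define L :: "int \<Rightarrow> (int \<times> int \<times> int) list" where
    "L k = (if k = 3 then [(1, -1, 0), (1, -1, 1)]
       else if k = 4 then [(1, -1, -1), (1, -1, 0), (1, 0, -1)]
       else [(1, 0, -1), (1, 1, -1)])" for k
  define A :: "int \<Rightarrow> int" where "A k = (if k = 5 then 0 else 1)" for k
  define B :: "int \<Rightarrow> int" where "B k = (if k = 3 then 0 else 1)" for k
  have cases: "3 \<le> k \<Longrightarrow> k \<le> 5 \<Longrightarrow> k = 3 \<or> k = 4 \<or> k = 5" for k :: int by linarith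
  have L: "x k = lsum (L k) u v" if "3 \<le> k" "k \<le> 5" for k
    using cases[OF that] uv by (auto simp: L_def x3 x4 x5 power_int_minus field_simps)
  show ?thesis
  proof (rule cluster_good_finite[OF rs, of 5 L A B])
    show "\<exists>k'. 1 \<le> k' \<and> k' \<le> 5 \<and> x k = x k' \<and> x (k + 1) = x (k' + 1)" for k
      by (rule per(2))
    show "x 5 = x 0" by (rule per(1))
    show "x (5 + 1) = x 1" by (rule per0(3))
    show "x k = lsum (L k) (x 1) (x 2) \<and> (\<forall>(c, i, j)\<in>set (L k). 0 \<le> c)" if "3 \<le> k" "k \<le> 5" for k
      using L[OF that] by (auto simp: u_v_def L_def)
    show "\<exists>l m. 0 \<le> l \<and> 0 \<le> m \<and> (\<forall>(c, i, j)\<in>set (L k) \<union> set (L (k + 1)). l * i + m * j \<le> - 1)"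
      if "3 \<le> k" "k < 5" for k
    proof -
      have "k = 3 \<or> k = 4" using that by linarith
      then show ?thesis
        \<comment> \<open>The weights \<open>(2, 1)\<close> and \<open>(1, 2)\<close> are the values
          at 1 and 2 of the tropical exchange sequence that is -1 at \<open>k\<close> and
          \<open>k + 1\<close>.\<close>
        by (elim disjE; intro exI[of _ "if k = 3 then 2 else 1"] exI[of _ "if k = 3 then 1 else 2"])
          (simp_all add: L_def)
    qed
    show "pointed 1 1 (A k, B k) (x 1) (x 2) (x k) \<and> 0 \<le> A k \<and> 0 \<le> B k" if k: "3 \<le> k" "k \<le> 5" for k
    proof -
      have "L k = (1, - A k, - B k) # tl (L k)"
        using cases[OF k] by (auto simp: L_def A_def B_def)
      moreover have "pointed 1 1 (A k, B k) u v (lsum ((1, - A k, - B k) # tl (L k)) u v)"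
        by (rule lsum_pointed) (use cases[OF k] in \<open>auto simp: L_def A_def B_def pbox_def\<close>)
      ultimately show ?thesis using L[OF k] by (simp add: u_v_def A_def B_def)
    qed
    fix p q :: int assume "0 < p" "0 < q"
    show "\<exists>k r s. 3 \<le> k \<and> k < 5 \<and> 0 \<le> r \<and> 0 \<le> s \<and> p = r * A k + s * A (k + 1) \<and> q = r * B k + s * B (k + 1)"
    proof (cases "q \<le> p")
      case True
      then show ?thesis using \<open>0 < q\<close> by (intro exI[of _ 3] exI[of _ "p - q"] exI[of _ q]) (simp add: A_def B_def)
    next
      case False
      then show ?thesis using \<open>0 < p\<close> by (intro exI[of _ 4] exI[of _ p] exI[of _ "q - p"]) (simp add: A_def B_def)
    qed
  qed simp
qed

text \<open>Type B2, of period 6, with denominators \<open>(1, 0)\<close>, \<open>(1, 1)\<close>,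
  \<open>(1, 2)\<close>, \<open>(0, 1)\<close>. The weights again belong to the tropical sequences
  that are -1 at \<open>k\<close> and \<open>k + 1\<close>.\<close>

lemma cluster_good_B2:
  assumes rs: "rank2_seq 1 2 x"
  shows "cluster_good 1 2 x"
proof -
  define u v where "u = x 1" "v = x 2"
  note nz = rank2_seq_nonzero[OF rs]
  have uv: "u \<noteq> 0" "v \<noteq> 0" using nz by (simp_all add: u_v_def)
  have x3: "x 3 = (v\<^sup>2 + 1) / u"
    using rank2_seq_nextI[OF rs, of 2 "(v\<^sup>2 + 1) / u"] uv by (simp add: exch_exp_def u_v_def)
  have x4: "x 4 = (v\<^sup>2 + 1 + u) / (u * v)"
    using rank2_seq_nextI[OF rs, of 3 "(v\<^sup>2 + 1 + u) / (u * v)"] uv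
    by (simp add: exch_exp_def u_v_def[symmetric] x3 field_simps)
  have x5: "x 5 = ((u + 1)\<^sup>2 + v\<^sup>2) / (u * v\<^sup>2)"
    using rank2_seq_nextI[OF rs, of 4 "((u + 1)\<^sup>2 + v\<^sup>2) / (u * v\<^sup>2)"] uv
    by (simp add: exch_exp_def u_v_def[symmetric] x3 x4 field_simps power2_eq_square)
  have x6: "x 6 = (u + 1) / v"
    using rank2_seq_nextI[OF rs, of 5 "(u + 1) / v"] uv
    by (simp add: exch_exp_def u_v_def[symmetric] x5 x4 field_simps power2_eq_square)
  have x7: "x 7 = u"
    using rank2_seq_nextI[OF rs, of 6 u] uv
    by (simp add: exch_exp_def u_v_def[symmetric] x5 x6 field_simps power2_eq_square)
  have x8: "x 8 = v"
    using rank2_seq_nextI[OF rs, of 7 v] uv by (simp add: exch_exp_def u_v_def[symmetric] x7 x6 field_simps)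
  have per0: "(0::int) < 6" "\<And>m. exch_exp 1 2 (m + 6) = exch_exp 1 2 m" "x (6 + 1) = x 1" "x (6 + 2) = x 2"
    using x7 x8 by (simp_all add: exch_exp_def u_v_def)
  note per = rank2_seq_periodic[OF rs per0]
  define L :: "int \<Rightarrow> (int \<times> int \<times> int) list" where
    "L k = (if k = 3 then [(1, -1, 0), (1, -1, 2)]
       else if k = 4 then [(1, -1, -1), (1, -1, 1), (1, 0, -1)]
       else if k = 5 then [(1, -1, -2), (2, 0, -2), (1, 1, -2), (1, -1, 0)]
       else [(1, 0, -1), (1, 1, -1)])" for k
  define A :: "int \<Rightarrow> int" where "A k = (if k = 6 then 0 else 1)" for k
  define B :: "int \<Rightarrow> int" where "B k = (if k = 3 then 0 else if k = 5 then 2 else 1)" for k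
  have cases: "3 \<le> k \<Longrightarrow> k \<le> 6 \<Longrightarrow> k = 3 \<or> k = 4 \<or> k = 5 \<or> k = 6" for k :: int by linarith
  have L: "x k = lsum (L k) u v" if "3 \<le> k" "k \<le> 6" for k
    using cases[OF that] uv by (auto simp: L_def x3 x4 x5 x6 power_int_minus field_simps power2_eq_square)
  show ?thesis
  proof (rule cluster_good_finite[OF rs, of 6 L A B])
    show "\<exists>k'. 1 \<le> k' \<and> k' \<le> 6 \<and> x k = x k' \<and> x (k + 1) = x (k' + 1)" for k
      by (rule per(2))
    show "x 6 = x 0" by (rule per(1))
    show "x (6 + 1) = x 1" by (rule per0(3))
    show "x k = lsum (L k) (x 1) (x 2) \<and> (\<forall>(c, i, j)\<in>set (L k). 0 \<le> c)" if "3 \<le> k" "k \<le> 6" for k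
      using L[OF that] by (auto simp: u_v_def L_def)
    show "\<exists>l m. 0 \<le> l \<and> 0 \<le> m \<and> (\<forall>(c, i, j)\<in>set (L k) \<union> set (L (k + 1)). l * i + m * j \<le> - 1)"
      if "3 \<le> k" "k < 6" for k
    proof -
      have "k = 3 \<or> k = 4 \<or> k = 5" using that by linarith
      then show ?thesis
        by (elim disjE; intro exI[of _ "if k = 3 then 3 else if k = 4 then 3 else 1"]
              exI[of _ "if k = 3 then 1 else 2"])
          (simp_all add: L_def)
    qed
    show "pointed 1 2 (A k, B k) (x 1) (x 2) (x k) \<and> 0 \<le> A k \<and> 0 \<le> B k" if k: "3 \<le> k" "k \<le> 6" for k
    proof -
      have "L k = (1, - A k, - B k) # tl (L k)"
        using cases[OF k] by (auto simp: L_def A_def B_def)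
      moreover have "pointed 1 2 (A k, B k) u v (lsum ((1, - A k, - B k) # tl (L k)) u v)"
        by (rule lsum_pointed) (use cases[OF k] in \<open>auto simp: L_def A_def B_def pbox_def\<close>)
      ultimately show ?thesis using L[OF k] by (simp add: u_v_def A_def B_def)
    qed
    fix p q :: int assume pq: "0 < p" "0 < q"
    consider "q \<le> p" | "p \<le> q" "q \<le> 2 * p" | "2 * p \<le> q" by linarith
    then show "\<exists>k r s. 3 \<le> k \<and> k < 6 \<and> 0 \<le> r \<and> 0 \<le> s \<and> p = r * A k + s * A (k + 1) \<and> q = r * B k + s * B (k + 1)"
    proof cases
      case 1
      then show ?thesis using pq by (intro exI[of _ 3] exI[of _ "p - q"] exI[of _ q]) (simp add: A_def B_def)
    next
      case 2
      then show ?thesis using pq by (intro exI[of _ 4] exI[of _ "2 * p - q"] exI[of _ "q - p"]) (simp add: A_def B_def)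
    next
      case 3
      then show ?thesis using pq by (intro exI[of _ 5] exI[of _ p] exI[of _ "q - 2 * p"]) (simp add: A_def B_def)
    qed
  qed simp
qed

text \<open>Type G2, of period 8, with the six positive roots as denominators. Consecutive ones have
  determinant 1, so the cone coordinates in the five cases are integral.\<close>

lemma cluster_good_G2:
  assumes rs: "rank2_seq 1 3 x"
  shows "cluster_good 1 3 x"
proof -
  define u v where "u = x 1" "v = x 2"
  note nz = rank2_seq_nonzero[OF rs]
  have uv: "u \<noteq> 0" "v \<noteq> 0" using nz by (simp_all add: u_v_def)
  \<comment> \<open>The numerator of \<open>x 5\<close>, that is the quotient of
    \<open>(v^3 + 1 + u)^3 + u^3 * v^3\<close> by \<open>v^3 + 1\<close>.\<close>
  define N where "N = v^6 + 2*v^3 + 1 + 3*u*v^3 + 3*u + 3*u^2 + u^3"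
  have x3: "x 3 = (v^3 + 1) / u"
    using rank2_seq_nextI[OF rs, of 2 "(v^3 + 1) / u"] uv by (simp add: exch_exp_def u_v_def)
  have x4: "x 4 = (v^3 + 1 + u) / (u * v)"
    using rank2_seq_nextI[OF rs, of 3 "(v^3 + 1 + u) / (u * v)"] uv
    by (simp add: exch_exp_def u_v_def[symmetric] x3 field_simps)
  have x5: "x 5 = N / (u^2 * v^3)"
  proof -
    have "(v^3 + 1) * N = (v^3 + 1 + u)^3 + u^3 * v^3" unfolding N_def by algebra
    then have "(v^3 + 1) / u * (N / (u^2 * v^3)) = ((v^3 + 1 + u) / (u * v))^3 + 1"
      using uv by (simp add: power_divide power_mult_distrib divide_simps power2_eq_square power3_eq_cube)
    then show ?thesis
      using rank2_seq_nextI[OF rs, of 4 "N / (u^2 * v^3)"] by (simp add: exch_exp_def u_v_def[symmetric] x3 x4)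
  qed
  have x6: "x 6 = ((u + 1)^2 + v^3) / (u * v^2)"
  proof -
    have "(v^3 + 1 + u) * ((u + 1)^2 + v^3) = N + u^2 * v^3" unfolding N_def by algebra
    then have "(v^3 + 1 + u) / (u * v) * (((u + 1)^2 + v^3) / (u * v^2)) = N / (u^2 * v^3) + 1"
      using uv by (simp add: divide_simps power2_eq_square power3_eq_cube)
    then show ?thesis
      using rank2_seq_nextI[OF rs, of 5 "((u + 1)^2 + v^3) / (u * v^2)"]
      by (simp add: exch_exp_def u_v_def[symmetric] x5 x4)
  qed
  have x7: "x 7 = ((u + 1)^3 + v^3) / (u * v^3)"
  proof -
    have "N * ((u + 1)^3 + v^3) = ((u + 1)^2 + v^3)^3 + u^3 * v^6" unfolding N_def by algebra
    then have "N / (u^2 * v^3) * (((u + 1)^3 + v^3) / (u * v^3)) = (((u + 1)^2 + v^3) / (u * v^2))^3 + 1"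
      using uv by (simp add: power_divide power_mult_distrib divide_simps eval_nat_numeral)
    then show ?thesis
      using rank2_seq_nextI[OF rs, of 6 "((u + 1)^3 + v^3) / (u * v^3)"]
      by (simp add: exch_exp_def u_v_def[symmetric] x5 x6)
  qed
  have x8: "x 8 = (u + 1) / v"
  proof -
    have "((u + 1)^2 + v^3) * (u + 1) = (u + 1)^3 + v^3 + u * v^3" by algebra
    then have "((u + 1)^2 + v^3) / (u * v^2) * ((u + 1) / v) = ((u + 1)^3 + v^3) / (u * v^3) + 1"
      using uv by (simp add: divide_simps power2_eq_square power3_eq_cube)
    then show ?thesis
      using rank2_seq_nextI[OF rs, of 7 "(u + 1) / v"]
      by (simp add: exch_exp_def u_v_def[symmetric] x7 x6)
  qed
  have x9: "x 9 = u"
    using rank2_seq_nextI[OF rs, of 8 u] uv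
    by (simp add: exch_exp_def u_v_def[symmetric] x7 x8 power_divide field_simps)
  have x10: "x 10 = v"
    using rank2_seq_nextI[OF rs, of 9 v] uv by (simp add: exch_exp_def u_v_def[symmetric] x8 x9 field_simps)
  have per0: "(0::int) < 8" "\<And>m. exch_exp 1 3 (m + 8) = exch_exp 1 3 m" "x (8 + 1) = x 1" "x (8 + 2) = x 2"
    using x9 x10 by (simp_all add: exch_exp_def u_v_def)
  note per = rank2_seq_periodic[OF rs per0]
  define L :: "int \<Rightarrow> (int \<times> int \<times> int) list" where
    "L k = (if k = 3 then [(1, -1, 0), (1, -1, 3)]
       else if k = 4 then [(1, -1, -1), (1, -1, 2), (1, 0, -1)]
       else if k = 5 then [(1, -2, -3), (1, -2, 3), (2, -2, 0), (3, -1, 0), (3, -1, -3), (3, 0, -3), (1, 1, -3)]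
       else if k = 6 then [(1, -1, -2), (2, 0, -2), (1, 1, -2), (1, -1, 1)]
       else if k = 7 then [(1, -1, -3), (3, 0, -3), (3, 1, -3), (1, 2, -3), (1, -1, 0)]
       else [(1, 0, -1), (1, 1, -1)])" for k
  define A :: "int \<Rightarrow> int" where "A k = (if k = 8 then 0 else if k = 5 then 2 else 1)" for k
  define B :: "int \<Rightarrow> int" where
    "B k = (if k = 3 then 0 else if k = 4 then 1 else if k = 5 then 3 else if k = 6 then 2 else if k = 7 then 3 else 1)" for k
  have cases: "3 \<le> k \<Longrightarrow> k \<le> 8 \<Longrightarrow> k = 3 \<or> k = 4 \<or> k = 5 \<or> k = 6 \<or> k = 7 \<or> k = 8" for k :: int by linarith
  have L: "x k = lsum (L k) u v" if "3 \<le> k" "k \<le> 8" for k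
  proof -
    have "x 3 = lsum (L 3) u v" "x 4 = lsum (L 4) u v" "x 8 = lsum (L 8) u v"
      using uv by (simp_all add: L_def x3 x4 x8 power_int_minus field_simps eval_nat_numeral)
    moreover have "x 5 = lsum (L 5) u v"
    proof -
      have "N = u^2 * v^3 * lsum (L 5) u v"
        using uv by (simp add: L_def N_def power_int_minus field_simps eval_nat_numeral)
      then show ?thesis using uv by (simp add: x5)
    qed
    moreover have "x 6 = lsum (L 6) u v" "x 7 = lsum (L 7) u v"
      using uv by (simp_all add: L_def x6 x7 power_int_minus field_simps eval_nat_numeral)
    ultimately show ?thesis using cases[OF that] by blast
  qed
  show ?thesis
  proof (rule cluster_good_finite[OF rs, of 8 L A B])
    show "\<exists>k'. 1 \<le> k' \<and> k' \<le> 8 \<and> x k = x k' \<and> x (k + 1) = x (k' + 1)" for k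
      by (rule per(2))
    show "x 8 = x 0" by (rule per(1))
    show "x (8 + 1) = x 1" by (rule per0(3))
    show "x k = lsum (L k) (x 1) (x 2) \<and> (\<forall>(c, i, j)\<in>set (L k). 0 \<le> c)" if "3 \<le> k" "k \<le> 8" for k
      using L[OF that] by (auto simp: u_v_def L_def)
    show "\<exists>l m. 0 \<le> l \<and> 0 \<le> m \<and> (\<forall>(c, i, j)\<in>set (L k) \<union> set (L (k + 1)). l * i + m * j \<le> - 1)"
      if "3 \<le> k" "k < 8" for k
    proof -
      \<comment> \<open>Each pair of weights below starts a tropical exchange sequence that is
        negative at \<open>k\<close> and \<open>k + 1\<close>.\<close>
      have "k = 3 \<or> k = 4 \<or> k = 5 \<or> k = 6 \<or> k = 7" using that by linarith
      then consider "k = 3" | "k = 4" | "k = 5" | "k = 6" | "k = 7" by blast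
      then show ?thesis
      proof cases
        case 1
        show ?thesis unfolding 1 by (intro exI[of _ 4] exI[of _ 1]) (simp add: L_def)
      next
        case 2
        show ?thesis unfolding 2 by (intro exI[of _ 5] exI[of _ 2]) (simp add: L_def)
      next
        case 3
        show ?thesis unfolding 3 by (intro exI[of _ 7] exI[of _ 4]) (simp add: L_def)
      next
        case 4
        show ?thesis unfolding 4 by (intro exI[of _ 5] exI[of _ 4]) (simp add: L_def)
      next
        case 5
        show ?thesis unfolding 5 by (intro exI[of _ 1] exI[of _ 2]) (simp add: L_def)
      qed
    qed
    show "pointed 1 3 (A k, B k) (x 1) (x 2) (x k) \<and> 0 \<le> A k \<and> 0 \<le> B k" if k: "3 \<le> k" "k \<le> 8" for k
    proof -
      have "L k = (1, - A k, - B k) # tl (L k)"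
        using cases[OF k] by (auto simp: L_def A_def B_def)
      moreover have "pointed 1 3 (A k, B k) u v (lsum ((1, - A k, - B k) # tl (L k)) u v)"
        by (rule lsum_pointed) (use cases[OF k] in \<open>auto simp: L_def A_def B_def pbox_def\<close>)
      ultimately show ?thesis using L[OF k] by (simp add: u_v_def A_def B_def)
    qed
    fix p q :: int assume pq: "0 < p" "0 < q"
    consider "q \<le> p" | "p \<le> q" "2 * q \<le> 3 * p" | "3 * p \<le> 2 * q" "q \<le> 2 * p"
      | "2 * p \<le> q" "q \<le> 3 * p" | "3 * p \<le> q" by linarith
    then show "\<exists>k r s. 3 \<le> k \<and> k < 8 \<and> 0 \<le> r \<and> 0 \<le> s \<and> p = r * A k + s * A (k + 1) \<and> q = r * B k + s * B (k + 1)"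
    proof cases
      case 1
      then show ?thesis using pq by (intro exI[of _ 3] exI[of _ "p - q"] exI[of _ q]) (simp add: A_def B_def)
    next
      case 2
      then show ?thesis using pq by (intro exI[of _ 4] exI[of _ "3 * p - 2 * q"] exI[of _ "q - p"]) (simp add: A_def B_def)
    next
      case 3
      then show ?thesis using pq by (intro exI[of _ 5] exI[of _ "2 * p - q"] exI[of _ "2 * q - 3 * p"]) (simp add: A_def B_def)
    next
      case 4
      then show ?thesis using pq by (intro exI[of _ 6] exI[of _ "3 * p - q"] exI[of _ "q - 2 * p"]) (simp add: A_def B_def)
    next
      case 5
      then show ?thesis using pq by (intro exI[of _ 7] exI[of _ p] exI[of _ "q - 3 * p"]) (simp add: A_def B_def)
    qed
  qed simp
qed

section \<open>Affine types\<close>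

text \<open>\<open>z\<close> is a conserved quantity: exchanging \<open>p\<close> for
  \<open>r\<close> preserves its defining equation, as multiplication by \<open>p\<close> or
  \<open>p ^ 2\<close> shows. The exponent at \<open>q\<close> is 4, 1 or 2, the last with both
  orders of the pair.\<close>

lemma affine_elt_step:
  fixes p q r z :: "'a::field"
  assumes "p \<noteq> 0" "q \<noteq> 0" "r \<noteq> 0"
  shows "p * r = q ^ 4 + 1 \<Longrightarrow> z * p * q ^ 2 = (p + 1) ^ 2 + q ^ 4 \<Longrightarrow> z * r * q ^ 2 = (r + 1) ^ 2 + q ^ 4"
    "p * r = q + 1 \<Longrightarrow> z * q * p ^ 2 = (q + 1) ^ 2 + p ^ 4 \<Longrightarrow> z * q * r ^ 2 = (q + 1) ^ 2 + r ^ 4"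
    "p * r = q ^ 2 + 1 \<Longrightarrow> z * p * q = p ^ 2 + q ^ 2 + 1 \<Longrightarrow> z * q * r = q ^ 2 + r ^ 2 + 1"
    "p * r = q ^ 2 + 1 \<Longrightarrow> z * q * p = q ^ 2 + p ^ 2 + 1 \<Longrightarrow> z * r * q = r ^ 2 + q ^ 2 + 1"
proof -
  assume 1: "p * r = q ^ 4 + 1" "z * p * q ^ 2 = (p + 1) ^ 2 + q ^ 4"
  have "p * (z * r * q ^ 2) = p * ((r + 1) ^ 2 + q ^ 4)" using 1 by algebra
  then show "z * r * q ^ 2 = (r + 1) ^ 2 + q ^ 4" using assms by simp
next
  assume 1: "p * r = q + 1" "z * q * p ^ 2 = (q + 1) ^ 2 + p ^ 4"
  have "p ^ 2 * (z * q * r ^ 2) = p ^ 2 * ((q + 1) ^ 2 + r ^ 4)" using 1 by algebra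
  then show "z * q * r ^ 2 = (q + 1) ^ 2 + r ^ 4" using assms by simp
next
  assume 1: "p * r = q ^ 2 + 1" "z * p * q = p ^ 2 + q ^ 2 + 1"
  have "p * (z * q * r) = p * (q ^ 2 + r ^ 2 + 1)" using 1 by algebra
  then show "z * q * r = q ^ 2 + r ^ 2 + 1" using assms by simp
next
  assume 1: "p * r = q ^ 2 + 1" "z * q * p = q ^ 2 + p ^ 2 + 1"
  have "p * (z * r * q) = p * (r ^ 2 + q ^ 2 + 1)" using 1 by algebra
  then show "z * r * q = r ^ 2 + q ^ 2 + 1" using assms by simp
qed

lemma affine_elt_exists:
  assumes rs: "rank2_seq b c x" and bc: "b * c = 4"
  shows "\<exists>z. affine_elt b c x z"
proof -
  note nz = rank2_seq_nonzero[OF rs]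
  let ?R = "\<lambda>z m. if exch_exp b c m = 1 then z * x m * x (m + 1) ^ 2 = (x m + 1) ^ 2 + x (m + 1) ^ 4
     else if exch_exp b c m = 2 then z * x m * x (m + 1) = x m ^ 2 + x (m + 1) ^ 2 + 1
     else z * x (m + 1) * x m ^ 2 = (x (m + 1) + 1) ^ 2 + x m ^ 4"
  define z where "z = (if b = 1 then ((x 1 + 1) ^ 2 + x 2 ^ 4) / (x 1 * x 2 ^ 2)
     else if b = 2 then (x 1 ^ 2 + x 2 ^ 2 + 1) / (x 1 * x 2)
     else ((x 2 + 1) ^ 2 + x 1 ^ 4) / (x 2 * x 1 ^ 2))"
  have "?R z m" for m
  proof (rule int_induct_both[where a = 1 and m = m and Q = "?R z"])
    show "?R z 1" using nz by (auto simp: z_def exch_exp_def field_simps)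
  next
    fix m assume m: "?R z m"
    have e: "x m * x (m + 1 + 1) = x (m + 1) ^ exch_exp b c (m + 1) + 1"
      using rank2_seq_exchange[OF rs, of "m + 1"] by simp
    show "?R z (m + 1)"
      using m e product_four[OF bc]
        affine_elt_step[of "x m" "x (m + 1)" "x (m + 1 + 1)" z, OF nz nz nz]
      by (cases "odd m") (auto simp: exch_exp_def)
  next
    fix m assume m: "?R z m"
    have e: "x (m + 1) * x (m - 1) = x m ^ exch_exp b c m + 1"
      using rank2_seq_exchange[OF rs, of "m"] by (simp add: mult.commute)
    show "?R z (m - 1)"
      using m e product_four[OF bc]
        affine_elt_step[of "x (m + 1)" "x m" "x (m - 1)" z, OF nz nz nz]
      by (cases "odd m") (auto simp: exch_exp_def)
  qed
  then show ?thesis unfolding affine_elt_def by blast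
qed

lemma affine_elt_unique:
  assumes rs: "rank2_seq b c x" and "affine_elt b c x z" "affine_elt b c x z'"
  shows "z = z'"
proof -
  note nz = rank2_seq_nonzero[OF rs]
  note zs = assms(2,3)[unfolded affine_elt_def, rule_format, of 1]
  consider "exch_exp b c 1 = 1" | "exch_exp b c 1 = 2" | "exch_exp b c 1 \<noteq> 1" "exch_exp b c 1 \<noteq> 2" by blast
  then show ?thesis
  proof cases
    case 1
    then have "z * x 1 * x 2 ^ 2 = (x 1 + 1) ^ 2 + x 2 ^ 4" "z' * x 1 * x 2 ^ 2 = (x 1 + 1) ^ 2 + x 2 ^ 4"
      using zs by simp_all
    from trans[OF this(1) this(2)[symmetric]] show ?thesis using nz by simp
  next
    case 2
    then have "z * x 1 * x 2 = x 1 ^ 2 + x 2 ^ 2 + 1" "z' * x 1 * x 2 = x 1 ^ 2 + x 2 ^ 2 + 1"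
      using zs by simp_all
    from trans[OF this(1) this(2)[symmetric]] show ?thesis using nz by simp
  next
    case 3
    then have "z * x 2 * x 1 ^ 2 = (x 2 + 1) ^ 2 + x 1 ^ 4" "z' * x 2 * x 1 ^ 2 = (x 2 + 1) ^ 2 + x 1 ^ 4"
      using zs by simp_all
    from trans[OF this(1) this(2)[symmetric]] show ?thesis using nz by simp
  qed
qed

text \<open>For \<open>D k = S (Suc k) - a * S k\<close> the recurrence reads
  \<open>D (Suc k) = a' * D k + s * S (Suc k)\<close>, because \<open>a * a' = 1\<close>; nothing is
  subtracted. The induction also records the part \<open>a ^ k * S 0\<close> of \<open>S k\<close>
  and the part \<open>a' ^ k * w\<close> of \<open>D k\<close>, whose product \<open>S 0 * w\<close>
  pays for the \<open>- 1\<close> in the second claim.\<close>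

lemma positive_recurrence:
  fixes S :: "nat \<Rightarrow> 'a::field"
  assumes nz: "u \<noteq> 0" "v \<noteq> 0"
    and rec: "\<And>k. S (Suc (Suc k)) = z * S (Suc k) - S k"
    and z: "z = a + a' + s" "a * a' = 1"
    and pos: "a \<in> laurents True UNIV u v" "a' \<in> laurents True UNIV u v" "s \<in> laurents True UNIV u v"
      "S 0 \<in> laurents True UNIV u v" "w \<in> laurents True UNIV u v"
    and S1: "S 1 = a * S 0 + w"
  shows "S k \<in> laurents True UNIV u v"
    "S 0 * w - 1 \<in> laurents True UNIV u v \<Longrightarrow> S k * S (Suc k) - 1 \<in> laurents True UNIV u v"
proof -
  note cl = laurents_add laurents_UNIV_mult[OF nz] laurents_power_UNIV[OF nz] laurents_zero pos
  have main: "S k \<in> laurents True UNIV u v \<and> S k - a ^ k * S 0 \<in> laurents True UNIV u v \<and>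
      S (Suc k) - a * S k - a' ^ k * w \<in> laurents True UNIV u v" for k
  proof (induction k)
    case 0
    then show ?case using S1 by (simp add: cl)
  next
    case (Suc k)
    define d where "d = S (Suc k) - a * S k - a' ^ k * w"
    have d: "d \<in> laurents True UNIV u v" using Suc by (simp add: d_def)
    have Sk: "S (Suc k) = a * S k + a' ^ k * w + d" by (simp add: d_def)
    have 1: "S (Suc k) \<in> laurents True UNIV u v" unfolding Sk using Suc d by (intro cl) auto
    have "S (Suc k) - a ^ Suc k * S 0 = a * (S k - a ^ k * S 0) + a' ^ k * w + d"
      unfolding Sk by (simp add: algebra_simps)
    also have "\<dots> \<in> laurents True UNIV u v" using Suc d by (intro cl) auto
    finally have 2: "S (Suc k) - a ^ Suc k * S 0 \<in> laurents True UNIV u v" .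
    have "a' * S (Suc k) - S k = a' ^ Suc k * w + a' * d"
      using z(2) unfolding Sk by (simp add: algebra_simps)
    then have "S (Suc (Suc k)) - a * S (Suc k) - a' ^ Suc k * w = a' * d + s * S (Suc k)"
      unfolding rec z(1) by (simp add: algebra_simps)
    also have "\<dots> \<in> laurents True UNIV u v" using 1 d by (intro cl)
    finally show ?case using 1 2 by blast
  qed
  then show "S k \<in> laurents True UNIV u v" by blast
  assume w: "S 0 * w - 1 \<in> laurents True UNIV u v"
  have aa: "a ^ k * a' ^ k = 1" using z(2) by (simp flip: power_mult_distrib)
  have "S k * S (Suc k) - 1 = (S k - a ^ k * S 0) * S (Suc k)
      + a ^ k * S 0 * (a * S k + (S (Suc k) - a * S k - a' ^ k * w)) + (a ^ k * a' ^ k * (S 0 * w) - 1)"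
    by (simp add: algebra_simps)
  also have "\<dots> \<in> laurents True UNIV u v"
    using main[of k] main[of "Suc k"] w unfolding aa by (intro cl) auto
  finally show "S k * S (Suc k) - 1 \<in> laurents True UNIV u v" .
qed

text \<open>Multiplication by \<open>z\<close> moves the corner by \<open>(1, g)\<close>, while the
  subtracted term lies off the corner of the box two steps beyond its own. The relations
  \<open>b * g = 2\<close> and \<open>c = 2 * g\<close> make the box of \<open>(p, q)\<close> part
  of that of \<open>(p + 2, q + 2 * g)\<close>.\<close>

lemma pointed_recurrence:
  fixes S :: "nat \<Rightarrow> 'a::field"
  assumes nz: "u \<noteq> 0" "v \<noteq> 0" and g: "b * g = 2" "c = 2 * g"
    and rec: "\<And>k. S (Suc (Suc k)) = z * S (Suc k) - S k"
    and z: "pointed b c (1, int g) u v z"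
    and pq: "0 \<le> p" "0 \<le> q" "pointed b c (p, q) u v (S 1)"
    and S0: "S 0 \<in> laurents False (pbox b c (p + 1, q + int g) - {(- (p + 1), - (q + int g))}) u v"
  shows "pointed b c (p + int k, q + int g * int k) u v (S (Suc k))"
proof -
  have bg: "int b * int g = 2" using g(1) by (metis of_nat_mult of_nat_numeral)
  have "pointed b c (p + int k, q + int g * int k) u v (S (Suc k)) \<and>
     S k \<in> laurents False (pbox b c (p + int k + 1, q + int g * int k + int g) -
        {(- (p + int k + 1), - (q + int g * int k + int g))}) u v" for k
  proof (induction k)
    case 0
    then show ?case using pq S0 by simp
  next
    case (Suc k)
    define P Q where "P = p + int k" "Q = q + int g * int k"
    have PQ: "0 \<le> P" "0 \<le> Q" using pq by (simp_all add: P_Q_def)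
    have "pointed b c (1 + P, int g + Q) u v (z * S (Suc k))"
      using Suc PQ by (intro pointed_mult nz z) (auto simp: P_Q_def)
    then have "pointed b c (P + 1, Q + int g) u v (z * S (Suc k) - S k)"
      using Suc by (intro pointed_sub) (simp_all add: P_Q_def algebra_simps)
    then have 1: "pointed b c (P + 1, Q + int g) u v (S (Suc (Suc k)))" by (simp add: rec)
    have pb: "pbox b c (P, Q) \<subseteq> pbox b c (P + 2, Q + 2 * int g)"
      using PQ g(2) bg by (auto simp: pbox_nonneg algebra_simps)
    have nc: "(- (P + 2), j) \<notin> pbox b c (P, Q)" for j
      using PQ by (auto simp: pbox_nonneg)
    have "pointed b c (P, Q) u v (S (Suc k))" using Suc by (simp add: P_Q_def)
    then have "S (Suc k) \<in> laurents False (pbox b c (P + 2, Q + 2 * int g) - {(- (P + 2), - (Q + 2 * int g))}) u v"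
      by (rule pointed_laurents) (use pb nc PQ in \<open>auto simp: pbox_nonneg\<close>)
    then show ?case using 1 by (simp add: P_Q_def algebra_simps)
  qed
  then show ?thesis by blast
qed

text \<open>The affine types with \<open>b \<le> c\<close>. Here \<open>(1, g)\<close> is the
  denominator of \<open>z\<close>, and \<open>g\<close> is also the index step of the linear
  recurrence.\<close>

locale affine_cluster =
  fixes b c g :: nat and x :: "int \<Rightarrow> 'a::field" and z :: 'a
  assumes rs: "rank2_seq b c x"
    and type: "(b = 2 \<and> c = 2 \<and> g = 1) \<or> (b = 1 \<and> c = 4 \<and> g = 2)"
    and z_elt: "affine_elt b c x z"
begin

lemmas nz = rank2_seq_nonzero[OF rs]
lemmas ind = rank2_seq_indep12[OF rs]

abbreviation "u \<equiv> x 1"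
abbreviation "v \<equiv> x 2"

text \<open>\<open>a\<close> and its inverse \<open>a'\<close> have degree 0 for the weights
  \<open>(g, 1)\<close>, while \<open>s\<close> has negative degree.\<close>

definition "a = v ^ g / u"
definition "a' = u / v ^ g"
definition "s = (if g = 1 then 1 / (u * v) else 2 / v ^ 2 + 1 / (u * v ^ 2))"

lemma bg: "b * g = 2" "c = 2 * g" using type by auto

lemma z_eq: "z = a + a' + s"
proof (cases "g = 1")
  case True
  then have "z * (u * v) = u ^ 2 + v ^ 2 + 1"
    using z_elt[unfolded affine_elt_def, rule_format, of 1] type by (auto simp: exch_exp_def mult.assoc)
  then have "z = (u ^ 2 + v ^ 2 + 1) / (u * v)" using nz by (simp add: eq_divide_eq)
  then show ?thesis unfolding a_def a'_def s_def using True nz by (simp add: field_simps power2_eq_square)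
next
  case False
  then have "g = 2" "z * (u * v ^ 2) = (u + 1) ^ 2 + v ^ 4"
    using z_elt[unfolded affine_elt_def, rule_format, of 1] type by (auto simp: exch_exp_def mult.assoc)
  from this(2) have zq: "z = ((u + 1) ^ 2 + v ^ 4) / (u * v ^ 2)" using nz by (simp add: eq_divide_eq)
  show ?thesis unfolding zq a_def a'_def s_def using nz \<open>g = 2\<close>
    by (simp add: field_simps eval_nat_numeral)
qed

lemma a_inverse: "a * a' = 1" "a' * a = 1"
  using nz by (simp_all add: a_def a'_def)

lemma a_lsum: "a = lsum [(1, - 1, int g)] u v" "a' = lsum [(1, 1, - int g)] u v"
  using nz by (simp_all add: a_def a'_def power_int_minus divide_inverse)

lemma s_lsum: "s = lsum (if g = 1 then [(1, - 1, - 1)] else [(2, 0, - 2), (1, - 1, - 2)]) u v"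
  using nz by (simp add: s_def power_int_minus divide_inverse)

text \<open>The exchange relation and the equation of \<open>z\<close> combine to a linear
  recurrence. For \<open>g = 2\<close> it serves the even variables; the odd ones are reached
  through \<open>odd_var\<close>.\<close>

lemma recurrence:
  assumes "g = 1 \<or> even m"
  shows "x (m + int g) = z * x m - x (m - int g)"
proof (cases "g = 1")
  case True
  then have bc: "b = 2" "c = 2" using type by auto
  have e: "x (m - 1) * x (m + 1) = x m ^ 2 + 1"
    using rank2_seq_exchange[OF rs, of m] bc by (simp add: exch_exp_def)
  have zz: "z * x (m - 1) * x m = x (m - 1) ^ 2 + x m ^ 2 + 1"
    using z_elt[unfolded affine_elt_def, rule_format, of "m - 1"] bc by (simp add: exch_exp_def)
  have "x (m - 1) * (x (m + 1) + x (m - 1)) = x (m - 1) * (z * x m)" using e zz by algebra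
  then have "x (m + 1) + x (m - 1) = z * x m" using nz by simp
  then show ?thesis using True by (simp add: eq_diff_eq)
next
  case False
  then have bc: "b = 1" "c = 4" "g = 2" and m: "even m" using type assms by auto
  define p q where "p = x (m - 1)" "q = x m"
  have pq: "p \<noteq> 0" "q \<noteq> 0" using nz by (simp_all add: p_q_def)
  have e1: "x (m + 1) = (q ^ 4 + 1) / p"
    using rank2_seq_next(1)[OF rs, of m] bc m by (simp add: exch_exp_def p_q_def)
  have e2: "x (m + 2) = (x (m + 1) + 1) / q"
    using rank2_seq_next(1)[OF rs, of "m + 1"] bc m by (simp add: exch_exp_def p_q_def add.commute)
  have e4: "x (m + 2) = ((q ^ 4 + 1) / p + 1) / q" unfolding e2 e1 ..
  have e3: "x (m - 2) = (p + 1) / q"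
    using rank2_seq_next(2)[OF rs, of "m - 1"] bc m by (simp add: exch_exp_def p_q_def)
  have zz: "z * p * q ^ 2 = (p + 1) ^ 2 + q ^ 4"
    using z_elt[unfolded affine_elt_def, rule_format, of "m - 1"] bc m by (simp add: exch_exp_def p_q_def)
  have "p * q * (x (m + 2) + x (m - 2)) = (p + 1) ^ 2 + q ^ 4"
    using pq by (simp add: e3 e4 field_simps power2_eq_square)
  also have "\<dots> = p * q * (z * q)" using zz by algebra
  finally have "x (m + 2) + x (m - 2) = z * q" using pq by simp
  then show ?thesis using bc by (simp add: eq_diff_eq p_q_def)
qed

text \<open>The left sequence starts inside the initial cluster: \<open>L 0 = x g\<close> and \<open>L 1 = x 0\<close>.\<close>

definition R :: "nat \<Rightarrow> 'a" where "R k = x (2 + int g * int k)"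
definition L :: "nat \<Rightarrow> 'a" where "L k = x (int g - int g * int k)"

lemma R_rec: "R (Suc (Suc k)) = z * R (Suc k) - R k"
  using recurrence[of "2 + int g * int (Suc k)"] type by (auto simp: R_def algebra_simps)

lemma L_rec: "L (Suc (Suc k)) = z * L (Suc k) - L k"
proof -
  define m where "m = int g - int g * int (Suc k)"
  have "x (m + int g) = L k" "x m = L (Suc k)" "x (m - int g) = L (Suc (Suc k))"
    unfolding L_def m_def by (rule arg_cong[of _ _ x], simp add: algebra_simps)+
  moreover have "g = 1 \<or> even m" using type by (auto simp: m_def)
  ultimately show ?thesis using recurrence[of m] by simp
qed

text \<open>The exponent at odd indices is \<open>b = 1\<close> here, so an odd variable is a
  product of even neighbours minus 1. This is why such differences need positivity and pointedness
  statements of their own.\<close>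

lemma odd_var:
  assumes "g = 2" "odd m" shows "x m = x (m - 1) * x (m + 1) - 1"
  using rank2_seq_exchange[OF rs, of m] assms type by (simp add: exch_exp_def)

lemma x0: "x 0 = (u ^ b + 1) / v"
  using rank2_seq_next(2)[OF rs, of 1] by (simp add: exch_exp_def)

lemma x3: "x 3 = (v ^ c + 1) / u"
  using rank2_seq_next(1)[OF rs, of 2] by (simp add: exch_exp_def)

lemma x4: "x 4 = (x 3 ^ b + 1) / v"
  using rank2_seq_next(1)[OF rs, of 3] by (simp add: exch_exp_def)

lemma monomials_pos: "u \<in> laurents True UNIV u v" "v \<in> laurents True UNIV u v"
    "1 / u \<in> laurents True UNIV u v" "1 / v \<in> laurents True UNIV u v" "1 \<in> laurents True UNIV u v"
  using laurents_monomial1[of 1 0 UNIV u v True] laurents_monomial1[of 0 1 UNIV u v True]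
    laurents_monomial1[of "- 1" 0 UNIV u v True] laurents_monomial1[of 0 "- 1" UNIV u v True]
    laurents_monomial1[of 0 0 UNIV u v True]
  by (simp_all add: divide_inverse)

lemma as_pos: "a \<in> laurents True UNIV u v" "a' \<in> laurents True UNIV u v" "s \<in> laurents True UNIV u v"
  unfolding a_lsum s_lsum by (rule lsum_laurents; auto split: if_splits)+

lemmas pos_closure = laurents_add laurents_UNIV_mult[OF nz nz] laurents_power_UNIV[OF nz nz]
  laurents_zero monomials_pos as_pos

lemma R_pos:
  "R k \<in> laurents True UNIV u v" "g = 2 \<Longrightarrow> R k * R (Suc k) - 1 \<in> laurents True UNIV u v"
proof -
  \<comment> \<open>\<open>w\<close> is \<open>R 1 - a * R 0\<close>, written without
    subtraction.\<close>
  define w where "w = (if g = 1 then 1 / u else 1 / u * (1 / v) + 1 / v)"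
  have w: "w \<in> laurents True UNIV u v" 
  proof (cases "g = 1")
    case False
    have "1 / u * (1 / v) + 1 / v \<in> laurents True UNIV u v" by (intro pos_closure)
    then show ?thesis unfolding w_def if_not_P[OF False] .
  qed (simp add: w_def monomials_pos)
  have R0: "R 0 = v" by (simp add: R_def)
  have "R 1 = a * R 0 + w"
    unfolding R0 using type
  proof
    assume "b = 2 \<and> c = 2 \<and> g = 1"
    then show "R 1 = a * v + w" unfolding R_def w_def a_def using nz by (simp add: x3 field_simps power2_eq_square)
  next
    assume "b = 1 \<and> c = 4 \<and> g = 2"
    then show "R 1 = a * v + w" unfolding R_def w_def a_def using nz by (simp add: x4 x3 field_simps eval_nat_numeral)
  qed
  note pr = positive_recurrence[of u v R z a a' s w, OF nz nz R_rec z_eq a_inverse(1) as_pos _ w this]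
  show "R k \<in> laurents True UNIV u v" by (rule pr) (simp add: R0 pos_closure)
  assume g: "g = 2"
  have "R 0 * w - 1 = 1 / u" unfolding R0 w_def using nz by (simp add: g field_simps)
  then show "R k * R (Suc k) - 1 \<in> laurents True UNIV u v"
    by (intro pr(2)) (simp_all add: R0 pos_closure)
qed

lemma L_pos:
  "L k \<in> laurents True UNIV u v" "g = 2 \<Longrightarrow> L (Suc k) * L (Suc (Suc k)) - 1 \<in> laurents True UNIV u v"
proof -
  have L0: "L 0 = x (int g)" and L1: "L 1 = x 0" by (simp_all add: L_def)
  have l0: "L 0 \<in> laurents True UNIV u v" using type by (auto simp: L0 intro: pos_closure)
  have L1': "L 1 = a' * L 0 + 1 / v"
    unfolding L0 L1 x0 using type nz by (auto simp: a'_def field_simps power2_eq_square)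
  have "1 / v \<in> laurents True UNIV u v" by (rule pos_closure)
  from positive_recurrence(1)[of u v L z a' a s "1 / v", OF nz nz L_rec _ a_inverse(2) as_pos(2,1,3) l0 this L1']
  show *: "L k \<in> laurents True UNIV u v" for k by (simp add: z_eq)
  assume g: "g = 2"
  \<comment> \<open>To the left, \<open>a'\<close> takes the role of \<open>a\<close>. The product
    claim uses the sequence starting at \<open>L 1\<close>: the \<open>L 0\<close> subtracted in
    \<open>L 2\<close> is absorbed by \<open>a * L 1\<close>, and the positive remainder serves as
    \<open>w\<close>.\<close>
  have "a * L 1 = L 0 + a * (1 / v)"
    unfolding L1' distrib_left mult.assoc[symmetric] a_inverse by simp
  then have "L (Suc 1) = a' * L 1 + (a * (1 / v) + s * L 1)"
    using L_rec[of 0] by (simp add: z_eq algebra_simps)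
  moreover have w: "a * (1 / v) + s * L 1 \<in> laurents True UNIV u v" by (intro pos_closure *)
  ultimately have "L 1 * (a * (1 / v) + s * L 1) - 1 \<in> laurents True UNIV u v \<Longrightarrow>
      L (Suc k) * L (Suc (Suc k)) - 1 \<in> laurents True UNIV u v"
    using positive_recurrence(2)[of u v "\<lambda>k. L (Suc k)" z a' a s "a * (1 / v) + s * L 1" k]
      nz L_rec a_inverse(2) as_pos * by (simp add: z_eq)
  moreover have "L 1 * (a * (1 / v) + s * L 1) - 1 = 1 / u + L 1 * s * L 1"
    unfolding L1 x0 a_def using nz type g by (auto simp: field_simps power2_eq_square)
  moreover have "1 / u + L 1 * s * L 1 \<in> laurents True UNIV u v" by (intro pos_closure *)
  ultimately show "L (Suc k) * L (Suc (Suc k)) - 1 \<in> laurents True UNIV u v" by simp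
qed

lemma var_cases:
  obtains (one) "m = 1" | (R) k where "m = 2 + int g * int k" "x m = R k"
  | (L) k where "m = - int g * int k" "x m = L (Suc k)"
  | (oddR) k where "g = 2" "m = 2 + int g * int k + 1" "x m = R k * R (Suc k) - 1"
  | (oddL) k where "g = 2" "m = - int g * int k - 1" "x m = L (Suc k) * L (Suc (Suc k)) - 1"
proof (cases "g = 1 \<or> even m")
  case True
  show thesis
  proof (cases "m \<ge> 2")
    case 2: True
    define k where "k = nat ((m - 2) div int g)"
    have "m = 2 + int g * int k"
      using True 2 type by (auto simp: k_def)
    then show thesis using R[of k] by (simp add: R_def)
  next
    case False
    show thesis
    proof (cases "m = 1")
      case False
      then have "m \<le> 0" using \<open>\<not> m \<ge> 2\<close> by linarith
      define k where "k = nat ((- m) div int g)"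
      have "m = - int g * int k"
        using True \<open>m \<le> 0\<close> type by (auto simp: k_def)
      then show thesis using L[of k] by (simp add: L_def algebra_simps)
    qed (use one in blast)
  qed
next
  case False
  then have g: "g = 2" and m: "odd m" using type by auto
  note o = odd_var[OF g m]
  show thesis
  proof (cases "m \<ge> 3")
    case True
    define k where "k = nat ((m - 3) div 2)"
    have "m = 2 + int g * int k + 1" using True m g by (auto simp: k_def)
    moreover from this have "R k = x (m - 1)" "R (Suc k) = x (m + 1)"
      unfolding R_def by (auto intro!: arg_cong[of _ _ x] simp: g)
    ultimately show thesis using oddR[OF g, of k] o by simp
  next
    case False
    show thesis
    proof (cases "m = 1")
      case False
      then have "m \<le> - 1" using \<open>\<not> m \<ge> 3\<close> m by presburger
      define k where "k = nat ((- m - 1) div 2)"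
      have "m = - int g * int k - 1" using \<open>m \<le> - 1\<close> m g by (auto simp: k_def)
      moreover from this have "L (Suc k) = x (m + 1)" "L (Suc (Suc k)) = x (m - 1)"
        unfolding L_def by (auto intro!: arg_cong[of _ _ x] simp: g)
      ultimately show thesis using oddL[OF g, of k] o by (simp add: mult.commute)
    qed (use one in blast)
  qed
qed

lemma var_pos: "x m \<in> laurents True UNIV u v"
proof (cases m rule: var_cases)
  case one then show ?thesis by (simp add: monomials_pos)
next
  case (R k) then show ?thesis using R_pos(1) by simp
next
  case (L k) then show ?thesis using L_pos(1) by simp
next
  case (oddR k) show ?thesis unfolding oddR(3) by (rule R_pos(2)[OF oddR(1)])
next
  case (oddL k) show ?thesis unfolding oddL(3) by (rule L_pos(2)[OF oddL(1)])
qed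

text \<open>For \<open>s = 0\<close> the difference would vanish; in general each term carries a
  factor \<open>s\<close>, of negative degree. Positivity again rests on the companion
  \<open>r (Suc n) - a * r n\<close>.\<close>

lemma cheb_expansion:
  "cheb z n - a ^ n - a' ^ n \<in> laurents True (halfplane (int g) 1 (- 1)) u v"
proof -
  define r where "r n = cheb z n - a ^ n - a' ^ n" for n
  let ?H = "laurents True (halfplane (int g) 1 (- 1)) u v"
  let ?K = "laurents True (halfplane (int g) 1 0) u v"
  have ak: "a \<in> ?K" "a' \<in> ?K" unfolding a_lsum by (rule lsum_laurents; simp)+
  have s: "s \<in> ?H" unfolding s_lsum by (rule lsum_laurents) (use type in \<open>auto split: if_splits\<close>)
  have pw: "a ^ k \<in> ?K" "a' ^ k \<in> ?K" for k
    using halfplane_power[OF nz nz ak(1), of k] halfplane_power[OF nz nz ak(2), of k] by simp_all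
  have KH: "p * q \<in> ?H" if "p \<in> ?K" "q \<in> ?H" for p q using halfplane_mult[OF nz nz that] by simp
  have HH: "p * q \<in> ?H" if "p \<in> ?H" "q \<in> ?H" for p q
    using halfplane_mult[OF nz nz that] by (rule laurents_mono) auto
  have "r n \<in> ?H \<and> r (Suc n) - a * r n \<in> ?H" for n
  proof (induction n)
    case 0
    have "r 0 = 0" "r 1 = s" by (simp_all add: r_def z_eq)
    then show ?case using s by (simp add: laurents_zero)
  next
    case (Suc n)
    have "r (Suc n) = a * r n + (r (Suc n) - a * r n)" by simp
    also have "\<dots> \<in> ?H" using Suc by (intro laurents_add KH ak) auto
    finally have 1: "r (Suc n) \<in> ?H" .
    have e: "a * a' ^ Suc n = a' ^ n" "a' * a ^ Suc n = a ^ n"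
      by (simp_all add: a_inverse flip: mult.assoc)
    have c: "cheb z k = r k + a ^ k + a' ^ k" for k by (simp add: r_def)
    have "r (Suc (Suc n)) = z * cheb z (Suc n) - cheb z n - a ^ Suc (Suc n) - a' ^ Suc (Suc n)"
      by (simp add: r_def)
    also have "\<dots> = (a + a' + s) * (r (Suc n) + a ^ Suc n + a' ^ Suc n) - (r n + a ^ n + a' ^ n)
        - a * a ^ Suc n - a' * a' ^ Suc n"
      unfolding c by (simp only: z_eq power_Suc)
    also have "\<dots> = a * r (Suc n) + (a' * r (Suc n) - (a' * a) * r n) + s * r (Suc n)
        + s * (a ^ Suc n + a' ^ Suc n) + (a * a' ^ Suc n - a' ^ n) + (a' * a ^ Suc n - a ^ n)"
      unfolding a_inverse mult_1_left by (simp only: algebra_simps)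
    finally have "r (Suc (Suc n)) - a * r (Suc n) =
        a' * (r (Suc n) - a * r n) + s * r (Suc n) + (a ^ Suc n + a' ^ Suc n) * s"
      unfolding e by (simp add: algebra_simps)
    also have "\<dots> \<in> ?H"
      using Suc 1 s by (intro laurents_add KH HH ak pw) auto
    finally show ?case using 1 by blast
  qed
  then show ?thesis by (simp add: r_def)
qed

lemma a_powers: "a ^ n = u powi (- int n) * v powi (int g * int n)"
    "a' ^ n = u powi int n * v powi (- int g * int n)"
  using nz by (simp_all add: a_def a'_def power_mult_distrib power_inverse power_int_minus divide_inverse power_mult flip: of_nat_mult)

text \<open>On the line of degree 0 for the weights \<open>(g, 1)\<close> only \<open>a ^ n\<close>
  and \<open>a' ^ n\<close> remain, so the coefficient of \<open>a' ^ l\<close> tells the elements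
  \<open>cheb z n\<close> apart.\<close>

lemma cheb_lookup:
  assumes "laurent_eval f u v = cheb z n" "1 \<le> n"
  shows "(i, j) \<in> Poly_Mapping.keys f \<Longrightarrow> i < 0 \<or> j < 0"
    "1 \<le> l \<Longrightarrow> Poly_Mapping.lookup f (int l, - int g * int l) = (if l = n then 1 else 0)"
proof -
  obtain h where h: "cheb z n - a ^ n - a' ^ n = laurent_eval h u v"
    "Poly_Mapping.keys h \<subseteq> halfplane (int g) 1 (- 1)"
    using cheb_expansion[of n] unfolding laurents_def by blast
  define f' where "f' = h + frag_of (- int n, int g * int n) + frag_of (int n, - int g * int n)"
  have "laurent_eval f u v = laurent_eval f' u v"
    using h(1) unfolding assms(1) f'_def laurent_eval_add laurent_eval_single
    by (simp add: a_powers algebra_simps)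
  then have f: "f = f'" by (rule laurent_indepD[OF ind])
  have g: "g > 0" using type by auto
  show "i < 0 \<or> j < 0" if "(i, j) \<in> Poly_Mapping.keys f"
  proof (rule ccontr)
    assume neg: "\<not> (i < 0 \<or> j < 0)"
    then have "0 \<le> int g * i + j" by simp
    then have "(i, j) \<notin> Poly_Mapping.keys h" using h(2) by auto
    then have "Poly_Mapping.lookup h (i, j) = 0" by (simp add: in_keys_iff)
    then have "Poly_Mapping.lookup f (i, j) = 0"
      unfolding f f'_def lookup_add lookup_single using neg assms(2) g
      by (auto simp: when_def)
    then show False using that by (simp add: in_keys_iff)
  qed
  show "Poly_Mapping.lookup f (int l, - int g * int l) = (if l = n then 1 else 0)" if "1 \<le> l"
  proof -
    have "(int l, - int g * int l) \<notin> Poly_Mapping.keys h" using h(2) by auto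
    then have "Poly_Mapping.lookup h (int l, - int g * int l) = 0" by (simp add: in_keys_iff)
    then show ?thesis
      unfolding f f'_def lookup_add lookup_single using that assms(2) g
      by (auto simp: when_def)
  qed
qed

lemma cheb_pos: "cheb z n \<in> laurents True UNIV u v"
proof -
  have "cheb z n - a ^ n - a' ^ n \<in> laurents True UNIV u v"
    by (rule laurents_mono[OF cheb_expansion]) auto
  moreover have "cheb z n = (cheb z n - a ^ n - a' ^ n) + a ^ n + a' ^ n" by simp
  ultimately show ?thesis by (metis laurents_add laurents_power_UNIV as_pos(1,2) nz)
qed

lemma cheb_proper: "1 \<le> n \<Longrightarrow> proper_at u v (cheb z n)"
  unfolding proper_at_def using cheb_lookup(1) by (meson linorder_not_less)

section \<open>Denominators in affine type\<close>

lemma z_pointed: "pointed b c (1, int g) u v z"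
proof -
  define M where "M = (if g = 1 then [(1, -1, 1), (1, 1, -1)] else [(1, 1, -2), (1, -1, 2), (2, 0, -2 :: int)] :: (int \<times> int \<times> int) list)"
  have "z = lsum ((1, - 1, - int g) # M) u v"
    using type nz by (auto simp: z_eq a_def a'_def s_def M_def power_int_minus field_simps)
  moreover have "pointed b c (1, int g) u v (lsum ((1, - 1, - int g) # M) u v)"
    by (rule lsum_pointed) (use type in \<open>auto simp: M_def pbox_def\<close>)
  ultimately show ?thesis by simp
qed

lemma cheb_pointed: "pointed b c (1 + int k, int g + int g * int k) u v (cheb z (Suc k))"
proof (rule pointed_recurrence[OF nz nz bg, of _ z])
  show "pointed b c (1, int g) u v (cheb z 1)" using z_pointed by simp
  have "of_int 2 * u powi 0 * v powi 0 \<in> laurents False (pbox b c (1 + 1, int g + int g) - {(- (1 + 1), - (int g + int g))}) u v"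
    by (rule laurents_monomial) (use type in \<open>auto simp: pbox_def\<close>)
  then show "cheb z 0 \<in> laurents False (pbox b c (1 + 1, int g + int g) - {(- (1 + 1), - (int g + int g))}) u v"
    by simp
qed (simp_all add: z_pointed)

text \<open>The denominators of \<open>R (Suc k)\<close> lie on the line
  \<open>q = g * p - 1\<close>, those of \<open>L (Suc k)\<close> on \<open>q = g * p + 1\<close>,
  and those of \<open>cheb z (Suc k)\<close> on the ray between them.\<close>

lemma R_pointed: "pointed b c (1 + int k, int g - 1 + int g * int k) u v (R (Suc k))"
proof (rule pointed_recurrence[where S = R and z = z, OF nz nz bg R_rec z_pointed])
  show "0 \<le> int g - 1" using type by auto
  define M where "M = (if g = 1 then [(1, - 1, 2)] else [(1, -1, 3), (1, 0, -1)] :: (int \<times> int \<times> int) list)"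
  have "R 1 = lsum ((1, - 1, - (int g - 1)) # M) u v"
    using type nz by (auto simp: R_def x3 x4 M_def power_int_minus field_simps eval_nat_numeral)
  moreover have "pointed b c (1, int g - 1) u v (lsum ((1, - 1, - (int g - 1)) # M) u v)"
    by (rule lsum_pointed) (use type in \<open>auto simp: M_def pbox_def\<close>)
  ultimately show "pointed b c (1, int g - 1) u v (R 1)" by simp
  have "u powi 0 * v powi 1 \<in> laurents False (pbox b c (1 + 1, int g - 1 + int g) - {(- (1 + 1), - (int g - 1 + int g))}) u v"
    by (rule laurents_monomial1) (use type in \<open>auto simp: pbox_def\<close>)
  then show "R 0 \<in> laurents False (pbox b c (1 + 1, int g - 1 + int g) - {(- (1 + 1), - (int g - 1 + int g))}) u v"
    by (simp add: R_def)
qed simp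

lemma L_pointed: "pointed b c (int k, 1 + int g * int k) u v (L (Suc k))"
proof -
  have "pointed b c (0 + int k, 1 + int g * int k) u v (L (Suc k))"
  proof (rule pointed_recurrence[where S = L and z = z, OF nz nz bg L_rec z_pointed])
    have "L 1 = lsum ((1, - 0, - 1) # [(1, int b, - 1)]) u v"
      using nz by (simp add: L_def x0 power_int_minus field_simps)
    moreover have "pointed b c (0, 1) u v (lsum ((1, - 0, - 1) # [(1, int b, - 1)]) u v)"
      by (rule lsum_pointed) (use type in \<open>auto simp: pbox_def\<close>)
    ultimately show "pointed b c (0, 1) u v (L 1)" by simp
    have "u powi (if g = 1 then 1 else 0) * v powi (if g = 1 then 0 else 1) \<in>
        laurents False (pbox b c (0 + 1, 1 + int g) - {(- (0 + 1), - (1 + int g))}) u v"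
      by (rule laurents_monomial1) (use type in \<open>auto simp: pbox_def\<close>)
    then show "L 0 \<in> laurents False (pbox b c (0 + 1, 1 + int g) - {(- (0 + 1), - (1 + int g))}) u v"
      using type by (auto simp: L_def)
  qed simp_all
  then show ?thesis by simp
qed

text \<open>The bounds on \<open>p\<close> and \<open>q\<close> put the origin into the box, and it
  is not the corner as \<open>p > 0\<close>.\<close>

lemma pointed_minus_one:
  assumes "0 < p" "0 < q" "p \<le> int b * q" "q \<le> int c * p" "pointed b c (p, q) u v y"
  shows "pointed b c (p, q) u v (y - 1)"
proof (rule pointed_sub[OF assms(5)])
  have "u powi 0 * v powi 0 \<in> laurents False (pbox b c (p, q) - {(- p, - q)}) u v"
    by (rule laurents_monomial1) (use assms in \<open>auto simp: pbox_nonneg\<close>)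
  then show "1 \<in> laurents False (pbox b c (p, q) - {(- p, - q)}) u v" by simp
qed

lemma oddR_pointed:
  assumes g: "g = 2"
  shows "pointed b c (2 * int k + 1, 4 * int k) u v (x (2 * int k + 3))"
proof (cases k)
  \<comment> \<open>\<open>R 0 = v\<close> has denominator \<open>(0, - 1)\<close>, outside the
    scope of \<open>pointed_mult\<close>, so \<open>x 3\<close> is expanded directly.\<close>
  case 0
  have bc: "b = 1" "c = 4" using type g by auto
  have "x 3 = lsum ((1, - 1, - 0) # [(1, - 1, 4)]) u v"
    using nz by (simp add: x3 bc power_int_minus field_simps)
  moreover have "pointed b c (1, 0) u v (lsum ((1, - 1, - 0) # [(1, - 1, 4)]) u v)"
    by (rule lsum_pointed) (simp add: pbox_def bc)
  ultimately show ?thesis using 0 by simp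
next
  case (Suc l)
  have bc: "b = 1" "c = 4" using type g by auto
  have "pointed b c (1 + int l + (1 + int (Suc l)), int g - 1 + int g * int l + (int g - 1 + int g * int (Suc l)))
      u v (R (Suc l) * R (Suc (Suc l)))"
    using g by (intro pointed_mult nz R_pointed) auto
  then have "pointed b c (2 * int k + 1, 4 * int k) u v (R k * R (Suc k))"
    using g Suc by (simp add: algebra_simps)
  then have "pointed b c (2 * int k + 1, 4 * int k) u v (R k * R (Suc k) - 1)"
    by (intro pointed_minus_one) (use Suc bc in auto)
  moreover have "x (2 * int k + 3) = R k * R (Suc k) - 1"
  proof -
    have "R k = x (2 * int k + 3 - 1)" "R (Suc k) = x (2 * int k + 3 + 1)"
      unfolding R_def by (auto intro!: arg_cong[of _ _ x] simp: g)
    then show ?thesis using odd_var[OF g, of "2 * int k + 3"] by simp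
  qed
  ultimately show ?thesis by simp
qed

lemma oddL_pointed:
  assumes g: "g = 2"
  shows "pointed b c (2 * int k + 1, 4 * int k + 4) u v (x (- 2 * int k - 1))"
proof -
  have bc: "b = 1" "c = 4" using type g by auto
  have "pointed b c (int k + int (Suc k), 1 + int g * int k + (1 + int g * int (Suc k)))
      u v (L (Suc k) * L (Suc (Suc k)))"
    by (intro pointed_mult nz L_pointed) auto
  then have "pointed b c (2 * int k + 1, 4 * int k + 4) u v (L (Suc k) * L (Suc (Suc k)))"
    using g by (simp add: algebra_simps)
  then have "pointed b c (2 * int k + 1, 4 * int k + 4) u v (L (Suc k) * L (Suc (Suc k)) - 1)"
    by (intro pointed_minus_one) (use bc in auto)
  moreover have "x (- 2 * int k - 1) = L (Suc k) * L (Suc (Suc k)) - 1"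
  proof -
    have "L (Suc k) = x (- 2 * int k - 1 + 1)" "L (Suc (Suc k)) = x (- 2 * int k - 1 - 1)"
      unfolding L_def by (auto intro!: arg_cong[of _ _ x] simp: g)
    then show ?thesis using odd_var[OF g, of "- 2 * int k - 1"] by (simp add: mult.commute)
  qed
  ultimately show ?thesis by simp
qed

lemma pointed_cluster_monomial:
  assumes "pointed b c (p, q) u v (x m)" "pointed b c (p', q') u v (x (m + 1))"
    "0 \<le> p" "0 \<le> q" "0 \<le> p'" "0 \<le> q'" "0 \<le> r" "0 \<le> t"
    "P = r * p + t * p'" "Q = r * q + t * q'"
  shows "\<exists>y\<in>cluster_monomials x. pointed b c (P, Q) u v y"
proof -
  have "pointed b c (int (nat r) * p + int (nat t) * p', int (nat r) * q + int (nat t) * q') u v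
      (x m ^ nat r * x (m + 1) ^ nat t)"
    using assms(3-8) by (intro pointed_mult pointed_power nz assms(1,2) mult_nonneg_nonneg) simp_all
  then show ?thesis using assms(7-10) cluster_monomialsI[of x m "nat r" "nat t"] by auto
qed

text \<open>The form \<open>g * p - q\<close> is 1 on the denominators of \<open>R\<close>, so
  division of \<open>p\<close> by \<open>d\<close> finds the cone: \<open>(p, q)\<close> is
  \<open>d - t\<close> times the denominator of \<open>R k\<close> plus \<open>t\<close> times that
  of \<open>R (Suc k)\<close>. For \<open>g = 2\<close> the odd variable between them has the sum of
  both denominators and splits the cone in two.\<close>

lemma pointed_right:
  assumes "0 < p" "0 < q" "q < int g * p"
  shows "\<exists>y\<in>cluster_monomials x. pointed b c (p, q) u v y"
proof -
  define d where "d = int g * p - q"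
  define t where "t = p mod d"
  define k where "k = nat (p div d)"
  have d: "0 < d" using assms by (simp add: d_def)
  have t: "0 \<le> t" "t < d" using d by (simp_all add: t_def)
  have p: "p = int k * d + t"
    using d assms by (simp add: k_def t_def pos_imp_zdiv_nonneg_iff)
  have q: "q = int g * int k * d + int g * t - d" using p d_def by algebra
  show ?thesis
  proof (cases "g = 1")
    case True
    \<comment> \<open>The cone next to \<open>R 0 = v\<close> is ruled out by \<open>q > 0\<close>;
      \<open>R_pointed\<close> starts at index 1.\<close>
    have "k \<noteq> 0"
    proof
      assume "k = 0"
      then have "q = t - d" using q True by simp
      then show False using t assms by simp
    qed
    then obtain l where l: "k = Suc l" using not0_implies_Suc by blast
    show ?thesis
    proof (rule pointed_cluster_monomial[where m = "2 + int k" and r = "d - t" and t = t])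
      show "pointed b c (int k, int k - 1) u v (x (2 + int k))"
      proof -
        have e: "R (Suc l) = x (2 + int k)" unfolding R_def by (rule arg_cong[of _ _ x]) (simp add: True l)
        show ?thesis using R_pointed[of l] unfolding e by (simp add: True l algebra_simps)
      qed
      show "pointed b c (int k + 1, int k) u v (x (2 + int k + 1))"
      proof -
        have e: "R (Suc k) = x (2 + int k + 1)" unfolding R_def by (rule arg_cong[of _ _ x]) (simp add: True)
        show ?thesis using R_pointed[of k] unfolding e by (simp add: True algebra_simps)
      qed
    qed (use t l p q True in \<open>auto simp: algebra_simps\<close>)
  next
    case False
    then have g: "g = 2" using type by auto
    note o = oddR_pointed[OF g, of k]
    have e: "pointed b c (int k + 1, 2 * int k + 1) u v (x (2 * int k + 3 + 1))"
    proof -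
      have e: "R (Suc k) = x (2 * int k + 3 + 1)" unfolding R_def by (rule arg_cong[of _ _ x]) (simp add: g)
      show ?thesis using R_pointed[of k] unfolding e by (simp add: g algebra_simps)
    qed
    show ?thesis
    proof (cases "t \<le> d - t")
      case True
      have "k \<noteq> 0"
      proof
        assume "k = 0"
        then have "q = 2 * t - d" using q g by simp
        then show False using True assms by simp
      qed
      then obtain l where l: "k = Suc l" using not0_implies_Suc by blast
      show ?thesis
      proof (rule pointed_cluster_monomial[where m = "2 * int k + 2" and r = "d - 2 * t" and t = t])
        show "pointed b c (int k, 2 * int k - 1) u v (x (2 * int k + 2))"
        proof -
          have e: "R (Suc l) = x (2 * int k + 2)" unfolding R_def by (rule arg_cong[of _ _ x]) (simp add: g l)
          show ?thesis using R_pointed[of l] unfolding e by (simp add: g l algebra_simps)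
        qed
        have "2 * int k + 2 + 1 = 2 * int k + 3" by simp
        then show "pointed b c (2 * int k + 1, 4 * int k) u v (x (2 * int k + 2 + 1))"
          using o by metis
      qed (use t l p q g True in \<open>auto simp: algebra_simps\<close>)
    next
      case False
      show ?thesis
        by (rule pointed_cluster_monomial[OF o e, where r = "d - t" and t = "2 * t - d"])
          (use t p q g False in \<open>auto simp: algebra_simps\<close>)
    qed
  qed
qed

text \<open>The same division with the line \<open>q = g * p + 1\<close>; \<open>k = 0\<close> is
  allowed, because \<open>L_pointed\<close> covers \<open>L (Suc 0)\<close>.\<close>

lemma pointed_left:
  assumes "0 < p" "int g * p < q"
  shows "\<exists>y\<in>cluster_monomials x. pointed b c (p, q) u v y"
proof -
  define d where "d = q - int g * p"
  define t where "t = p mod d"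
  define k where "k = nat (p div d)"
  have d: "0 < d" using assms by (simp add: d_def)
  have t: "0 \<le> t" "t < d" using d by (simp_all add: t_def)
  have p: "p = int k * d + t"
    using d assms by (simp add: k_def t_def pos_imp_zdiv_nonneg_iff)
  have q: "q = int g * int k * d + int g * t + d" using p d_def by algebra
  show ?thesis
  proof (cases "g = 1")
    case True
    show ?thesis
    proof (rule pointed_cluster_monomial[where m = "- int k - 1" and r = t and t = "d - t"])
      show "pointed b c (int k + 1, int k + 2) u v (x (- int k - 1))"
      proof -
        have e: "L (Suc (Suc k)) = x (- int k - 1)" unfolding L_def by (rule arg_cong[of _ _ x]) (simp add: True)
        show ?thesis using L_pointed[of "Suc k"] unfolding e by (simp add: True algebra_simps)
      qed
      show "pointed b c (int k, int k + 1) u v (x (- int k - 1 + 1))"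
      proof -
        have e: "L (Suc k) = x (- int k - 1 + 1)" unfolding L_def by (rule arg_cong[of _ _ x]) (simp add: True)
        show ?thesis using L_pointed[of k] unfolding e by (simp add: True algebra_simps)
      qed
    qed (use t p q True in \<open>auto simp: algebra_simps\<close>)
  next
    case False
    then have g: "g = 2" using type by auto
    note o = oddL_pointed[OF g, of k]
    show ?thesis
    proof (cases "t \<le> d - t")
      case True
      have e: "pointed b c (int k, 2 * int k + 1) u v (x (- 2 * int k - 1 + 1))"
      proof -
        have e: "L (Suc k) = x (- 2 * int k - 1 + 1)" unfolding L_def by (rule arg_cong[of _ _ x]) (simp add: g)
        show ?thesis using L_pointed[of k] unfolding e by (simp add: g algebra_simps)
      qed
      show ?thesis
        by (rule pointed_cluster_monomial[OF o e, where r = t and t = "d - 2 * t"])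
          (use t p q g True in \<open>auto simp: algebra_simps\<close>)
    next
      case False
      show ?thesis
      proof (rule pointed_cluster_monomial[where m = "- 2 * int k - 2" and r = "2 * t - d" and t = "d - t"])
        show "pointed b c (int k + 1, 2 * int k + 3) u v (x (- 2 * int k - 2))"
        proof -
          have e: "L (Suc (Suc k)) = x (- 2 * int k - 2)" unfolding L_def by (rule arg_cong[of _ _ x]) (simp add: g)
          show ?thesis using L_pointed[of "Suc k"] unfolding e by (simp add: g algebra_simps)
        qed
        have "- 2 * int k - 2 + 1 = - 2 * int k - 1" by simp
        then show "pointed b c (2 * int k + 1, 4 * int k + 4) u v (x (- 2 * int k - 2 + 1))"
          using o by metis
      qed (use t p q g False in \<open>auto simp: algebra_simps\<close>)
    qed
  qed
qed

lemma canonical_basis_eq: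
  "canonical_basis b c x = cluster_monomials x \<union> {cheb z n | n. 1 \<le> n}"
proof -
  have "b * c = 4" using type by auto
  moreover have "affine_elt b c x z' \<longleftrightarrow> z' = z" for z'
    using affine_elt_unique[OF rs z_elt] z_elt by blast
  ultimately show ?thesis unfolding canonical_basis_def by simp
qed

text \<open>The cones of the clusters leave out only the ray \<open>q = g * p\<close>,
  \<open>p > 0\<close>, which the elements \<open>cheb z n\<close> cover.\<close>

lemma canonical_basis_pointed: "\<exists>y\<in>canonical_basis b c x. pointed b c (p, q) u v y"
proof -
  have sub: "\<exists>y\<in>cluster_monomials x. Q y \<Longrightarrow> \<exists>y\<in>canonical_basis b c x. Q y" for Q
    unfolding canonical_basis_eq by blast
  consider "p \<le> 0 \<or> q \<le> 0" | "0 < p" "0 < q" "q < int g * p" | "0 < p" "int g * p < q"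
    | "0 < p" "q = int g * p" by linarith
  then show ?thesis
  proof cases
    case 1
    show ?thesis by (rule sub[OF cluster_good_pointed_boundary[OF rs 1]])
  next
    case 2
    show ?thesis by (rule sub[OF pointed_right[OF 2]])
  next
    case 3
    show ?thesis by (rule sub[OF pointed_left[OF 3]])
  next
    case 4
    define k where "k = nat (p - 1)"
    have "p = 1 + int k" using 4 by (simp add: k_def)
    then have "pointed b c (p, q) u v (cheb z (Suc k))"
      using cheb_pointed[of k] 4 by (simp add: algebra_simps)
    moreover have "cheb z (Suc k) \<in> canonical_basis b c x"
      unfolding canonical_basis_eq by (auto simp del: cheb.simps)
    ultimately show ?thesis by (rule bexI)
  qed
qed

end

section \<open>Proper expansions in affine type\<close>

text \<open>
  The tropical sequence with value \<open>- 1\<close> at \<open>k\<close> and \<open>k + 1\<close>, indexed by the distance to \<open>k\<close>.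
\<close>

definition trop :: "nat \<Rightarrow> nat \<Rightarrow> int \<Rightarrow> nat \<Rightarrow> int" where
  "trop b c k n = (if even n then int (n div 2) * (int (exch_exp b c (k - 1)) + 2) - 1
     else 1 + int (n div 2) * (int (exch_exp b c k) + 2))"

lemma trop_pos: "0 < n \<Longrightarrow> 1 \<le> trop b c k n"
proof (cases "even n")
  case True
  assume "0 < n"
  then have "1 \<le> int (n div 2)" using True by auto
  then have "1 * 2 \<le> int (n div 2) * (int (exch_exp b c (k - 1)) + 2)" by (intro mult_mono) auto
  then show ?thesis using True by (simp add: trop_def)
qed (simp add: trop_def)

text \<open>Values at positive distance are positive, so the maximum in the tropical relation
  disappears and a linear recurrence remains; for \<open>b * c = 4\<close> its solutions grow
  linearly over steps of two.\<close>

lemma trop_rec: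
  assumes "b * c = 4"
  shows "trop b c k (Suc (Suc n)) = int (exch_exp b c (k - int (Suc n))) * trop b c k (Suc n) - trop b c k n"
proof -
  have "int (b * c) = 4" using assms by simp
  then have bc: "int b * int c = 4" by simp
  define p q where "p = int (exch_exp b c (k - 1))" "q = int (exch_exp b c k)"
  have pq: "p * q = 4" "q * p = 4" using bc by (auto simp: p_q_def exch_exp_def mult.commute)
  have 1: "p * (L * (q + 2)) = L * 4 + 2 * L * p" for L
    using arg_cong[OF pq(1), of "\<lambda>r. L * r"] by (simp add: algebra_simps)
  have 2: "q * (L * (p + 2)) = L * 4 + 2 * L * q" for L
    using arg_cong[OF pq(2), of "\<lambda>r. L * r"] by (simp add: algebra_simps)
  show ?thesis
  proof (cases "even n")
    case True
    then obtain l where n: "n = 2 * l" by blast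
    have "exch_exp b c (k - int (Suc n)) = exch_exp b c (k - 1)" by (simp add: exch_exp_def n)
    then show ?thesis unfolding trop_def using 1[of "int l"]
      by (simp add: n algebra_simps flip: p_q_def)
  next
    case False
    then obtain l where n: "n = 2 * l + 1" by (rule oddE)
    have "exch_exp b c (k - int (Suc n)) = exch_exp b c k" by (simp add: exch_exp_def n)
    then show ?thesis unfolding trop_def using 2[of "int l"] pq
      by (simp add: n algebra_simps flip: p_q_def)
  qed
qed

text \<open>The weights are the values of \<open>trop\<close> at the positions 1 and 2. With them
  the degrees of \<open>x 1\<close>, \<open>x 2\<close> and so on run through the sequence and
  arrive at -1 for \<open>x k\<close> and \<open>x (k + 1)\<close>.\<close>

lemma trop_bound:
  assumes rs: "rank2_seq b c x" and bc: "b * c = 4" and k: "3 \<le> k"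
    and pos: "\<And>m. x m \<in> laurents True UNIV (x 1) (x 2)"
  defines "l \<equiv> trop b c k (nat (k - 1))" and "l' \<equiv> trop b c k (nat (k - 2))"
  shows "x k \<in> laurents True (halfplane l l' (- 1)) (x 1) (x 2)"
    "x (k + 1) \<in> laurents True (halfplane l l' (- 1)) (x 1) (x 2)"
proof -
  note nz = rank2_seq_nonzero[OF rs]
  note ind = rank2_seq_indep12[OF rs]
  have "\<forall>m. \<exists>f. laurent_eval f (x 1) (x 2) = x m \<and> nonneg_coeffs f"
  proof
    show "\<exists>f. laurent_eval f (x 1) (x 2) = x m \<and> nonneg_coeffs f" for m
      using pos[of m] unfolding laurents_def by auto
  qed
  then obtain F where F: "\<And>m. laurent_eval (F m) (x 1) (x 2) = x m" "\<And>m. nonneg_coeffs (F m)"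
    by metis
  have ex: "F (m - 1) * F (m + 1) = F m ^ exch_exp b c m + 1" for m
    by (rule laurent_indepD[OF ind])
      (simp add: laurent_eval_mult laurent_eval_add laurent_eval_power nz F rank2_seq_exchange[OF rs])
  have step: "wmax l l' (F (m - 1)) s \<Longrightarrow> wmax l l' (F m) t \<Longrightarrow>
      wmax l l' (F (m + 1)) (max (int (exch_exp b c m) * t) 0 - s)" for m s t
    by (rule wmax_exchange[OF F(2) F(2) F(2) ex])
  have F1: "F 1 = frag_of (1, 0)" "F 2 = frag_of (0, 1)"
    by (rule laurent_indepD[OF ind], simp add: F laurent_eval_single)+
  have main: "wmax l l' (F (1 + int j)) (trop b c k (nat (k - 1) - j)) \<and>
      wmax l l' (F (2 + int j)) (trop b c k (nat (k - 2) - j))" if "int j \<le> k - 2" for j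
    using that
  proof (induction j)
    case 0
    show ?case by (simp add: F1 wmax_def l_def l'_def)
  next
    case (Suc j)
    define n where "n = nat (k - 3) - j"
    have n: "nat (k - 1) - j = Suc (Suc n)" "nat (k - 2) - j = Suc n" "nat (k - 1) - Suc j = Suc n"
      "nat (k - 2) - Suc j = n" "k - int (Suc n) = 2 + int j"
      using Suc.prems by (auto simp: n_def)
    have IH: "wmax l l' (F (2 + int j - 1)) (trop b c k (Suc (Suc n)))" "wmax l l' (F (2 + int j)) (trop b c k (Suc n))"
      using Suc by (simp_all add: n)
    have "0 \<le> int (exch_exp b c (2 + int j)) * trop b c k (Suc n)"
      using trop_pos[of "Suc n" b c k] by simp
    then have "wmax l l' (F (2 + int j + 1)) (int (exch_exp b c (2 + int j)) * trop b c k (Suc n) - trop b c k (Suc (Suc n)))"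
      using step[OF IH] by simp
    also have "int (exch_exp b c (2 + int j)) * trop b c k (Suc n) - trop b c k (Suc (Suc n)) = trop b c k n"
      unfolding trop_rec[OF bc, of k n] n(5) by simp
    finally show ?case using IH(2) by (simp add: n add.commute)
  qed
  have t01: "trop b c k 0 = - 1" "trop b c k (Suc 0) = 1" by (simp_all add: trop_def)
  have "nat (k - 1) - nat (k - 2) = Suc 0" using k by simp
  then have w: "wmax l l' (F (k - 1)) 1" "wmax l l' (F k) (- 1)"
    using main[of "nat (k - 2)"] k t01 by simp_all
  \<comment> \<open>Only this last step starts from a negative degree: the maximum becomes 0, which
    leaves -1 at \<open>k + 1\<close>.\<close>
  have w': "wmax l l' (F (k + 1)) (- 1)"
    using step[OF w] by simp
  have "x m \<in> laurents True (halfplane l l' (- 1)) (x 1) (x 2)" if "wmax l l' (F m) (- 1)" for m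
    using F[of m] that unfolding laurents_def wmax_def by (intro CollectI exI[of _ "F m"]) auto
  then show "x k \<in> laurents True (halfplane l l' (- 1)) (x 1) (x 2)"
    "x (k + 1) \<in> laurents True (halfplane l l' (- 1)) (x 1) (x 2)"
    using w w' by blast+
qed

lemma proper_at_right:
  assumes rs: "rank2_seq b c x" and bc: "b * c = 4" and k: "2 \<le> k"
    and pos: "\<And>m. x m \<in> laurents True UNIV (x 1) (x 2)"
  shows "proper_at (x 1) (x 2) (x k ^ r * x (k + 1) ^ s)"
proof (cases "k = 2")
  case True
  then show ?thesis using proper_at_adjacent[OF rs] by simp
next
  case False
  then have k: "3 \<le> k" using k by simp
  have "0 \<le> trop b c k (nat (k - 1))" "0 \<le> trop b c k (nat (k - 2))"
    using trop_pos[of "nat (k - 1)" b c k] trop_pos[of "nat (k - 2)" b c k] k by auto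
  then show ?thesis
    by (rule proper_at_cluster_monomial[OF rank2_seq_indep12[OF rs]])
      (use laurents_mono[OF trop_bound(1)[OF rs bc k pos]] laurents_mono[OF trop_bound(2)[OF rs bc k pos]] in auto)
qed

context affine_cluster
begin

lemma bc4: "b * c = 4" using type by auto

lemma cluster_monomial_proper: "proper_at u v (x k ^ r * x (k + 1) ^ t)"
proof -
  consider "2 \<le> k" | "k = 1" | "k \<le> 0" by linarith
  then show ?thesis
  proof cases
    case 1
    then show ?thesis by (rule proper_at_right[OF rs bc4 _ var_pos])
  next
    case 2
    then show ?thesis using proper_at_monomial[OF ind] by simp
  next
    case 3
    have "proper_at (x (3 - 1)) (x (3 - 2)) (x (3 - (2 - k)) ^ t * x (3 - (2 - k + 1)) ^ r)"
    proof (rule proper_at_right[OF rank2_seq_reflect[OF rs]])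
      show "c * b = 4" using bc4 by (simp add: mult.commute)
      show "2 \<le> 2 - k" using 3 by simp
      show "x (3 - m) \<in> laurents True UNIV (x (3 - 1)) (x (3 - 2))" for m
        using laurents_mono[OF laurents_swap[OF var_pos], of UNIV True "3 - m"] by simp
    qed
    from proper_at_swap[OF this] show ?thesis by (simp add: algebra_simps)
  qed
qed

lemma cluster_good: "cluster_good b c x"
proof -
  have "y \<in> laurents True UNIV u v \<and> proper_at u v y" if "y \<in> canonical_basis b c x" for y
    using that unfolding canonical_basis_eq
  proof
    assume "y \<in> cluster_monomials x"
    then obtain k r t where y: "y = x k ^ r * x (k + 1) ^ t" unfolding cluster_monomials_def by blast
    show ?thesis unfolding y
      by (intro conjI cluster_monomial_proper laurents_UNIV_mult laurents_power_UNIV var_pos nz)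
  next
    assume "y \<in> {cheb z n |n. 1 \<le> n}"
    then show ?thesis using cheb_pos cheb_proper by blast
  qed
  then show ?thesis
    unfolding cluster_good_def using canonical_basis_pointed by blast
qed

text \<open>Says that \<open>a' = u / v ^ g\<close> has positive degree for the weights attached to
  \<open>k\<close>.\<close>

lemma trop_slope:
  assumes k: "3 \<le> k"
  shows "int g * trop b c k (nat (k - 2)) < trop b c k (nat (k - 1))"
proof -
  define n where "n = nat (k - 3)"
  have n: "nat (k - 2) = Suc n" "nat (k - 1) = Suc (Suc n)" "k = int n + 3"
    using k by (auto simp: n_def)
  show ?thesis
  proof (cases "even n")
    case True
    then obtain l where l: "n = 2 * l" by blast
    show ?thesis unfolding trop_def n(1,2) using type
      by (auto simp: l n(3) exch_exp_def algebra_simps)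
  next
    case False
    then obtain l where l: "n = 2 * l + 1" by (rule oddE)
    show ?thesis unfolding trop_def n(1,2) using type
      by (auto simp: l n(3) exch_exp_def algebra_simps)
  qed
qed

text \<open>For the weights attached to \<open>k\<close> the product has degree at most 0, whereas
  \<open>a' ^ n\<close> has positive degree and so cannot occur.\<close>

lemma cluster_monomial_lookup:
  assumes k: "3 \<le> k" and f: "laurent_eval f u v = x k ^ r * x (k + 1) ^ t" and n: "1 \<le> n"
  shows "Poly_Mapping.lookup f (int n, - int g * int n) = 0"
proof (rule ccontr)
  define l l' where "l = trop b c k (nat (k - 1))" "l' = trop b c k (nat (k - 2))"
  have "x k ^ r * x (k + 1) ^ t \<in> laurents True (halfplane l l' (int r * - 1 + int t * - 1)) u v"
    unfolding l_l'_def by (intro halfplane_mult halfplane_power nz trop_bound[OF rs bc4 k var_pos])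
  then have "Poly_Mapping.keys f \<subseteq> halfplane l l' (int r * - 1 + int t * - 1)"
    unfolding f[symmetric] by (rule laurents_lookup(1)[OF ind])
  moreover assume "Poly_Mapping.lookup f (int n, - int g * int n) \<noteq> 0"
  ultimately have "l * int n + l' * (- int g * int n) \<le> int r * - 1 + int t * - 1"
    by (auto simp: in_keys_iff)
  then have "(l - int g * l') * int n \<le> 0" by (simp add: algebra_simps)
  moreover have "0 < (l - int g * l') * int n"
    using trop_slope[OF k] n unfolding l_l'_def by (intro mult_pos_pos) auto
  ultimately show False by simp
qed

end

section \<open>All types together, and coordinates as coefficients\<close>

lemma affine_clusterI:
  assumes "rank2_seq b c x" "b * c = 4" "b \<le> c" "affine_elt b c x z"
  shows "\<exists>g. affine_cluster b c g x z"
  using product_four[OF assms(2)] assms(1,3,4) unfolding affine_cluster_def by auto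

lemma cluster_good_le:
  assumes rs: "rank2_seq b c x" and bc: "b * c \<le> 4" and le: "b \<le> c"
  shows "cluster_good b c x"
proof (cases "b * c = 4")
  case True
  obtain z where "affine_elt b c x z" using affine_elt_exists[OF rs True] by blast
  then show ?thesis using affine_clusterI[OF rs True le] affine_cluster.cluster_good by blast
next
  case False
  have b: "b > 0" "c > 0" using rank2_seq_pos[OF rs] by auto
  have "b = 1"
  proof (rule ccontr)
    assume "b \<noteq> 1"
    then have "2 * 2 \<le> b * c" using b le by (intro mult_mono) auto
    then show False using bc False by simp
  qed
  then have "c = 1 \<or> c = 2 \<or> c = 3" using bc b False by auto
  then show ?thesis using cluster_good_A2 cluster_good_B2 cluster_good_G2 rs \<open>b = 1\<close> by blast
qed

lemma cluster_good_rank2: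
  assumes rs: "rank2_seq b c x" and bc: "b * c \<le> 4"
  shows "cluster_good b c x"
proof (cases "b \<le> c")
  case False
  have "cluster_good c b (\<lambda>m. x (3 - m))"
    by (rule cluster_good_le[OF rank2_seq_reflect[OF rs]]) (use bc False in \<open>simp_all add: mult.commute\<close>)
  then show ?thesis by (rule cluster_good_reflect)
qed (rule cluster_good_le[OF rs bc])

text \<open>The cluster at \<open>m\<close> is the initial one of the sequence shifted by
  \<open>m - 1\<close>, and that sequence has the same canonical basis.\<close>

lemma canonical_basis_cluster:
  assumes rs: "rank2_seq b c x" and bc: "b * c \<le> 4" and y: "y \<in> canonical_basis b c x"
  shows "y \<in> laurents True UNIV (x m) (x (m + 1))" "proper_at (x m) (x (m + 1)) y"
proof -
  let ?b = "exch_exp b c (m - 1 + 1)" and ?c = "exch_exp b c (m - 1)"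
  have "?b * ?c \<le> 4" using bc by (auto simp: exch_exp_def mult.commute)
  then have "cluster_good ?b ?c (\<lambda>k. x (k + (m - 1)))"
    by (rule cluster_good_rank2[OF rank2_seq_shift[OF rs]])
  then show "y \<in> laurents True UNIV (x m) (x (m + 1))" "proper_at (x m) (x (m + 1)) y"
    using y unfolding cluster_good_def canonical_basis_shift by (simp_all add: add.commute)
qed

text \<open>The cluster lies to the left of all clusters occurring in \<open>S\<close>, so only
  elements \<open>cheb z l\<close> can contribute to the coefficient of
  \<open>a' ^ n\<close>.\<close>

lemma canonical_basis_dual_affine:
  assumes rs: "rank2_seq b c x" and bc: "b * c = 4" and z: "affine_elt b c x z"
    and S: "finite S" "S \<subseteq> canonical_basis b c x" and n: "1 \<le> n"
  shows "\<exists>m k. \<forall>y\<in>S. \<forall>f. laurent_eval f (x m) (x (m + 1)) = y \<longrightarrow>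
           Poly_Mapping.lookup f k = (if y = cheb z n then 1 else 0)"
proof -
  have "\<forall>y\<in>S \<inter> cluster_monomials x. \<exists>k. \<exists>r s. y = x k ^ r * x (k + 1) ^ s"
    unfolding cluster_monomials_def by blast
  then obtain \<kappa> where \<kappa>: "\<forall>y\<in>S \<inter> cluster_monomials x. \<exists>r s. y = x (\<kappa> y) ^ r * x (\<kappa> y + 1) ^ s"
    by metis
  have fin: "finite (insert 0 (\<kappa> ` S))" using S(1) by simp
  define M where "M = Min (insert 0 (\<kappa> ` S))"
  have M: "M \<le> \<kappa> y" if "y \<in> S" for y using fin that unfolding M_def by (intro Min_le) auto
  \<comment> \<open>The parity of \<open>s\<close> puts the smaller exponent first, as
    \<open>affine_cluster\<close> demands, and \<open>s + 3 \<le> M\<close> gives all clusters of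
    \<open>S\<close> a shifted index of at least 3.\<close>
  define s where "s = (if b \<le> c then 2 * (M div 2) - 4 else 2 * (M div 2) - 3)"
  have "2 * (M div 2) \<le> M" by presburger
  then have s: "s + 3 \<le> M" by (simp add: s_def)
  let ?b = "exch_exp b c (s + 1)" and ?c = "exch_exp b c s"
  have bc': "?b * ?c = 4" "?b \<le> ?c" using bc by (auto simp: exch_exp_def s_def mult.commute)
  obtain g where "affine_cluster ?b ?c g (\<lambda>m. x (m + s)) z"
    using affine_clusterI[OF rank2_seq_shift[OF rs] bc'] z affine_elt_shift by blast
  then interpret A: affine_cluster ?b ?c g "\<lambda>m. x (m + s)" z .
  have "Poly_Mapping.lookup f (int n, - int g * int n) = (if y = cheb z n then 1 else 0)"
    if "y \<in> S" and f: "laurent_eval f (x (1 + s)) (x (2 + s)) = y" for y f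
  proof (cases "y = cheb z n")
    case True
    then show ?thesis using A.cheb_lookup(2)[of f n n] f n by simp
  next
    case False
    have "y \<in> cluster_monomials (\<lambda>m. x (m + s)) \<union> {cheb z n |n. 1 \<le> n}"
      using S(2) that(1) A.canonical_basis_eq canonical_basis_shift[of b c s x] by blast
    then consider "y \<in> cluster_monomials x" | l where "1 \<le> l" "y = cheb z l"
      unfolding cluster_monomials_shift by blast
    then show ?thesis
    proof cases
      case 1
      with that(1) have "y \<in> S \<inter> cluster_monomials x" by blast
      then obtain r t where y: "y = x (\<kappa> y) ^ r * x (\<kappa> y + 1) ^ t" using bspec[OF \<kappa>] by blast
      have "3 \<le> \<kappa> y - s" using M[OF that(1)] s by simp
      moreover have "laurent_eval f (x (1 + s)) (x (2 + s)) =
          x (\<kappa> y - s + s) ^ r * x (\<kappa> y - s + 1 + s) ^ t"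
        using f y by simp
      ultimately show ?thesis using A.cluster_monomial_lookup n False by simp
    next
      case 2
      then show ?thesis using A.cheb_lookup(2)[of f l n] f n False by auto
    qed
  qed
  then show ?thesis
    by (intro exI[of _ "1 + s"] exI[of _ "(int n, - int g * int n)"]) (simp add: add.commute add.left_commute)
qed

lemma canonical_basis_dual:
  assumes rs: "rank2_seq b c x" and bc: "b * c \<le> 4"
    and S: "finite S" "S \<subseteq> canonical_basis b c x" and y: "y \<in> canonical_basis b c x"
  shows "\<exists>m k. \<forall>y'\<in>S. \<forall>f. laurent_eval f (x m) (x (m + 1)) = y' \<longrightarrow>
           Poly_Mapping.lookup f k = (if y' = y then 1 else 0)"
  using y unfolding canonical_basis_def
proof
  assume "y \<in> cluster_monomials x"
  then obtain m r t where yy: "y = x m ^ r * x (m + 1) ^ t" unfolding cluster_monomials_def by blast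
  have "Poly_Mapping.lookup f (int r, int t) = (if y' = y then 1 else 0)"
    if y': "y' \<in> S" and f: "laurent_eval f (x m) (x (m + 1)) = y'" for y' f
  proof (cases "y' = y")
    case True
    have "laurent_eval f (x m) (x (m + 1)) = laurent_eval (frag_of (int r, int t)) (x m) (x (m + 1))"
      using f True yy by (simp add: laurent_eval_single)
    then have "f = frag_of (int r, int t)" by (rule laurent_indepD[OF rank2_seq_indep[OF rs]])
    then show ?thesis using True by simp
  next
    case False
    have "proper_at (x m) (x (m + 1)) y'"
      using canonical_basis_cluster(2)[OF rs bc] S(2) y' by blast
    then have "(int r, int t) \<in> Poly_Mapping.keys f \<Longrightarrow> y' = y"
      using f yy unfolding proper_at_def by fastforce
    then show ?thesis using False by (auto simp: in_keys_iff)
  qed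
  then show ?thesis by blast
next
  assume "y \<in> {cheb z n |z n. b * c = 4 \<and> 1 \<le> n \<and> affine_elt b c x z}"
  then obtain z n where "y = cheb z n" "b * c = 4" "1 \<le> n" "affine_elt b c x z" by blast
  then show ?thesis using canonical_basis_dual_affine[OF rs _ _ S] by simp
qed

section \<open>The basis of the cluster algebra\<close>

lemma
  fixes S :: "'a::comm_ring_1 set"
  shows subring_generated_zero: "0 \<in> subring_generated S"
    and subring_generated_add: "p \<in> subring_generated S \<Longrightarrow> q \<in> subring_generated S \<Longrightarrow> p + q \<in> subring_generated S"
    and subring_generated_power: "p \<in> subring_generated S \<Longrightarrow> p ^ n \<in> subring_generated S"
    and subring_generated_of_int: "of_int k \<in> subring_generated S"
proof -
  show z: "0 \<in> subring_generated S"
    using subring_generated.diff[OF subring_generated.one subring_generated.one, of S] by simp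
  have m: "- p \<in> subring_generated S" if "p \<in> subring_generated S" for p
    using subring_generated.diff[OF z that] by simp
  show a: "p + q \<in> subring_generated S" if "p \<in> subring_generated S" "q \<in> subring_generated S" for p q
    using subring_generated.diff[OF that(1) m[OF that(2)]] by simp
  show "p ^ n \<in> subring_generated S" if "p \<in> subring_generated S"
    by (induction n) (auto intro: subring_generated.one subring_generated.mult that)
  have n: "of_nat n \<in> subring_generated S" for n
    by (induction n) (auto intro: z a subring_generated.one)
  show "of_int k \<in> subring_generated S"
    using n[of "nat k"] m[OF n[of "nat (- k)"]] by (cases "0 \<le> k") simp_all
qed

lemma (in affine_cluster) z_in_subring: "z \<in> subring_generated (range x)"
proof -
  have g: "x m \<in> subring_generated (range x)" for m by (rule subring_generated.generator) simp
  \<comment> \<open>The products \<open>x 0 * x 3\<close> and \<open>x 0 ^ 2 * x 3\<close> exceed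
    \<open>z\<close> by a polynomial in \<open>u\<close> and \<open>v\<close>.\<close>
  have "z = (if g = 1 then x 0 * x 3 - u * v else x 0 ^ 2 * x 3 - (u + of_int 2) * v ^ 2)"
    unfolding z_eq a_def a'_def s_def x0 x3 using type nz by (auto simp: field_simps eval_nat_numeral)
  also have "\<dots> \<in> subring_generated (range x)"
    by (auto intro!: subring_generated.diff subring_generated.mult subring_generated_power
        subring_generated_add subring_generated_of_int g simp del: of_int_numeral)
  finally show ?thesis .
qed

lemma canonical_basis_in_subring:
  assumes rs: "rank2_seq b c x" and bc: "b * c \<le> 4" and y: "y \<in> canonical_basis b c x"
  shows "y \<in> subring_generated (range x)"
  using y unfolding canonical_basis_def
proof
  assume "y \<in> cluster_monomials x"
  then obtain k p q where y: "y = x k ^ p * x (k + 1) ^ q" unfolding cluster_monomials_def by blast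
  have g: "x m \<in> subring_generated (range x)" for m by (rule subring_generated.generator) simp
  show ?thesis unfolding y by (intro subring_generated.mult subring_generated_power g)
next
  assume "y \<in> {cheb z n |z n. b * c = 4 \<and> 1 \<le> n \<and> affine_elt b c x z}"
  then obtain z n where yz: "y = cheb z n" "b * c = 4" "affine_elt b c x z" by blast
  define s :: int where "s = (if b \<le> c then 0 else 1)"
  let ?b = "exch_exp b c (s + 1)" and ?c = "exch_exp b c s"
  have bc': "?b * ?c = 4" "?b \<le> ?c" using yz(2) by (auto simp: exch_exp_def s_def mult.commute)
  obtain g where "affine_cluster ?b ?c g (\<lambda>m. x (m + s)) z"
    using affine_clusterI[OF rank2_seq_shift[OF rs] bc'] yz(3) affine_elt_shift by blast
  then have "z \<in> subring_generated (range (\<lambda>m. x (m + s)))"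
    by (rule affine_cluster.z_in_subring)
  moreover have "x m \<in> range (\<lambda>m. x (m + s))" for m
    by (rule range_eqI[of _ _ "m - s"]) simp
  then have "range (\<lambda>m. x (m + s)) = range x" by blast
  ultimately have z: "z \<in> subring_generated (range x)" by simp
  have two: "2 \<in> subring_generated (range x)"
    using subring_generated_of_int[of 2 "range x"] by simp
  have "cheb z n \<in> subring_generated (range x) \<and> cheb z (Suc n) \<in> subring_generated (range x)" for n
    by (induction n) (auto intro: z two subring_generated.diff subring_generated.mult)
  then show ?thesis unfolding yz(1) by blast
qed

text \<open>The Laurent phenomenon, obtained from the expansions already established, since every
  cluster variable is itself a basis element.\<close>

lemma subring_laurents:
  assumes rs: "rank2_seq b c x" and bc: "b * c \<le> 4" and y: "y \<in> subring_generated (range x)"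
  shows "y \<in> laurents False UNIV (x m) (x (m + 1))"
  using y
proof induction
  case (generator y)
  then obtain k where "y = x k" by blast
  then have "y \<in> canonical_basis b c x"
    using cluster_monomialsI[of x k 1 0] unfolding canonical_basis_def by simp
  from canonical_basis_cluster(1)[OF rs bc this] show ?case by (rule laurents_mono) auto
next
  case one
  show ?case using laurents_monomial1[of 0 0 UNIV "x m" "x (m + 1)" False] by simp
next
  case (diff p q)
  then show ?case by (intro laurents_diff)
next
  case (mult p q)
  then show ?case by (intro laurents_UNIV_mult rank2_seq_nonzero[OF rs])
qed

lemma laurents_of_int_mult:
  assumes "y \<in> laurents P UNIV u v" "P \<Longrightarrow> 0 \<le> n"
  shows "of_int n * y \<in> laurents P UNIV u v"
proof -
  obtain f where f: "y = laurent_eval f u v" "P \<longrightarrow> nonneg_coeffs f"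
    using assms(1) unfolding laurents_def by blast
  have "P \<longrightarrow> nonneg_coeffs (frag_cmul n f)"
    using f(2) assms(2) by (auto simp: nonneg_coeffs_def)
  moreover have "of_int n * y = laurent_eval (frag_cmul n f) u v"
    unfolding f(1) laurent_eval_frag_cmul ..
  ultimately show ?thesis unfolding laurents_def by blast
qed

lemma laurents_sum:
  "(\<And>y. y \<in> S \<Longrightarrow> h y \<in> laurents P T u v) \<Longrightarrow> sum h S \<in> laurents P T u v"
  by (induction S rule: infinite_finite_induct) (auto intro: laurents_zero laurents_add)

text \<open>Serves independence, through the expansion 0 of a vanishing combination, and
  non-negativity of coordinates, through a positive expansion.\<close>

lemma combination_coefficient:
  assumes rs: "rank2_seq b c x" and bc: "b * c \<le> 4"
    and S: "finite S" "S \<subseteq> canonical_basis b c x" and y: "y \<in> S"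
  shows "\<exists>m k. \<forall>f. laurent_eval f (x m) (x (m + 1)) = (\<Sum>y\<in>S. of_int (r y) * y) \<longrightarrow>
           Poly_Mapping.lookup f k = r y"
proof -
  obtain m k where mk: "\<forall>y'\<in>S. \<forall>f. laurent_eval f (x m) (x (m + 1)) = y' \<longrightarrow>
           Poly_Mapping.lookup f k = (if y' = y then 1 else 0)"
    using canonical_basis_dual[OF rs bc S] S(2) y by blast
  have "\<forall>y'\<in>S. \<exists>f. laurent_eval f (x m) (x (m + 1)) = y'"
  proof
    fix y' assume "y' \<in> S"
    then have "y' \<in> laurents True UNIV (x m) (x (m + 1))"
      using canonical_basis_cluster(1)[OF rs bc] S(2) by blast
    then show "\<exists>f. laurent_eval f (x m) (x (m + 1)) = y'" unfolding laurents_def by blast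
  qed
  then obtain F where F: "\<And>y'. y' \<in> S \<Longrightarrow> laurent_eval (F y') (x m) (x (m + 1)) = y'" by metis
  define G where "G = (\<Sum>y'\<in>S. frag_cmul (r y') (F y'))"
  have G: "laurent_eval G (x m) (x (m + 1)) = (\<Sum>y\<in>S. of_int (r y) * y)"
    unfolding G_def laurent_eval_sum laurent_eval_frag_cmul by (intro sum.cong refl) (simp add: F)
  have "Poly_Mapping.lookup G k = (\<Sum>y'\<in>S. if y' = y then r y' else 0)"
    unfolding G_def lookup_sum lookup_frag_cmul using mk F by (intro sum.cong refl) auto
  also have "\<dots> = r y" using S(1) y by simp
  finally have "Poly_Mapping.lookup G k = r y" .
  moreover have "f = G" if "laurent_eval f (x m) (x (m + 1)) = (\<Sum>y\<in>S. of_int (r y) * y)" for f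
    using laurent_indepD[OF rank2_seq_indep[OF rs]] that G by metis
  ultimately show ?thesis by blast
qed

lemma canonical_basis_independent:
  assumes rs: "rank2_seq b c x" and bc: "b * c \<le> 4"
  shows "int_module.independent (canonical_basis b c x)"
  unfolding int_module.independent_explicit_module
proof (intro allI impI)
  fix S and r :: "'a \<Rightarrow> int" and y
  assume S: "finite S" "S \<subseteq> canonical_basis b c x" "(\<Sum>v\<in>S. of_int (r v) * v) = 0" and y: "y \<in> S"
  obtain m k where mk: "\<forall>f. laurent_eval f (x m) (x (m + 1)) = (\<Sum>y\<in>S. of_int (r y) * y) \<longrightarrow>
           Poly_Mapping.lookup f k = r y"
    using combination_coefficient[OF rs bc S(1,2) y] by blast
  show "r y = 0" using mk[rule_format, of 0] S(3) by simp
qed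

lemma canonical_basis_span:
  assumes rs: "rank2_seq b c x" and bc: "b * c \<le> 4"
  shows "int_module.span (canonical_basis b c x) = subring_generated (range x)"
proof
  have "int_module.subspace (subring_generated (range x))"
    unfolding int_module.subspace_def
    by (auto intro: subring_generated_zero subring_generated_add subring_generated.mult subring_generated_of_int)
  then show sub: "int_module.span (canonical_basis b c x) \<subseteq> subring_generated (range x)"
    by (intro int_module.span_minimal subsetI canonical_basis_in_subring[OF rs bc])
  show "subring_generated (range x) \<subseteq> int_module.span (canonical_basis b c x)"
  proof
    fix y assume y: "y \<in> subring_generated (range x)"
    have l: "y \<in> laurents False UNIV (x 1) (x 2)" "y \<in> laurents False UNIV (x 0) (x 1)"
      "y \<in> laurents False UNIV (x 2) (x 3)" if "y \<in> subring_generated (range x)" for y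
      using subring_laurents[OF rs bc that, of 1] subring_laurents[OF rs bc that, of 0]
        subring_laurents[OF rs bc that, of 2] by simp_all
    have ex: "x 0 * x 2 = x 1 ^ b + 1" "x 1 * x 3 = x 2 ^ c + 1"
      using rank2_seq_exchange[OF rs, of 1] rank2_seq_exchange[OF rs, of 2] by (simp_all add: exch_exp_def)
    show "y \<in> int_module.span (canonical_basis b c x)"
    proof (rule greedy_expansion[OF rank2_seq_indep12[OF rs] rank2_seq_pos[OF rs] ex,
          where U = "subring_generated (range x)"])
      show "p - of_int n * q \<in> subring_generated (range x)"
        if "p \<in> subring_generated (range x)" "q \<in> int_module.span (canonical_basis b c x)" for p q n
        using that sub by (intro subring_generated.diff subring_generated.mult subring_generated_of_int) auto
      show "p + of_int n * q \<in> int_module.span (canonical_basis b c x)"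
        if "p \<in> int_module.span (canonical_basis b c x)" "q \<in> int_module.span (canonical_basis b c x)" for p q n
        using that by (intro int_module.span_add int_module.span_scale)
      show "\<exists>y\<in>int_module.span (canonical_basis b c x). pointed b c (p, q) (x 1) (x 2) y" for p q
      proof -
        have "\<exists>y\<in>canonical_basis b c x. pointed b c (p, q) (x 1) (x 2) y"
          using cluster_good_rank2[OF rs bc] unfolding cluster_good_def by blast
        then obtain y where "y \<in> canonical_basis b c x" "pointed b c (p, q) (x 1) (x 2) y" by (rule bexE)
        then show ?thesis by (intro bexI[of _ y] int_module.span_base)
      qed
    qed (use l y in \<open>simp_all add: int_module.span_zero\<close>)
  qed
qed

lemma positive_expansion_iff:
  "(\<exists>f. y = laurent_eval f u v \<and> (\<forall>k\<in>Poly_Mapping.keys f. 0 < Poly_Mapping.lookup f k)) \<longleftrightarrow>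
     y \<in> laurents True UNIV u v"
proof -
  have "(\<forall>k\<in>Poly_Mapping.keys f. 0 < Poly_Mapping.lookup f k) \<longleftrightarrow> nonneg_coeffs f"
    for f :: "(int \<times> int) \<Rightarrow>\<^sub>0 int"
    unfolding nonneg_coeffs_def by (metis in_keys_iff order.order_iff_strict)
  then show ?thesis unfolding laurents_def by auto
qed

lemma pos_int_combinationsE:
  assumes "y \<in> pos_int_combinations B"
  obtains S n where "finite S" "S \<noteq> {}" "S \<subseteq> B" "\<forall>b\<in>S. 0 < n b" "y = (\<Sum>b\<in>S. of_int (n b) * b)"
  using assms unfolding pos_int_combinations_def mem_Collect_eq by (elim exE conjE) (rule that)

lemma canonical_basis_positive:
  assumes rs: "rank2_seq b c x" and bc: "b * c \<le> 4"
  shows "{y \<in> subring_generated (range x). y \<noteq> 0 \<and> (\<forall>m. y \<in> laurents True UNIV (x m) (x (m + 1)))} =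
    pos_int_combinations (canonical_basis b c x)" (is "?P = _")
proof
  let ?B = "canonical_basis b c x"
  note ind = canonical_basis_independent[OF rs bc]
  show "?P \<subseteq> pos_int_combinations ?B"
  proof
    fix y assume y: "y \<in> ?P"
    define r where "r = int_module.representation ?B y"
    define S where "S = {b. r b \<noteq> 0}"
    have span: "y \<in> int_module.span ?B" using y canonical_basis_span[OF rs bc] by simp
    have S: "finite S" "S \<subseteq> ?B" "y = (\<Sum>b\<in>S. of_int (r b) * b)"
      using int_module.finite_representation[of ?B y] int_module.representation_ne_zero[of ?B y]
        int_module.sum_nonzero_representation_eq[OF ind span]
      unfolding S_def r_def by auto
    have "0 < r b" if b: "b \<in> S" for b
    proof -
      obtain m k where mk: "\<forall>f. laurent_eval f (x m) (x (m + 1)) = (\<Sum>y\<in>S. of_int (r y) * y) \<longrightarrow>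
           Poly_Mapping.lookup f k = r b"
        using combination_coefficient[OF rs bc S(1,2) b] by blast
      obtain f where f: "y = laurent_eval f (x m) (x (m + 1))" "nonneg_coeffs f"
        using y unfolding laurents_def by blast
      have "Poly_Mapping.lookup f k = r b" using mk f(1) S(3) by simp
      then have "0 \<le> r b" using f(2) unfolding nonneg_coeffs_def by metis
      then show ?thesis using b unfolding S_def by simp
    qed
    moreover have "S \<noteq> {}" using y S(3) by auto
    ultimately show "y \<in> pos_int_combinations ?B"
      unfolding pos_int_combinations_def using S by blast
  qed
  show "pos_int_combinations ?B \<subseteq> ?P"
  proof
    fix y assume "y \<in> pos_int_combinations ?B"
    then obtain S n where S: "finite S" "S \<noteq> {}" "S \<subseteq> ?B" "\<forall>b\<in>S. 0 < n b"
      and y: "y = (\<Sum>b\<in>S. of_int (n b) * b)"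
      by (rule pos_int_combinationsE)
    have "y \<in> int_module.span ?B"
      unfolding y using S(3) by (intro int_module.span_sum int_module.span_scale int_module.span_base) auto
    moreover have "y \<noteq> 0"
    proof
      assume "y = 0"
      then have "(\<Sum>b\<in>S. of_int (n b) * b) = 0" using y by simp
      moreover obtain b where b: "b \<in> S" using S(2) by blast
      ultimately have "n b = 0"
        using int_module.independentD[OF ind S(1,3), of n b] by simp
      then show False using S(4) b by auto
    qed
    moreover have "y \<in> laurents True UNIV (x m) (x (m + 1))" for m
      unfolding y using S(3,4)
      by (intro laurents_sum laurents_of_int_mult canonical_basis_cluster(1)[OF rs bc]) (auto intro: less_imp_le)
    ultimately show "y \<in> ?P" unfolding canonical_basis_span[OF rs bc] by simp
  qed
qed

section \<open>Uniqueness of the basis\<close>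

lemma representation_combination:
  assumes ind: "int_module.independent B" and S: "finite S" "S \<subseteq> B"
  shows "int_module.representation B (\<Sum>b\<in>S. of_int (n b) * b) = (\<lambda>b. if b \<in> S then n b else 0)"
proof (rule int_module.representation_eqI[OF ind])
  show "(\<Sum>b\<in>S. of_int (n b) * b) \<in> int_module.span B"
    using S by (intro int_module.span_sum int_module.span_scale int_module.span_base) auto
  show "(\<Sum>b | (if b \<in> S then n b else 0) \<noteq> 0. of_int (if b \<in> S then n b else 0) * b) = (\<Sum>b\<in>S. of_int (n b) * b)"
    by (rule sum.mono_neutral_cong_left) (use S in auto)
qed (use S in \<open>auto split: if_splits\<close>)

text \<open>A basis can be recovered as the set of indecomposable elements of its positive cone.\<close>

lemma positive_basis_subset:
  fixes B B' :: "'a::comm_ring_1 set"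
  assumes ind: "int_module.independent B" "int_module.independent B'"
    and eq: "pos_int_combinations B = pos_int_combinations B'"
  shows "B \<subseteq> B'"
proof
  fix b assume b: "b \<in> B"
  let ?r = "int_module.representation B"
  have rep: "y \<in> int_module.span B \<and> (\<forall>e. 0 \<le> ?r y e) \<and> (\<exists>e. 0 < ?r y e)"
    if y_in: "y \<in> pos_int_combinations B" for y
  proof -
    obtain S n where S: "finite S" "S \<noteq> {}" "S \<subseteq> B" "\<forall>b\<in>S. 0 < n b"
      and y: "y = (\<Sum>b\<in>S. of_int (n b) * b)"
      using y_in by (rule pos_int_combinationsE)
    have "?r y = (\<lambda>b. if b \<in> S then n b else 0)"
      unfolding y by (rule representation_combination[OF ind(1) S(1,3)])
    moreover have "y \<in> int_module.span B"
      unfolding y using S(3) by (intro int_module.span_sum int_module.span_scale int_module.span_base) auto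
    ultimately show ?thesis using S(2,4) by (auto intro: less_imp_le)
  qed
  have single: "e \<in> pos_int_combinations C" if "e \<in> C" for e :: 'a and C
    unfolding pos_int_combinations_def using that
    by (intro CollectI exI[of _ "{e}"] exI[of _ "\<lambda>_. 1"]) simp
  have "b \<in> pos_int_combinations B'" using single[OF b] eq by simp
  then obtain S n where S: "finite S" "S \<noteq> {}" "S \<subseteq> B'" "\<forall>e\<in>S. 0 < n e"
    and bS: "b = (\<Sum>e\<in>S. of_int (n e) * e)"
    by (rule pos_int_combinationsE)
  have e: "e \<in> int_module.span B" "\<And>d. 0 \<le> ?r e d" "\<exists>d. 0 < ?r e d" if "e \<in> S" for e
    using rep[of e] single[of e B'] S(3) that eq by auto
  have sum: "?r b d = (\<Sum>e\<in>S. n e * ?r e d)" for d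
    unfolding bS
    by (subst int_module.representation_sum[OF ind(1)])
      (auto simp: int_module.representation_scale[OF ind(1)] e int_module.span_scale intro!: sum.cong)
  have nn: "0 \<le> n d * ?r d d'" if "d \<in> S" for d d'
    using e(2)[OF that] S(4) that by (simp add: less_imp_le)
  obtain e0 where e0: "e0 \<in> S" using S(2) by blast
  \<comment> \<open>The summands of \<open>b\<close> have non-negative coordinates in
    \<open>B\<close>, which cannot cancel; away from \<open>b\<close> they sum to 0, so
    \<open>e0\<close> is a multiple of \<open>b\<close>. At \<open>b\<close> they sum to 1, which
    leaves only the coefficient 1 for \<open>e0\<close>.\<close>
  have zero: "?r e0 d = 0" if "d \<noteq> b" for d
  proof -
    have "(\<Sum>e\<in>S. n e * ?r e d) = 0"
      using sum[of d] that int_module.representation_basis[OF ind(1) b] by simp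
    then have "n e0 * ?r e0 d = 0"
      using S(1) e0 nn by (subst (asm) sum_nonneg_eq_0_iff) auto
    then show ?thesis using S(4) e0 by auto
  qed
  obtain d where "0 < ?r e0 d" using e(3)[OF e0] by blast
  then have pos: "0 < ?r e0 b" using zero[of d] by (cases "d = b") auto
  have "n e0 * ?r e0 b \<le> (\<Sum>e\<in>S. n e * ?r e b)"
    using S(1) e0 nn by (intro member_le_sum) auto
  also have "\<dots> = 1"
    using sum[of b] int_module.representation_basis[OF ind(1) b] by simp
  finally have "n e0 * ?r e0 b \<le> 1" .
  moreover have "0 < n e0" using S(4) e0 by blast
  ultimately have one: "?r e0 b = 1"
    using pos by (smt (verit) mult_le_cancel_right1)
  have "{d. ?r e0 d \<noteq> 0} = {b}" using zero one by auto
  then have "e0 = b"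
    using int_module.sum_nonzero_representation_eq[OF ind(1) e(1)[OF e0]] one by simp
  then show "b \<in> B'" using e0 S(3) by blast
qed

section \<open>The initial cluster in the fraction field\<close>

lemma Fract_sum: "Fract (sum h A) 1 = (\<Sum>a\<in>A. Fract (h a) 1)"
proof (induction A rule: infinite_finite_induct)
  case (insert a A)
  have "Fract (h a + sum h A) 1 = Fract (h a) 1 + Fract (sum h A) 1" by simp
  then show ?case using insert by simp
qed (simp_all add: fract_collapse)

lemma Fract_of_int: "of_int n = Fract (of_int n) 1"
  by (cases n rule: int_diff_cases) (simp flip: Fract_of_nat_eq)

lemma Fract_power: "Fract p 1 ^ n = Fract (p ^ n) 1"
  by (induction n) (simp_all add: fract_collapse)

text \<open>Multiplication by \<open>y1 ^ L * y2 ^ M\<close> makes all exponents non-negative. The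
  relation then holds in the polynomial ring, where the nested coefficients are those of
  \<open>f\<close>.\<close>

lemma laurent_indep_initial: "laurent_indep y1 y2"
  unfolding laurent_indep_def
proof (intro conjI allI impI)
  show nz: "y1 \<noteq> 0" "y2 \<noteq> 0" by (simp_all add: y1_def y2_def Zero_fract_def eq_fract)
  fix f assume f: "laurent_eval f y1 y2 = 0"
  obtain M where M: "\<And>i j. (i, j) \<in> Poly_Mapping.keys f \<Longrightarrow> 0 \<le> int M + j"
    using exponent_bound by blast
  obtain L where L: "\<And>i j. (i, j) \<in> Poly_Mapping.keys (swap_exponents f) \<Longrightarrow> 0 \<le> int L + j"
    using exponent_bound by blast
  have L': "0 \<le> int L + i" if "(i, j) \<in> Poly_Mapping.keys f" for i j
    using L[of j i] that by (auto simp: in_keys_iff)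
  define Q :: "int \<times> int \<Rightarrow> rat poly poly" where
    "Q k = monom (monom 1 (nat (int L + fst k))) (nat (int M + snd k))" for k
  have y1p: "y1 ^ n = Fract [:monom 1 n:] 1" for n
    unfolding y1_def Fract_power by (simp add: poly_const_pow monom_altdef)
  have y2p: "y2 ^ n = Fract (monom 1 n) 1" for n
    unfolding y2_def Fract_power by (simp add: monom_altdef)
  have Q: "Fract (Q k) 1 = y1 ^ L * y1 powi fst k * (y2 ^ M * y2 powi snd k)" if "k \<in> Poly_Mapping.keys f" for k
  proof -
    have "0 \<le> int L + fst k" "0 \<le> int M + snd k"
      using L'[of "fst k" "snd k"] M[of "fst k" "snd k"] that by simp_all
    then have "y1 ^ L * y1 powi fst k = y1 ^ nat (int L + fst k)" "y2 ^ M * y2 powi snd k = y2 ^ nat (int M + snd k)"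
      using nz power_int_add[of y1 "int L" "fst k"] power_int_add[of y2 "int M" "snd k"]
      by (simp_all add: power_int_def)
    then show ?thesis by (simp add: Q_def y1p y2p smult_monom)
  qed
  have "Fract (\<Sum>k\<in>Poly_Mapping.keys f. of_int (Poly_Mapping.lookup f k) * Q k) 1 =
      (\<Sum>k\<in>Poly_Mapping.keys f. of_int (Poly_Mapping.lookup f k) * Fract (Q k) 1)"
    unfolding Fract_sum Fract_of_int by simp
  also have "\<dots> = y1 ^ L * y2 ^ M * laurent_eval f y1 y2"
    unfolding laurent_eval_superset[OF finite_keys subset_refl] sum_distrib_left
    by (intro sum.cong refl) (simp add: Q)
  also have "\<dots> = Fract 0 1" unfolding f by (simp add: Zero_fract_def)
  finally have "(\<Sum>k\<in>Poly_Mapping.keys f. of_int (Poly_Mapping.lookup f k) * Q k) = 0"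
    by (simp add: eq_fract)
  moreover have "coeff (coeff (\<Sum>k\<in>Poly_Mapping.keys f. of_int (Poly_Mapping.lookup f k) * Q k)
      (nat (int M + j))) (nat (int L + i)) = of_int (Poly_Mapping.lookup f (i, j))"
    if ij: "(i, j) \<in> Poly_Mapping.keys f" for i j
  proof -
    have "coeff (coeff (of_int n * Q k) (nat (int M + j))) (nat (int L + i)) = (if k = (i, j) then of_int n else 0)"
      if k: "k \<in> Poly_Mapping.keys f" for k n
    proof -
      have "nat (int M + snd k) = nat (int M + j) \<longleftrightarrow> snd k = j" "nat (int L + fst k) = nat (int L + i) \<longleftrightarrow> fst k = i"
        using M[OF ij] L'[OF ij] M[of "fst k" "snd k"] L'[of "fst k" "snd k"] k by auto
      then show ?thesis by (cases k) (auto simp: Q_def of_int_poly)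
    qed
    then show ?thesis using ij by (simp add: coeff_sum sum.delta)
  qed
  ultimately have "Poly_Mapping.lookup f (i, j) = 0" if "(i, j) \<in> Poly_Mapping.keys f" for i j
    using that by fastforce
  then show "f = 0"
    by (intro poly_mapping_eqI) (metis in_keys_iff lookup_zero surj_pair)
qed

text \<open>Independence spreads from the initial cluster in both directions by
  \<open>laurent_indep_mutation\<close>.\<close>

lemma rank2_seq_cluster_var:
  assumes "b > 0" "c > 0"
  shows "rank2_seq b c (cluster_var b c)"
proof -
  let ?x = "cluster_var b c"
  have ex: "?x (m - 1) * ?x (m + 1) = ?x m ^ exch_exp b c m + 1" for m
    using exchange_relation[of b c m] by (simp add: exch_exp_def)
  have e: "exch_exp b c m > 0" for m using assms by (simp add: exch_exp_def)
  have "laurent_indep (?x m) (?x (m + 1))" for m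
  proof (rule int_induct_both[where a = 1 and m = m and Q = "\<lambda>m. laurent_indep (?x m) (?x (m + 1))"])
    show "laurent_indep (?x 1) (?x (1 + 1))"
      using laurent_indep_initial by (simp add: cluster_var_initial)
  next
    fix m assume m: "laurent_indep (?x m) (?x (m + 1))"
    have "?x (m + 1 + 1) * ?x m = ?x (m + 1) ^ exch_exp b c (m + 1) + 1"
      using ex[of "m + 1"] by (simp add: mult.commute)
    then show "laurent_indep (?x (m + 1)) (?x (m + 1 + 1))"
      using laurent_indep_mutation[OF laurent_indep_sym[OF m] e] by blast
  next
    fix m assume m: "laurent_indep (?x m) (?x (m + 1))"
    show "laurent_indep (?x (m - 1)) (?x (m - 1 + 1))"
      using laurent_indep_sym[OF laurent_indep_mutation[OF m e ex]] by simp
  qed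
  then show ?thesis unfolding rank2_seq_def using assms ex by blast
qed

theorem theorem2p3:
  fixes b c :: nat
  assumes "b > 0" and "c > 0" and "b * c \<le> 4"
  shows "\<exists>!B. is_int_basis B (cluster_algebra b c) \<and>
              positive_elements b c = pos_int_combinations B"
proof -
  have rs: "rank2_seq b c (cluster_var b c)" by (rule rank2_seq_cluster_var[OF assms(1,2)])
  show ?thesis
  proof (rule ex1I)
    show "is_int_basis (canonical_basis b c (cluster_var b c)) (cluster_algebra b c) \<and>
        positive_elements b c = pos_int_combinations (canonical_basis b c (cluster_var b c))"
      unfolding is_int_basis_def positive_elements_def positive_expansion_iff cluster_algebra_def
      using canonical_basis_independent[OF rs assms(3)] canonical_basis_span[OF rs assms(3)]
        canonical_basis_positive[OF rs assms(3)] by blast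
    then show "B = canonical_basis b c (cluster_var b c)"
      if "is_int_basis B (cluster_algebra b c) \<and> positive_elements b c = pos_int_combinations B" for B
      using that positive_basis_subset unfolding is_int_basis_def by (metis subset_antisym)
  qed
qed

end
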